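(* Let $n\in\mathbb N_+$, $\varepsilon\in\mathbb N^{-1}$ and $\tilde\varepsilon=2\ln\bigl(1+2^{-\lceil\log(2/\varepsilon)\rceil}\bigr)\in(\tfrac49\varepsilon,\varepsilon]$. Then there is a deterministic algorithm ${\tt GeoSample}_{n,\varepsilon}:[n]\times[d]_+\to[n]$ with $\log d=O(n\log(1/\varepsilon))$ having the following properties: (i) for every $c\in[n]$, ${\tt GeoSample}_{n,\varepsilon}(c,U)$ with $U\sim\mathrm{Unif}([d]_+)$ is identically distributed to $c+\mathrm{Geo}(2/\tilde\varepsilon)$ clamped to the interval $[0,n]$; consequently ${\tt GeoSample}_{n,\varepsilon}$ is $(\tilde\varepsilon/2,0)$-differentially private for counting queries and has $(a,\beta)$-accuracy for every $\beta\in(0,1]$ with $a=\lceil\frac{2}{\tilde\varepsilon}\ln\frac1\beta\rceil$; (ii) ${\tt GeoSample}_{n,\varepsilon}$ has running time $\tilde O(n\log(1/\varepsilon))$; (iii) for every $z\in[n]$, $F_{{\tt GeoSample}_{n,\varepsilon}}(z)$ can be computed in time $\tilde O(n\log(1/\varepsilon))$; (iv) for each $c$, ${\tt GeoSample}_{n,\varepsilon}(c,u)$ is a non-decreasing function of $u$.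
   Context: Notation: $\mathbb N=\{0,1,\dots\}$, $\mathbb N_+=\{1,2,\dots\}$, $\mathbb N^{-1}=\{1/k:k\in\mathbb N_+\}$; $[n]=\{0,\dots,n\}$, $[n]_+=\{1,\dots,n\}$; $\log$ is base 2. For $s>0$ and $c\in\mathbb Z$, $c+\mathrm{Geo}(s)$ denotes the integer-valued random variable with probability mass function proportional to $e^{-|z-c|/s}$; "clamped to $[0,n]$" means values below $0$ are replaced by $0$ and values above $n$ by $n$. A randomized algorithm on datasets in $\mathcal X^n$ is $(\varepsilon,\delta)$-differentially private if for all datasets $D,D'$ differing in exactly one row and all output sets $S$, $\Pr[\mathcal M(D)\in S]\le e^\varepsilon\Pr[\mathcal M(D')\in S]+\delta$. A map $\mathcal M:[n]\times[d]_+\to[n]$ is $(\varepsilon,\delta)$-differentially private for counting queries if the algorithm $D\in\{0,1\}^n\mapsto\mathcal M(\sum_iD_i,U)$ with $U\sim\mathrm{Unif}([d]_+)$ is $(\varepsilon,\delta)$-differentially private; it has $(a,\beta)$-accuracy if $\Pr[|\mathcal M(c,U)-c|\le a]\ge1-\beta$ for all $c\in[n]$. For deterministic $\mathcal M$, $F_{\mathcal M}(z)=d\cdot\Pr[\mathcal M(0,U)\le z]$ for $z\in[n]$. Running times are in the $w$-bit word RAM model with $w$ logarithmic in the input length, with unit-cost access to an oracle returning a uniform element of $[d]_+$, and multiplication of two $x$-bit integers costing $\tilde O(x)$.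
   Formalization: At ε=1 the bound n·log(1/ε) is 0, which would force d=1 (contradicting (i)) and zero running time; so log(1/ε) is read as max(1, log(1/ε)) in the bound on log d and in both running times, and n·max(1, log(1/ε)) is taken as the input length. Nothing changes for ε≤1/2. *)

theory Defs
  imports "HOL-Probability.Probability"
begin

section \<open>Parameters\<close>

definition reciprocals :: "real set" where
  "reciprocals = {1 / real k | k. 0 < k}"

definition eps_tilde :: "real \<Rightarrow> real" where
  "eps_tilde \<epsilon> = 2 * ln (1 + 2 powr (- of_int \<lceil>log 2 (2 / \<epsilon>)\<rceil>))"

text \<open>The quantity \<open>n log (1 / \<epsilon>)\<close>. At \<open>\<epsilon> = 1\<close> the logarithm vanishes, so it is replaced by
  \<open>1\<close> there; for the other reciprocals of integers, \<open>\<epsilon> \<le> 1 / 2\<close> and the maximum has no effect. Up to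
  constants this is \<open>log d\<close>, the number of bits of the argument \<open>u\<close>, hence it also serves as the
  input length that determines the word size.\<close>

definition nlog :: "nat \<Rightarrow> real \<Rightarrow> real" where
  "nlog n \<epsilon> = real n * max 1 (log 2 (1 / \<epsilon>))"

text \<open>\<open>f = \<^emph>\<open>soft-O\<close>(g)\<close>: \<open>f = O(g \<cdot> polylog g)\<close>, with one pair of constants for all of \<open>A\<close>.\<close>

definition soft_O_on :: "'a set \<Rightarrow> ('a \<Rightarrow> real) \<Rightarrow> ('a \<Rightarrow> real) \<Rightarrow> bool" where
  "soft_O_on A f g \<longleftrightarrow>
     (\<exists>(C::real) (j::nat). \<forall>x\<in>A. f x \<le> C * g x * (1 + log 2 (1 + g x)) ^ j)"


section \<open>The geometric distribution and privacy\<close>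

text \<open>\<open>geo c s\<close> is the distribution of \<open>c + Geo(s)\<close>.\<close>

definition geo :: "int \<Rightarrow> real \<Rightarrow> int pmf" where
  "geo c s = embed_pmf (\<lambda>z. exp (- \<bar>real_of_int (z - c)\<bar> / s) /
                            (\<Sum>\<^sub>\<infinity>y\<in>UNIV. exp (- \<bar>real_of_int (y - c)\<bar> / s)))"

lemma geo_weight_summable:
  fixes c :: int and s :: real
  assumes "s > 0"
  shows "(\<lambda>z. exp (- \<bar>real_of_int (z - c)\<bar> / s)) summable_on UNIV"
proof -
  let ?f = "\<lambda>z. exp (- \<bar>real_of_int (z - c)\<bar> / s)"
  have g: "(\<lambda>k::nat. exp (- real k / s)) summable_on UNIV"
  proof -
    have "summable (\<lambda>k::nat. exp (- 1 / s) ^ k)"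
      using assms by (intro summable_geometric) auto
    then have "summable (\<lambda>k::nat. exp (- real k / s))"
      by (simp flip: exp_of_nat_mult)
    then show ?thesis
      by (subst summable_on_UNIV_nonneg_real_iff) auto
  qed
  have inj1: "inj (\<lambda>k. c + int k)" and inj2: "inj (\<lambda>k. c - int k)"
    by (auto intro: injI)
  have 1: "?f summable_on range (\<lambda>k. c + int k)"
    by (subst summable_on_reindex[OF inj1]) (use g in \<open>simp add: o_def\<close>)
  have 2: "?f summable_on range (\<lambda>k. c - int k)"
    by (subst summable_on_reindex[OF inj2]) (use g in \<open>simp add: o_def\<close>)
  have "z \<in> range (\<lambda>k. c + int k) \<union> range (\<lambda>k. c - int k)" for z
  proof (cases "z \<ge> c")
    case True
    then have "z = c + int (nat (z - c))" by simp
    then show ?thesis by blast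
  next
    case False
    then have "z = c - int (nat (c - z))" by simp
    then show ?thesis by blast
  qed
  then have "UNIV = range (\<lambda>k. c + int k) \<union> range (\<lambda>k. c - int k)" by blast
  then show ?thesis using summable_on_union[OF 1 2] by simp
qed

lemma pmf_geo:
  assumes "s > 0"
  shows "pmf (geo c s) z = exp (- \<bar>real_of_int (z - c)\<bar> / s) /
           (\<Sum>\<^sub>\<infinity>y\<in>UNIV. exp (- \<bar>real_of_int (y - c)\<bar> / s))"
proof -
  define f where "f = (\<lambda>z. exp (- \<bar>real_of_int (z - c)\<bar> / s))"
  define Z where "Z = infsum f UNIV"
  have sf: "f summable_on UNIV"
    unfolding f_def by (rule geo_weight_summable[OF assms])
  have "0 < f c" by (simp add: f_def)
  also have "f c = infsum f {c}" by simp
  also have "\<dots> \<le> Z"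
    unfolding Z_def by (rule infsum_mono_neutral[OF _ sf]) (auto simp: f_def)
  finally have Z: "Z > 0" .
  have s: "(\<lambda>z. f z / Z) summable_on UNIV"
    using summable_on_cmult_left[OF sf, of "1 / Z"] by simp
  have abs: "Infinite_Set_Sum.abs_summable_on (\<lambda>z. f z / Z) UNIV"
  proof -
    have "(\<lambda>z. norm (f z / Z)) = (\<lambda>z. f z / Z)"
      using Z by (auto simp: f_def)
    then show ?thesis
      using s by (subst abs_summable_equivalent[symmetric]) (simp only:)
  qed
  have "0 \<le> f z / Z" for z
    using Z by (simp add: f_def)
  moreover have "infsum (\<lambda>z. f z / Z) UNIV = 1"
    using infsum_cmult_left[of "1 / Z" f UNIV] sf Z by (simp add: Z_def)
  ultimately have "(\<integral>\<^sup>+z. ennreal (f z / Z) \<partial>count_space UNIV) = 1"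
    using nn_integral_conv_infsetsum[OF abs] infsetsum_infsum[OF abs] by simp
  then have "pmf (embed_pmf (\<lambda>z. f z / Z)) z = f z / Z"
    using Z by (intro pmf_embed_pmf) (auto simp: f_def)
  then show ?thesis by (simp add: geo_def f_def Z_def)
qed

definition clamp_to :: "nat \<Rightarrow> int \<Rightarrow> nat" where
  "clamp_to n z = nat (max 0 (min (int n) z))"

definition differentially_private ::
  "'x set \<Rightarrow> nat \<Rightarrow> real \<Rightarrow> real \<Rightarrow> ('x list \<Rightarrow> 'y pmf) \<Rightarrow> bool" where
  "differentially_private X n \<epsilon> \<delta> M \<longleftrightarrow>
     (\<forall>D D'. set D \<subseteq> X \<and> set D' \<subseteq> X \<and> length D = n \<and> length D' = n \<and>
        card {i. i < n \<and> D ! i \<noteq> D' ! i} = 1 \<longrightarrow>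
        (\<forall>S. measure_pmf.prob (M D) S \<le> exp \<epsilon> * measure_pmf.prob (M D') S + \<delta>))"

text \<open>For a map \<open>M : [n] \<times> [d]\<^sub>+ \<rightarrow> [n]\<close>, \<open>M_dist d M c\<close> is the distribution of \<open>M(c, U)\<close>, where
  \<open>U\<close> is uniform on \<open>[d]\<^sub>+\<close>.\<close>

definition M_dist :: "nat \<Rightarrow> (nat \<Rightarrow> nat \<Rightarrow> nat) \<Rightarrow> nat \<Rightarrow> nat pmf" where
  "M_dist d M c = map_pmf (M c) (pmf_of_set {1..d})"

definition dp_counting :: "nat \<Rightarrow> nat \<Rightarrow> real \<Rightarrow> real \<Rightarrow> (nat \<Rightarrow> nat \<Rightarrow> nat) \<Rightarrow> bool" where
  "dp_counting n d \<epsilon> \<delta> M \<longleftrightarrow>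
     differentially_private {0, 1::nat} n \<epsilon> \<delta> (\<lambda>D. M_dist d M (sum_list D))"

definition accurate :: "nat \<Rightarrow> nat \<Rightarrow> real \<Rightarrow> real \<Rightarrow> (nat \<Rightarrow> nat \<Rightarrow> nat) \<Rightarrow> bool" where
  "accurate n d a \<beta> M \<longleftrightarrow>
     (\<forall>c\<le>n. measure_pmf.prob (M_dist d M c) {y. \<bar>real y - real c\<bar> \<le> a} \<ge> 1 - \<beta>)"

definition scaled_cdf :: "nat \<Rightarrow> (nat \<Rightarrow> nat \<Rightarrow> nat) \<Rightarrow> nat \<Rightarrow> real" where
  "scaled_cdf d M z = real d * measure_pmf.prob (M_dist d M 0) {y. y \<le> z}"


section \<open>The word RAM\<close>

text \<open>
  A \<open>w\<close>-bit word RAM with finitely many registers per program and a memory of \<open>2 ^ w\<close> words,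
  programmed with structured control flow. Words are naturals below \<open>2 ^ w\<close>. Every word operation,
  memory access and test takes one unit of time. The bulk instruction \<open>BigMul\<close> multiplies two
  integers of \<open>l\<close> words each; its cost is a parameter \<open>mulcost\<close> of the model, applied to the
  number \<open>l * w\<close> of bits.
\<close>

datatype binop = Add | Sub | Mul | Div | Mod | And | Or | Xor | Shl | Shr | Less | Eq

type_synonym reg = nat

datatype com =
    Skip
  | Const reg nat
  | Op binop reg reg reg   \<comment> \<open>target, left operand, right operand\<close>
  | Load reg reg           \<comment> \<open>target, register holding the address\<close>
  | Store reg reg          \<comment> \<open>register holding the address, source\<close>
  | BigMul reg reg reg reg \<comment> \<open>addresses of product and factors, length of the factors\<close>
  | Seq com com
  | Cond reg com com
  | While reg com

type_synonym state = "(reg \<Rightarrow> nat) \<times> (nat \<Rightarrow> nat)"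

fun apply_op :: "nat \<Rightarrow> binop \<Rightarrow> nat \<Rightarrow> nat \<Rightarrow> nat" where
  "apply_op w Add x y = (x + y) mod 2 ^ w"
| "apply_op w Sub x y = (x + 2 ^ w - y) mod 2 ^ w"
| "apply_op w Mul x y = (x * y) mod 2 ^ w"
| "apply_op w Div x y = x div y"
| "apply_op w Mod x y = x mod y"
| "apply_op w And x y = Bit_Operations.and x y"
| "apply_op w Or x y = Bit_Operations.or x y"
| "apply_op w Xor x y = Bit_Operations.xor x y"
| "apply_op w Shl x y = (x * 2 ^ y) mod 2 ^ w"
| "apply_op w Shr x y = x div 2 ^ y"
| "apply_op w Less x y = (if x < y then 1 else 0)"
| "apply_op w Eq x y = (if x = y then 1 else 0)"

text \<open>Long integers are stored in consecutive words, least significant word first.\<close>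

definition digit :: "nat \<Rightarrow> nat \<Rightarrow> nat \<Rightarrow> nat" where
  "digit w x i = (x div 2 ^ (w * i)) mod 2 ^ w"

definition bignum :: "nat \<Rightarrow> (nat \<Rightarrow> nat) \<Rightarrow> nat \<Rightarrow> nat \<Rightarrow> nat" where
  "bignum w m a l = (\<Sum>i<l. m (a + i) * 2 ^ (w * i))"

text \<open>\<open>exec mulcost w P s t s'\<close>: started in \<open>s\<close>, the program \<open>P\<close> halts in \<open>s'\<close> after time \<open>t\<close>. A
  \<open>BigMul\<close> that would leave the memory has no successor state, so such a run does not halt.\<close>

inductive exec :: "(nat \<Rightarrow> nat) \<Rightarrow> nat \<Rightarrow> com \<Rightarrow> state \<Rightarrow> nat \<Rightarrow> state \<Rightarrow> bool"
  for mulcost :: "nat \<Rightarrow> nat" and w :: nat where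
  Skip: "exec mulcost w Skip s 1 s"
| Const: "exec mulcost w (Const r k) (R, m) 1 (R(r := k mod 2 ^ w), m)"
| Op: "exec mulcost w (Op f r a b) (R, m) 1 (R(r := apply_op w f (R a) (R b)), m)"
| Load: "exec mulcost w (Load r a) (R, m) 1 (R(r := m (R a)), m)"
| Store: "exec mulcost w (Store a r) (R, m) 1 (R, m(R a := R r))"
| BigMul: "R x + R l \<le> 2 ^ w \<Longrightarrow> R y + R l \<le> 2 ^ w \<Longrightarrow> R z + 2 * R l \<le> 2 ^ w \<Longrightarrow>
    p = bignum w m (R x) (R l) * bignum w m (R y) (R l) \<Longrightarrow>
    exec mulcost w (BigMul z x y l) (R, m) (1 + mulcost (R l * w))
      (R, \<lambda>a. if R z \<le> a \<and> a < R z + 2 * R l then digit w p (a - R z) else m a)"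
| Seq: "exec mulcost w P s t s' \<Longrightarrow> exec mulcost w Q s' t' s'' \<Longrightarrow>
    exec mulcost w (Seq P Q) s (t + t') s''"
| CondTrue: "fst s r \<noteq> 0 \<Longrightarrow> exec mulcost w P s t s' \<Longrightarrow> exec mulcost w (Cond r P Q) s (1 + t) s'"
| CondFalse: "fst s r = 0 \<Longrightarrow> exec mulcost w Q s t s' \<Longrightarrow> exec mulcost w (Cond r P Q) s (1 + t) s'"
| WhileFalse: "fst s r = 0 \<Longrightarrow> exec mulcost w (While r P) s 1 s"
| WhileTrue: "fst s r \<noteq> 0 \<Longrightarrow> exec mulcost w P s t s' \<Longrightarrow> exec mulcost w (While r P) s' t' s'' \<Longrightarrow>
    exec mulcost w (While r P) s (1 + t + t') s''"

inductive_cases exec_SkipE: "exec mulcost w Skip s t s'"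
inductive_cases exec_ConstE: "exec mulcost w (Const r k) s t s'"
inductive_cases exec_OpE: "exec mulcost w (Op f r a b) s t s'"
inductive_cases exec_LoadE: "exec mulcost w (Load r a) s t s'"
inductive_cases exec_StoreE: "exec mulcost w (Store a r) s t s'"
inductive_cases exec_BigMulE: "exec mulcost w (BigMul z x y l) s t s'"
inductive_cases exec_SeqE: "exec mulcost w (Seq P Q) s t s'"
inductive_cases exec_CondE: "exec mulcost w (Cond r P Q) s t s'"
inductive_cases exec_WhileE: "exec mulcost w (While r P) s t s'"

lemma exec_deterministic:
  "exec mulcost w P s t s' \<Longrightarrow> exec mulcost w P s u s'' \<Longrightarrow> u = t \<and> s'' = s'"
proof (induction arbitrary: u s'' rule: exec.induct)
  case (Seq P s t s1 Q t' s2)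
  from Seq.prems obtain v r v' where "exec mulcost w P s v r" "exec mulcost w Q r v' s''" "u = v + v'"
    by (rule exec_SeqE)
  with Seq.IH show ?case by blast
next
  case (CondTrue s r P t s' Q)
  from CondTrue.prems CondTrue.hyps obtain v where "exec mulcost w P s v s''" "u = 1 + v"
    by (auto elim: exec_CondE)
  with CondTrue.IH show ?case by blast
next
  case (CondFalse s r Q t s' P)
  from CondFalse.prems CondFalse.hyps obtain v where "exec mulcost w Q s v s''" "u = 1 + v"
    by (auto elim: exec_CondE)
  with CondFalse.IH show ?case by blast
next
  case (WhileFalse s r P)
  from WhileFalse.prems WhileFalse.hyps show ?case by (auto elim: exec_WhileE)
next
  case (WhileTrue s r P t s1 t' s2)
  from WhileTrue.prems WhileTrue.hyps obtain v q v'
    where "exec mulcost w P s v q" "exec mulcost w (While r P) q v' s''" "u = 1 + v + v'"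
    by (auto elim: exec_WhileE)
  with WhileTrue.IH show ?case by blast
qed (auto elim: exec_SkipE exec_ConstE exec_OpE exec_LoadE exec_StoreE exec_BigMulE)

definition num_words :: "nat \<Rightarrow> nat \<Rightarrow> nat" where
  "num_words w x = (LEAST l. x < 2 ^ (w * l))"

definition words_of :: "nat \<Rightarrow> nat \<Rightarrow> nat list" where
  "words_of w x = map (digit w x) [0..<num_words w x]"

text \<open>The inputs \<open>xs\<close> are stored one after the other, starting at address \<open>0\<close>, in a memory that is
  zero elsewhere. Registers \<open>2 * i\<close> and \<open>2 * i + 1\<close> hold the address and the number of words of the
  \<open>i\<close>-th input. On halting, registers \<open>0\<close> and \<open>1\<close> hold the address and the number of words of the
  output.\<close>

definition input_state :: "nat \<Rightarrow> nat list \<Rightarrow> state" where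
  "input_state w xs =
    (let ws = map (words_of w) xs; memory = concat ws in
      (\<lambda>r. if r div 2 < length xs
            then if even r then length (concat (take (r div 2) ws)) else length (ws ! (r div 2))
            else 0,
       \<lambda>a. if a < length memory then memory ! a else 0))"

definition result_of :: "nat \<Rightarrow> state \<Rightarrow> nat" where
  "result_of w s = bignum w (snd s) (fst s 0) (fst s 1)"

text \<open>
  \<open>computable_in_soft_O mulcost I len g inp f\<close>: a single program computes \<open>f\<close> on all instances in
  \<open>I\<close> in time soft-O of \<open>g\<close>. The instance \<open>i\<close> is presented as the list \<open>inp i\<close> of naturals and has
  input length \<open>len i\<close>. The word size is logarithmic in the input length: the program works for
  every word size between \<open>\<kappa>\<close> and \<open>\<kappa>'\<close> times the logarithm of the length, where \<open>\<kappa>\<close> belongs to the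
  program and only the constants of the running time may depend on \<open>\<kappa>'\<close>.
\<close>

definition computable_in_soft_O ::
  "(nat \<Rightarrow> nat) \<Rightarrow> 'i set \<Rightarrow> ('i \<Rightarrow> real) \<Rightarrow> ('i \<Rightarrow> real) \<Rightarrow> ('i \<Rightarrow> nat list) \<Rightarrow> ('i \<Rightarrow> real) \<Rightarrow> bool"
  where
  "computable_in_soft_O mulcost I len g inp f \<longleftrightarrow>
     (\<exists>P (\<kappa>::real). \<forall>\<kappa>'::real. \<exists>T. soft_O_on I T g \<and>
       (\<forall>i\<in>I. \<forall>w::nat.
          \<kappa> * log 2 (2 + len i) \<le> real w \<and> real w \<le> \<kappa>' * log 2 (2 + len i) \<longrightarrow>
          (\<exists>t s. exec mulcost w P (input_state w (inp i)) t s \<and>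
                 real t \<le> T i \<and> real (result_of w s) = f i)))"

text \<open>The encoding of \<open>\<epsilon> = 1 / k\<close> as program input is the integer \<open>k\<close>.\<close>

definition recip :: "real \<Rightarrow> nat" where
  "recip \<epsilon> = nat \<lfloor>1 / \<epsilon>\<rfloor>"

end

theory Submission
  imports Defs
begin

text \<open>
  With \<open>m = \<lceil>log (2 / \<epsilon>)\<rceil>\<close> and \<open>q = 2\<^sup>m\<close> one has \<open>exp (- \<epsilon>' / 2) = q / (q + 1)\<close> for \<open>\<epsilon>' = eps_tilde \<epsilon>\<close>, so all
  cumulative probabilities of the clamped distribution are multiples of \<open>1 / d\<close> for
  \<open>d = (2 q + 1) (q + 1)\<^bsup>n - 1\<^esup>\<close>. The sampler is the inversion method: it returns the least \<open>z\<close> with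
  \<open>u \<le> d Pr[c + Geo \<le> z]\<close>, found by binary search, where each comparison needs a single number
  \<open>q\<^bsup>a\<^esup> (q + 1)\<^bsup>n - a\<^esup>\<close>, computed by repeated squaring.

  On the word RAM, all long integers are kept in buffers of one common length \<open>L\<close>, with \<open>2\<^bsup>w L\<^esup> > d\<close>, and
  all arithmetic is modulo \<open>2\<^bsup>w L\<^esup>\<close>, so that intermediate overflow (in the last squaring) is harmless.
  Only multiplication and subtraction with borrow are needed: comparison is the borrow, copying is
  multiplication by one, and addition is subtraction of the negative. The loops for powers and for
  binary search have at most \<open>w\<close> rounds, since each round halves a number below \<open>2\<^sup>w\<close>.
\<close>


section \<open>The inversion sampler\<close>

text \<open>With \<open>r = q / (q + 1)\<close>, the tail of \<open>Geo\<close> from distance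
  \<open>a\<close> on has mass \<open>r ^ a / (1 + r)\<close>, and
  \<open>1 + r = (2 q + 1) / (q + 1)\<close>. Clamping confines \<open>a\<close> to
  \<open>a \<le> n\<close>, so one common denominator clears all these fractions: it is
  \<open>d\<close>, and the numerators are \<open>geo_term q n a\<close>. The time bound shapes the
  algorithm. A number with as many bits as \<open>d\<close> already has about
  \<open>n log(1 / \<epsilon>)\<close> bits, so only polylogarithmically many long operations are
  affordable. Accumulating the probabilities one by one would take \<open>n\<close> of them. Hence
  every comparison uses a closed form for a single tail: the lower tail for \<open>z < c\<close>,
  the upper tail for \<open>c \<le> z\<close>.\<close>

definition geo_term :: "nat \<Rightarrow> nat \<Rightarrow> nat \<Rightarrow> nat" where
  "geo_term q n a = q ^ a * (q + 1) ^ (n - a)"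

text \<open>
  \<open>geo_total\<close> is the \<open>d\<close> of the theorem, and \<open>geo_cdf q n c z\<close> is \<open>d\<close> times the probability that
  \<open>c + Geo\<close>, clamped to \<open>[0, n]\<close>, is at most \<open>z\<close>.
\<close>

definition geo_total :: "nat \<Rightarrow> nat \<Rightarrow> nat" where
  "geo_total q n = geo_term q n 0 + geo_term q n 1"

definition geo_cdf :: "nat \<Rightarrow> nat \<Rightarrow> nat \<Rightarrow> nat \<Rightarrow> nat" where
  "geo_cdf q n c z =
    (if z < c then geo_term q n (c - z)
     else if z < n then geo_total q n - geo_term q n (z + 1 - c)
     else geo_total q n)"

definition geo_sample :: "nat \<Rightarrow> nat \<Rightarrow> nat \<Rightarrow> nat \<Rightarrow> nat" where
  "geo_sample q n c u = (LEAST z. u \<le> geo_cdf q n c z)"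

lemma geo_term_antimono:
  assumes "a \<le> b" "b \<le> n"
  shows "geo_term q n b \<le> geo_term q n a"
proof -
  have "geo_term q n b = q ^ a * (q ^ (b - a) * (q + 1) ^ (n - b))"
    using assms by (simp add: geo_term_def flip: power_add mult.assoc)
  also have "\<dots> \<le> q ^ a * ((q + 1) ^ (b - a) * (q + 1) ^ (n - b))"
    by (intro mult_left_mono mult_right_mono power_mono) auto
  also have "\<dots> = geo_term q n a"
    using assms by (simp add: geo_term_def flip: power_add)
  finally show ?thesis .
qed

lemma geo_term_le_total: "a \<le> n \<Longrightarrow> geo_term q n a \<le> geo_total q n"
  using geo_term_antimono[of 0 a n q] by (simp add: geo_total_def)

lemma geo_cdf_le_total: "c \<le> n \<Longrightarrow> geo_cdf q n c z \<le> geo_total q n"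
  by (simp add: geo_cdf_def geo_term_le_total)

text \<open>Within one branch this is antitonicity of \<open>geo_term\<close>. Crossing from below
  \<open>c\<close> to above it works because the lower side never exceeds
  \<open>geo_term q n 0\<close>, and \<open>geo_total\<close> minus an upper tail is at least
  \<open>geo_total - geo_term q n 1\<close>, which is the same number.\<close>

lemma geo_cdf_mono:
  assumes "c \<le> n" "z \<le> z'"
  shows "geo_cdf q n c z \<le> geo_cdf q n c z'"
proof -
  consider "z' < c" | "z < c" "c \<le> z'" "z' < n" | "c \<le> z" "z' < n" | "n \<le> z'"
    by linarith
  then show ?thesis
  proof cases
    case 1
    then show ?thesis using assms by (simp add: geo_cdf_def geo_term_antimono)
  next
    case 2
    have "geo_term q n (c - z) \<le> geo_term q n 0" using assms by (intro geo_term_antimono) auto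
    moreover have "geo_term q n (z' + 1 - c) \<le> geo_term q n 1"
      using 2 by (intro geo_term_antimono) auto
    ultimately show ?thesis using 2 by (simp add: geo_cdf_def geo_total_def)
  next
    case 3
    then show ?thesis using assms by (auto simp: geo_cdf_def intro!: diff_le_mono2 geo_term_antimono)
  next
    case 4
    then show ?thesis using assms geo_cdf_le_total[of c n q z] by (simp add: geo_cdf_def[of q n c z'])
  qed
qed

lemma geo_cdf_top: "c \<le> n \<Longrightarrow> geo_cdf q n c n = geo_total q n"
  by (simp add: geo_cdf_def)

text \<open>The Galois connection between a distribution function and its quantile function. It
  yields the distribution of the sampler, its monotonicity in \<open>u\<close>, and the test of the
  binary search.\<close>

lemma geo_sample_le_iff:
  assumes "c \<le> n" "u \<le> geo_total q n"
  shows "geo_sample q n c u \<le> z \<longleftrightarrow> u \<le> geo_cdf q n c z"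
proof
  have "u \<le> geo_cdf q n c (geo_sample q n c u)"
    unfolding geo_sample_def by (rule LeastI[where k = n]) (use assms in \<open>simp add: geo_cdf_top\<close>)
  moreover assume "geo_sample q n c u \<le> z"
  ultimately show "u \<le> geo_cdf q n c z" using geo_cdf_mono[OF assms(1)] le_trans by blast
qed (simp add: geo_sample_def Least_le)

lemma geo_sample_le: "c \<le> n \<Longrightarrow> u \<le> geo_total q n \<Longrightarrow> geo_sample q n c u \<le> n"
  by (simp add: geo_sample_le_iff geo_cdf_top)

lemma geo_total_pos: "0 < geo_total q n"
  by (simp add: geo_total_def geo_term_def)

lemma geo_total_eq: "1 \<le> n \<Longrightarrow> geo_total q n = (2 * q + 1) * (q + 1) ^ (n - 1)"
  by (cases n) (simp_all add: geo_total_def geo_term_def algebra_simps)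

text \<open>\<open>clog k = \<lceil>log k\<rceil>\<close>, so that \<open>geo_base k\<close> is the number \<open>q\<close> for \<open>\<epsilon> = 1 / k\<close>.\<close>

definition clog :: "nat \<Rightarrow> nat" where "clog k = (LEAST e. k \<le> 2 ^ e)"

text \<open>This form is also the test by which the program finds \<open>clog k\<close>: one power
  of two compared with \<open>k\<close>.\<close>

lemma clog_le_iff: "clog k \<le> e \<longleftrightarrow> k \<le> 2 ^ e"
proof
  have "k \<le> 2 ^ clog k" unfolding clog_def by (rule LeastI[where k = k]) simp
  moreover assume "clog k \<le> e"
  ultimately show "k \<le> 2 ^ e"
    using power_increasing[of "clog k" e "2::nat"] by linarith
qed (simp add: clog_def Least_le)

definition geo_base :: "nat \<Rightarrow> nat" where "geo_base k = 2 ^ (clog k + 1)"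

text \<open>With \<open>m = clog k + 1\<close>, the factor \<open>2 q + 1\<close> has at most
  \<open>m + 2\<close> bits and each factor \<open>q + 1\<close> is at most
  \<open>2 ^ (m + 1)\<close>. The bound serves both \<open>log d\<close> and the buffer
  length.\<close>

lemma geo_total_less:
  assumes "1 \<le> n"
  shows "geo_total (geo_base k) n < 2 ^ ((clog k + 3) * n)"
proof -
  let ?q = "geo_base k" and ?m = "clog k + 1"
  have m: "(2::nat) ^ (?m + 1) = 2 * 2 ^ ?m" "1 \<le> (2::nat) ^ ?m" by simp_all
  have q1: "?q + 1 \<le> 2 ^ (?m + 1)" unfolding geo_base_def using m by linarith
  have "(?q + 1) ^ (n - 1) \<le> (2 ^ (?m + 1)) ^ (n - 1)"
    by (rule power_mono[OF q1]) simp
  moreover have "2 * ?q + 1 < 2 ^ (?m + 2)"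
  proof -
    have "(2::nat) ^ (?m + 2) = 4 * 2 ^ ?m" by simp
    then show ?thesis unfolding geo_base_def using m(2) by linarith
  qed
  ultimately have "geo_total ?q n < 2 ^ (?m + 2) * (2 ^ (?m + 1)) ^ (n - 1)"
    unfolding geo_total_eq[OF assms] by (intro mult_less_le_imp_less) auto
  also have "\<dots> = 2 ^ ((?m + 2) + (?m + 1) * (n - 1))" by (simp only: power_add power_mult)
  also have "\<dots> \<le> 2 ^ ((?m + 2) * n)"
  proof (rule power_increasing)
    have "(?m + 1) * (n - 1) \<le> (?m + 2) * (n - 1)" by (intro mult_right_mono) auto
    moreover have "(?m + 2) + (?m + 2) * (n - 1) = (?m + 2) * n" using assms by (cases n) auto
    ultimately show "(?m + 2) + (?m + 1) * (n - 1) \<le> (?m + 2) * n" by linarith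
  qed simp
  also have "?m + 2 = clog k + 3" by simp
  finally show ?thesis .
qed


section \<open>The geometric distribution\<close>

lemma has_sum_geometric_shift:
  fixes r :: real
  assumes "0 < r" "r < 1"
  shows "((\<lambda>k::nat. r ^ (a + k)) has_sum r ^ a / (1 - r)) UNIV"
proof (rule sums_nonneg_imp_has_sum)
  have "(\<lambda>k. r ^ a * r ^ k) sums (r ^ a * (1 / (1 - r)))"
    using assms by (intro sums_mult geometric_sums) auto
  then show "(\<lambda>k. r ^ (a + k)) sums (r ^ a / (1 - r))" by (simp add: power_add)
qed (use assms in auto)

locale geo_ratio =
  fixes s r :: real
  assumes s: "0 < s" and r: "r = exp (- (1 / s))"
begin

lemma r_bounds: "0 < r" "r < 1"
  using s by (simp_all add: r)

lemma weight: "exp (- \<bar>real_of_int i\<bar> / s) = r ^ nat \<bar>i\<bar>"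
proof -
  have "r ^ nat \<bar>i\<bar> = exp (real (nat \<bar>i\<bar>) * (- (1 / s)))"
    unfolding r by (rule exp_of_nat_mult[symmetric])
  then show ?thesis by simp
qed

text \<open>On one side of \<open>c\<close> the absolute value has constant sign, so the weights
  from \<open>z\<close> outwards form a geometric series whose first exponent is the distance to
  \<open>c\<close>.\<close>

lemma weight_below:
  assumes "z \<le> c"
  shows "((\<lambda>y. exp (- \<bar>real_of_int (y - c)\<bar> / s)) has_sum r ^ nat (c - z) / (1 - r)) {..z}"
proof -
  have inj: "inj (\<lambda>k::nat. z - int k)" by (auto intro: injI)
  have "range (\<lambda>k::nat. z - int k) = {..z}"
  proof safe
    fix y assume "y \<le> z"
    then have "y = z - int (nat (z - y))" by simp
    then show "y \<in> range (\<lambda>k::nat. z - int k)" by blast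
  qed simp
  moreover have "nat \<bar>z - int k - c\<bar> = nat (c - z) + k" for k using assms by simp
  ultimately show ?thesis
    using has_sum_reindex[OF inj, of "\<lambda>y. exp (- \<bar>real_of_int (y - c)\<bar> / s)"]
      has_sum_geometric_shift[OF r_bounds, of "nat (c - z)"]
    unfolding weight o_def by simp
qed

lemma weight_above:
  assumes "c \<le> z + 1"
  shows "((\<lambda>y. exp (- \<bar>real_of_int (y - c)\<bar> / s)) has_sum r ^ nat (z + 1 - c) / (1 - r)) {z<..}"
proof -
  have inj: "inj (\<lambda>k::nat. z + 1 + int k)" by (auto intro: injI)
  have "range (\<lambda>k::nat. z + 1 + int k) = {z<..}"
  proof safe
    fix y assume "z < y"
    then have "y = z + 1 + int (nat (y - z - 1))" by simp
    then show "y \<in> range (\<lambda>k::nat. z + 1 + int k)" by blast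
  qed simp
  moreover have "nat \<bar>z + 1 + int k - c\<bar> = nat (z + 1 - c) + k" for k using assms by simp
  ultimately show ?thesis
    using has_sum_reindex[OF inj, of "\<lambda>y. exp (- \<bar>real_of_int (y - c)\<bar> / s)"]
      has_sum_geometric_shift[OF r_bounds, of "nat (z + 1 - c)"]
    unfolding weight o_def by simp
qed

lemma weight_total: "(\<Sum>\<^sub>\<infinity>y\<in>UNIV. exp (- \<bar>real_of_int (y - c)\<bar> / s)) = (1 + r) / (1 - r)"
proof (rule infsumI)
  have "((\<lambda>y. exp (- \<bar>real_of_int (y - c)\<bar> / s)) has_sum r ^ nat (c - c) / (1 - r) +
      r ^ nat (c + 1 - c) / (1 - r)) ({..c} \<union> {c<..})"
    by (intro has_sum_Un_disjoint weight_below weight_above) auto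
  moreover have "{..c} \<union> {c<..} = UNIV" by auto
  ultimately show "((\<lambda>y. exp (- \<bar>real_of_int (y - c)\<bar> / s)) has_sum (1 + r) / (1 - r)) UNIV"
    by (simp add: add_divide_distrib)
qed

lemma pmf_geo_ratio: "pmf (geo c s) y = exp (- \<bar>real_of_int (y - c)\<bar> / s) / ((1 + r) / (1 - r))"
  by (simp only: pmf_geo[OF s] weight_total)

lemma prob_geo_has_sum:
  assumes "((\<lambda>y. exp (- \<bar>real_of_int (y - c)\<bar> / s)) has_sum t / (1 - r)) A"
  shows "measure_pmf.prob (geo c s) A = t / (1 + r)"
proof -
  have "measure_pmf.prob (geo c s) A = infsum (pmf (geo c s)) A"
    by (simp add: measure_pmf_conv_infsetsum infsetsum_infsum pmf_abs_summable)
  also have "(pmf (geo c s) has_sum t / (1 - r) * (1 / ((1 + r) / (1 - r)))) A"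
    using has_sum_cmult_left[OF assms, of "1 / ((1 + r) / (1 - r))"]
    by (simp add: pmf_geo_ratio[abs_def])
  then have "infsum (pmf (geo c s)) A = t / (1 - r) * (1 / ((1 + r) / (1 - r)))"
    by (rule infsumI)
  also have "\<dots> = t / (1 + r)" using r_bounds by simp
  finally show ?thesis .
qed

lemma prob_geo_below:
  "z \<le> c \<Longrightarrow> measure_pmf.prob (geo c s) {..z} = r ^ nat (c - z) / (1 + r)"
  by (rule prob_geo_has_sum[OF weight_below])

lemma prob_geo_above:
  "c \<le> z + 1 \<Longrightarrow> measure_pmf.prob (geo c s) {z<..} = r ^ nat (z + 1 - c) / (1 + r)"
  by (rule prob_geo_has_sum[OF weight_above])

lemma prob_geo_atMost:
  assumes "c \<le> z + 1"
  shows "measure_pmf.prob (geo c s) {..z} = 1 - r ^ nat (z + 1 - c) / (1 + r)"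
proof -
  have "{..z} = - {z<..}" by auto
  then show ?thesis using measure_pmf.prob_compl[of "{z<..}" "geo c s"] prob_geo_above[OF assms]
    by (simp add: Compl_eq_Diff_UNIV)
qed

text \<open>The two tails beyond distance \<open>a\<close> together have mass
  \<open>2 r / (1 + r)\<close> times \<open>r ^ a\<close>, and that factor is at most 1 because
  \<open>r < 1\<close>.\<close>

lemma prob_geo_close:
  assumes "0 \<le> a"
  shows "1 - r ^ nat a \<le> measure_pmf.prob (geo c s) {y. \<bar>y - c\<bar> \<le> a}"
proof -
  let ?p = "measure_pmf.prob (geo c s)"
  have "{y. \<bar>y - c\<bar> \<le> a} = - ({..c - a - 1} \<union> {c + a<..})" by auto
  then have compl: "?p {y. \<bar>y - c\<bar> \<le> a} = 1 - ?p ({..c - a - 1} \<union> {c + a<..})"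
    using measure_pmf.prob_compl[of "{..c - a - 1} \<union> {c + a<..}" "geo c s"]
    by (simp add: Compl_eq_Diff_UNIV)
  have tails: "?p {..c - a - 1} = r * r ^ nat a / (1 + r)" "?p {c + a<..} = r * r ^ nat a / (1 + r)"
  proof -
    have "nat (a + 1) = Suc (nat a)" using assms by simp
    then show "?p {..c - a - 1} = r * r ^ nat a / (1 + r)" "?p {c + a<..} = r * r ^ nat a / (1 + r)"
      using prob_geo_below[of "c - a - 1" c] prob_geo_above[of c "c + a"] assms
      by (simp_all add: algebra_simps)
  qed
  have "?p ({..c - a - 1} \<union> {c + a<..}) \<le> ?p {..c - a - 1} + ?p {c + a<..}"
    by (rule measure_Un_le) auto
  also have "\<dots> = 2 * r / (1 + r) * r ^ nat a" by (simp add: tails)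
  also have "\<dots> \<le> 1 * r ^ nat a" using r_bounds by (intro mult_right_mono) auto
  finally show ?thesis using compl by simp
qed

lemma pmf_geo_neighbour:
  assumes "\<bar>c - c'\<bar> \<le> 1"
  shows "pmf (geo c s) y \<le> exp (1 / s) * pmf (geo c' s) y"
proof -
  have "\<bar>real_of_int (y - c')\<bar> \<le> \<bar>real_of_int (y - c)\<bar> + 1" using assms by linarith
  then have "\<bar>real_of_int (y - c')\<bar> / s \<le> (\<bar>real_of_int (y - c)\<bar> + 1) / s"
    using s by (intro divide_right_mono) auto
  then have "exp (- \<bar>real_of_int (y - c)\<bar> / s) \<le> exp (1 / s + - \<bar>real_of_int (y - c')\<bar> / s)"
    by (simp add: add_divide_distrib)
  also have "\<dots> = exp (1 / s) * exp (- \<bar>real_of_int (y - c')\<bar> / s)" by (rule exp_add)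
  finally have "exp (- \<bar>real_of_int (y - c)\<bar> / s) / ((1 + r) / (1 - r)) \<le>
      exp (1 / s) * exp (- \<bar>real_of_int (y - c')\<bar> / s) / ((1 + r) / (1 - r))"
    using r_bounds by (intro divide_right_mono) auto
  then show ?thesis unfolding pmf_geo_ratio by simp
qed

end

section \<open>Distribution, privacy and accuracy of the sampler\<close>

lemma measure_pmf_mono_scaled:
  assumes "\<And>y. pmf p y \<le> C * pmf q y"
  shows "measure_pmf.prob p S \<le> C * measure_pmf.prob q S"
proof -
  have "infsetsum (pmf p) S \<le> infsetsum (\<lambda>y. C * pmf q y) S"
    by (rule infsetsum_mono) (use assms in \<open>auto intro: abs_summable_on_cmult_right\<close>)
  then show ?thesis by (simp add: measure_pmf_conv_infsetsum infsetsum_cmult_right pmf_abs_summable)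
qed

lemma pmf_eq_of_cdf:
  fixes p q :: "nat pmf"
  assumes "\<And>z. measure_pmf.prob p {..z} = measure_pmf.prob q {..z}"
  shows "p = q"
proof (rule pmf_eqI)
  have *: "pmf p' y = measure_pmf.prob p' {..y} - (if y = 0 then 0 else measure_pmf.prob p' {..y - 1})"
    for p' :: "nat pmf" and y
  proof (cases y)
    case 0
    then show ?thesis by (simp add: measure_pmf_single atMost_0)
  next
    case (Suc x)
    have "measure_pmf.prob p' ({..Suc x} - {..x}) = measure_pmf.prob p' {..Suc x} - measure_pmf.prob p' {..x}"
      by (rule measure_pmf.finite_measure_Diff) auto
    moreover have "{..Suc x} - {..x} = {Suc x}" by auto
    ultimately show ?thesis using Suc by (simp add: measure_pmf_single)
  qed
  show "pmf p y = pmf q y" for y using *[of p y] *[of q y] assms by simp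
qed

lemma sum_list_neighbours:
  fixes D D' :: "nat list"
  assumes "set D \<subseteq> {0, 1}" "set D' \<subseteq> {0, 1}" "length D = n" "length D' = n"
    and "card {i. i < n \<and> D ! i \<noteq> D' ! i} = 1"
  shows "\<bar>int (sum_list D) - int (sum_list D')\<bar> \<le> 1" "sum_list D \<le> n" "sum_list D' \<le> n"
proof -
  have le: "D ! i \<le> 1" "D' ! i \<le> 1" if "i < n" for i
  proof -
    have "D ! i \<in> set D" "D' ! i \<in> set D'" using that assms(3,4) by simp_all
    then have "D ! i \<in> {0, 1}" "D' ! i \<in> {0, 1}" using assms(1,2) by blast+
    then show "D ! i \<le> 1" "D' ! i \<le> 1" by auto
  qed
  have sums: "sum_list D = (\<Sum>i<n. D ! i)" "sum_list D' = (\<Sum>i<n. D' ! i)"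
    using assms by (simp_all add: sum_list_sum_nth atLeast0LessThan)
  have "\<bar>int (sum_list D) - int (sum_list D')\<bar> = \<bar>\<Sum>i<n. int (D ! i) - int (D' ! i)\<bar>"
    by (simp add: sums sum_subtractf)
  also have "\<dots> \<le> (\<Sum>i<n. \<bar>int (D ! i) - int (D' ! i)\<bar>)" by (rule sum_abs)
  also have "\<dots> \<le> (\<Sum>i<n. if D ! i \<noteq> D' ! i then 1 else 0)"
  proof (rule sum_mono)
    fix i assume "i \<in> {..<n}"
    then show "\<bar>int (D ! i) - int (D' ! i)\<bar> \<le> (if D ! i \<noteq> D' ! i then 1 else 0)"
      using le[of i] by auto
  qed
  also have "\<dots> = int (card {i. i < n \<and> D ! i \<noteq> D' ! i})"
    by (simp add: sum.If_cases Int_def)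
  finally show "\<bar>int (sum_list D) - int (sum_list D')\<bar> \<le> 1" using assms(5) by simp
  show "sum_list D \<le> n" "sum_list D' \<le> n"
    unfolding sums using sum_bounded_above[of "{..<n}" "\<lambda>i. D ! i" 1] le(1)
      sum_bounded_above[of "{..<n}" "\<lambda>i. D' ! i" 1] le(2)
    by simp_all
qed

lemma prob_M_dist:
  assumes "1 \<le> d"
  shows "measure_pmf.prob (M_dist d M c) S = card {u \<in> {1..d}. M c u \<in> S} / d"
proof -
  have "{1..d} \<inter> M c -` S = {u \<in> {1..d}. M c u \<in> S}" by auto
  then show ?thesis using assms by (simp add: M_dist_def measure_pmf_of_set)
qed

lemma prob_geo_sample:
  assumes "c \<le> n"
  shows "measure_pmf.prob (M_dist (geo_total q n) (geo_sample q n) c) {..z} = geo_cdf q n c z / geo_total q n"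
proof -
  have "{u \<in> {1..geo_total q n}. geo_sample q n c u \<in> {..z}} = {1..geo_cdf q n c z}"
    using assms geo_cdf_le_total[OF assms, of q z] by (auto simp: geo_sample_le_iff intro: order_trans)
  then show ?thesis using geo_total_pos[of q n] by (simp add: prob_M_dist Suc_le_eq)
qed

text \<open>The bridge from integers to probabilities: the right-hand side is a tail mass
  \<open>r ^ a / (1 + r)\<close> for \<open>r = q / (q + 1)\<close>. The condition
  \<open>a \<le> n\<close> lets \<open>(q + 1) ^ a\<close> be split off
  \<open>(q + 1) ^ n\<close>.\<close>

lemma geo_term_ratio:
  assumes "1 \<le> n" "a \<le> n"
  shows "real (geo_term q n a) / real (geo_total q n) = (real q / (real q + 1)) ^ a / (1 + real q / (real q + 1))"
proof -
  have q: "real q + 1 > 0" by simp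
  have "(real q + 1) ^ n = (real q + 1) ^ a * (real q + 1) ^ (n - a)"
    "(real q + 1) ^ n = (real q + 1) * (real q + 1) ^ (n - 1)"
    using assms by (simp_all flip: power_add power_Suc)
  then have e: "(real q + 1) ^ a * (real q + 1) ^ (n - a) = (real q + 1) * (real q + 1) ^ (n - 1)"
    by simp
  have t: "real (geo_total q n) = (2 * real q + 1) * (real q + 1) ^ (n - 1)"
    "real (geo_term q n a) = real q ^ a * (real q + 1) ^ (n - a)"
    using assms by (simp_all add: geo_total_eq geo_term_def algebra_simps)
  have "1 + real q / (real q + 1) = (2 * real q + 1) / (real q + 1)" using q by (simp add: field_simps)
  then have "(real q / (real q + 1)) ^ a / (1 + real q / (real q + 1)) =
      real q ^ a * (real q + 1) / ((real q + 1) ^ a * (2 * real q + 1))"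
    by (simp add: power_divide mult.commute)
  also have "\<dots> = real q ^ a * (real q + 1) ^ (n - a) / ((2 * real q + 1) * (real q + 1) ^ (n - 1))"
  proof (subst frac_eq_eq)
    show "real q ^ a * (real q + 1) * ((2 * real q + 1) * (real q + 1) ^ (n - 1)) =
        real q ^ a * (real q + 1) ^ (n - a) * ((real q + 1) ^ a * (2 * real q + 1))"
    proof -
      have "real q ^ a * (real q + 1) * ((2 * real q + 1) * (real q + 1) ^ (n - 1)) =
          real q ^ a * (2 * real q + 1) * ((real q + 1) * (real q + 1) ^ (n - 1))"
        by (simp only: mult_ac)
      also have "\<dots> = real q ^ a * (2 * real q + 1) * ((real q + 1) ^ a * (real q + 1) ^ (n - a))"
        by (simp only: e)
      also have "\<dots> = real q ^ a * (real q + 1) ^ (n - a) * ((real q + 1) ^ a * (2 * real q + 1))"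
        by (simp only: mult_ac)
      finally show ?thesis .
    qed
  qed (use q in auto)
  finally show ?thesis by (simp add: t)
qed

lemma ceiling_log2_eq_clog:
  assumes "1 \<le> k"
  shows "\<lceil>log 2 (2 * real k)\<rceil> = int (clog k + 1)"
proof -
  have "real k \<le> 2 ^ clog k"
    using clog_le_iff[of k "clog k"] by (metis of_nat_le_iff of_nat_numeral of_nat_power order_refl)
  then have le: "log 2 (real k) \<le> real (clog k)"
    using assms by (simp add: log_le_iff powr_realpow)
  have "real (clog k) < log 2 (real k) + 1"
  proof (cases "clog k")
    case (Suc e)
    then have "2 ^ e < k" using clog_le_iff[of k e] by (simp add: not_le)
    then have "real e < log 2 (real k)" by (rule less_log2_of_power)
    then show ?thesis using Suc by simp
  qed (use assms in \<open>simp add: add_nonneg_pos\<close>)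
  with le show ?thesis using assms by (intro ceiling_unique) (simp_all add: log_mult)
qed

lemma eps_tilde_reciprocal:
  assumes "1 \<le> k"
  shows "eps_tilde (1 / real k) = 2 * ln (1 + 1 / real (geo_base k))"
proof -
  have "(2::real) powr (- real (clog k + 1)) = inverse (2 ^ (clog k + 1))"
    by (simp only: powr_minus powr_realpow zero_less_numeral)
  then have "(2::real) powr (- of_int \<lceil>log 2 (2 * real k)\<rceil>) = 1 / real (geo_base k)"
    by (simp only: ceiling_log2_eq_clog[OF assms] of_int_of_nat_eq)
      (simp add: geo_base_def inverse_eq_divide)
  then show ?thesis by (simp add: eps_tilde_def)
qed

text \<open>If \<open>clog k = e + 1\<close> then \<open>2 ^ e < k\<close>, and integrality gives
  \<open>2 ^ e \<le> k - 1\<close>; multiplying by 4 produces the gain of 4. Otherwise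
  \<open>k = 1\<close>.\<close>

lemma geo_base_bounds:
  assumes "1 \<le> k"
  shows "2 * k \<le> geo_base k" "geo_base k = 2 * k \<or> geo_base k + 4 \<le> 4 * k"
proof -
  have k: "k \<le> 2 ^ clog k" using clog_le_iff[of k "clog k"] by simp
  then show "2 * k \<le> geo_base k" by (simp add: geo_base_def)
  show "geo_base k = 2 * k \<or> geo_base k + 4 \<le> 4 * k"
  proof (cases "clog k")
    case (Suc e)
    then have "2 ^ e < k" using clog_le_iff[of k e] by (simp add: not_le)
    then show ?thesis by (simp add: geo_base_def Suc)
  qed (use assms k in \<open>simp add: geo_base_def\<close>)
qed

text \<open>The upper bound is \<open>ln (1 + x) \<le> x\<close>, the lower one
  \<open>x - x ^ 2 \<le> ln (1 + x)\<close>, at \<open>x = 1 / q\<close>. For small \<open>q\<close>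
  the quadratic loss is substantial: from \<open>q \<le> 4 k\<close> alone the comparison would
  require \<open>q > 9\<close>, so the summand 4 of \<open>geo_base_bounds\<close> is essential
  here.\<close>

lemma eps_tilde_bounds:
  assumes "1 \<le> k"
  shows "4 / 9 * (1 / real k) < eps_tilde (1 / real k)" "eps_tilde (1 / real k) \<le> 1 / real k"
proof -
  define q where "q = real (geo_base k)"
  have q: "2 * real k \<le> q" "q = 2 * real k \<or> q + 4 \<le> 4 * real k" "2 \<le> q"
    using geo_base_bounds[OF assms] assms by (auto simp: q_def)
  have e: "eps_tilde (1 / real k) = 2 * ln (1 + 1 / q)"
    using eps_tilde_reciprocal[OF assms] by (simp add: q_def)
  have "ln (1 + 1 / q) \<le> 1 / q" using q by (intro ln_add_one_self_le_self) simp
  also have "\<dots> \<le> 1 / (2 * real k)" using q assms by (intro divide_left_mono) auto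
  finally show "eps_tilde (1 / real k) \<le> 1 / real k" unfolding e by simp
  have "4 / 9 * (1 / real k) < 2 * (1 / q - (1 / q) ^ 2)"
  proof (cases "q = 2 * real k")
    case True
    then have "4 / 9 * (1 / real k) = 8 / 9 / q" using assms by (simp add: field_simps)
    also have "\<dots> < 2 * (1 / q - (1 / q) ^ 2)"
      using q(3) by (simp add: field_simps power2_eq_square)
    finally show ?thesis .
  next
    case False
    then have "4 / 9 * (1 / real k) \<le> 16 / (9 * (q + 4))" using q assms by (simp add: field_simps)
    also have "\<dots> < 2 * (1 / q - (1 / q) ^ 2)"
    proof -
      have "0 < 2 * q ^ 2 + 54 * q - 72" using q(3) zero_le_power2[of q] by linarith
      then have "16 * q ^ 2 < 2 * (q - 1) * (9 * (q + 4))"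
        by (simp add: algebra_simps power2_eq_square)
      moreover have "2 * (1 / q - (1 / q) ^ 2) = 2 * (q - 1) / q ^ 2"
        using q(3) by (simp add: field_simps power2_eq_square)
      ultimately show ?thesis using q(3) by (simp add: divide_less_eq less_divide_eq)
    qed
    finally show ?thesis .
  qed
  also have "\<dots> \<le> 2 * ln (1 + 1 / q)"
    using ln_one_plus_pos_lower_bound[of "1 / q"] q(3) by simp
  finally show "4 / 9 * (1 / real k) < eps_tilde (1 / real k)" unfolding e .
qed

lemma geo_ratio_eps_tilde:
  assumes "1 \<le> k"
  shows "geo_ratio (2 / eps_tilde (1 / real k)) (real (geo_base k) / (real (geo_base k) + 1))"
proof
  let ?q = "real (geo_base k)"
  have q: "0 < ?q" by (simp add: geo_base_def)
  have "0 < ln (1 + 1 / ?q)" using q by (intro ln_gt_zero) simp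
  then show "0 < 2 / eps_tilde (1 / real k)" by (simp add: eps_tilde_reciprocal[OF assms])
  have "exp (- ln (1 + 1 / ?q)) = 1 / (1 + 1 / ?q)"
    using q by (simp add: exp_minus inverse_eq_divide add_pos_pos)
  also have "\<dots> = ?q / (?q + 1)" using q by (simp add: field_simps)
  finally show "?q / (?q + 1) = exp (- (1 / (2 / eps_tilde (1 / real k))))"
    by (simp add: eps_tilde_reciprocal[OF assms])
qed

lemma M_dist_geo_sample:
  assumes k: "1 \<le> k" and n: "1 \<le> n" and c: "c \<le> n"
  shows "M_dist (geo_total (geo_base k) n) (geo_sample (geo_base k) n) c =
    map_pmf (clamp_to n) (geo (int c) (2 / eps_tilde (1 / real k)))"
proof (rule pmf_eq_of_cdf)
  fix z
  let ?q = "geo_base k"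
  interpret geo_ratio "2 / eps_tilde (1 / real k)" "real ?q / (real ?q + 1)"
    by (rule geo_ratio_eps_tilde[OF k])
  let ?g = "geo (int c) (2 / eps_tilde (1 / real k))"
  \<comment> \<open>All mass above \<open>n\<close> is moved to \<open>n\<close>, so the clamped
    distribution function jumps to 1 there; this is the last branch of
    \<open>geo_cdf\<close>.\<close>
  have clamp: "clamp_to n -` {..z} = (if z < n then {..int z} else UNIV)"
    using n by (auto simp: clamp_to_def)
  have "real (geo_cdf ?q n c z) / real (geo_total ?q n) = measure_pmf.prob ?g (clamp_to n -` {..z})"
  proof -
    consider "z < c" | "c \<le> z" "z < n" | "n \<le> z" by linarith
    then show ?thesis
    proof cases
      case 1
      then show ?thesis
        using c geo_term_ratio[OF n, of "c - z" ?q] prob_geo_below[of "int z" "int c"]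
        by (simp add: clamp geo_cdf_def nat_diff_distrib)
    next
      case 2
      then have a: "z + 1 - c \<le> n" and e: "nat (int z + 1 - int c) = z + 1 - c" by auto
      have "real (geo_cdf ?q n c z) / real (geo_total ?q n) =
          1 - real (geo_term ?q n (z + 1 - c)) / real (geo_total ?q n)"
        using 2 geo_term_le_total[OF a, of ?q] geo_total_pos[of ?q n]
        by (simp add: geo_cdf_def of_nat_diff diff_divide_distrib)
      then show ?thesis
        using 2 geo_term_ratio[OF n a, of ?q] prob_geo_atMost[of "int c" "int z"] e
        by (simp add: clamp)
    next
      case 3
      then show ?thesis using c geo_total_pos[of ?q n] by (simp add: clamp geo_cdf_def)
    qed
  qed
  then show "measure_pmf.prob (M_dist (geo_total ?q n) (geo_sample ?q n) c) {..z} =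
      measure_pmf.prob (map_pmf (clamp_to n) ?g) {..z}"
    by (simp add: prob_geo_sample[OF c])
qed

text \<open>Neighbouring counts differ by at most one, which changes each point mass by a factor of
  at most \<open>exp (1 / s)\<close>; for \<open>s = 2 / eps_tilde\<close> this is
  \<open>exp (eps_tilde / 2)\<close>. Events after clamping are events before it, via
  preimages.\<close>

lemma dp_counting_geo_sample:
  assumes k: "1 \<le> k" and n: "1 \<le> n"
  shows "dp_counting n (geo_total (geo_base k) n) (eps_tilde (1 / real k) / 2) 0
    (geo_sample (geo_base k) n)"
  unfolding dp_counting_def differentially_private_def
proof (intro allI impI)
  fix D D' :: "nat list" and S
  assume D: "set D \<subseteq> {0, 1} \<and> set D' \<subseteq> {0, 1} \<and> length D = n \<and> length D' = n \<and>
    card {i. i < n \<and> D ! i \<noteq> D' ! i} = 1"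
  interpret geo_ratio "2 / eps_tilde (1 / real k)" "real (geo_base k) / (real (geo_base k) + 1)"
    by (rule geo_ratio_eps_tilde[OF k])
  have sums: "\<bar>int (sum_list D) - int (sum_list D')\<bar> \<le> 1" "sum_list D \<le> n" "sum_list D' \<le> n"
    using D sum_list_neighbours[of D D' n] by blast+
  show "measure_pmf.prob (M_dist (geo_total (geo_base k) n) (geo_sample (geo_base k) n) (sum_list D)) S
    \<le> exp (eps_tilde (1 / real k) / 2) *
      measure_pmf.prob (M_dist (geo_total (geo_base k) n) (geo_sample (geo_base k) n) (sum_list D')) S + 0"
    using measure_pmf_mono_scaled[OF pmf_geo_neighbour[OF sums(1)], of "clamp_to n -` S"]
    by (simp add: M_dist_geo_sample[OF k n sums(2)] M_dist_geo_sample[OF k n sums(3)])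
qed

text \<open>The radius \<open>a\<close> makes \<open>r ^ a = exp (- a / s)\<close> at most
  \<open>\<beta>\<close>. Clamping to an interval that contains \<open>c\<close> does not increase
  the distance to \<open>c\<close>.\<close>

lemma accurate_geo_sample:
  assumes k: "1 \<le> k" and n: "1 \<le> n" and \<beta>: "0 < \<beta>" "\<beta> \<le> 1"
  shows "accurate n (geo_total (geo_base k) n)
    (of_int \<lceil>2 / eps_tilde (1 / real k) * ln (1 / \<beta>)\<rceil>) \<beta> (geo_sample (geo_base k) n)"
  unfolding accurate_def
proof (intro allI impI)
  fix c assume c: "c \<le> n"
  let ?s = "2 / eps_tilde (1 / real k)" and ?r = "real (geo_base k) / (real (geo_base k) + 1)"
  interpret geo_ratio ?s ?r by (rule geo_ratio_eps_tilde[OF k])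
  define a where "a = \<lceil>?s * ln (1 / \<beta>)\<rceil>"
  have "0 \<le> ?s * ln (1 / \<beta>)" using s \<beta> by (intro mult_nonneg_nonneg) auto
  then have a: "0 \<le> a" unfolding a_def by linarith
  have "?s * ln (1 / \<beta>) \<le> real_of_int a" unfolding a_def by (rule le_of_int_ceiling)
  then have "ln (1 / \<beta>) \<le> real_of_int a / ?s"
    unfolding pos_le_divide_eq[OF s] by (simp only: mult.commute)
  then have "- (real_of_int a / ?s) \<le> ln \<beta>" using \<beta> by (simp add: ln_div)
  then have "exp (- (real_of_int a / ?s)) \<le> exp (ln \<beta>)" by simp
  then have "?r ^ nat a \<le> \<beta>"
    using weight[of a] a \<beta> by simp
  then have "1 - \<beta> \<le> measure_pmf.prob (geo (int c) ?s) {y. \<bar>y - int c\<bar> \<le> a}"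
    using prob_geo_close[OF a, of "int c"] by linarith
  also have "\<dots> \<le> measure_pmf.prob (geo (int c) ?s) (clamp_to n -` {y. \<bar>real y - real c\<bar> \<le> of_int a})"
  proof (rule measure_pmf.finite_measure_mono)
    show "{y. \<bar>y - int c\<bar> \<le> a} \<subseteq> clamp_to n -` {y. \<bar>real y - real c\<bar> \<le> of_int a}"
    proof safe
      fix y assume "\<bar>y - int c\<bar> \<le> a"
      then have "\<bar>int (clamp_to n y) - int c\<bar> \<le> a" using c by (auto simp: clamp_to_def)
      then have "real_of_int \<bar>int (clamp_to n y) - int c\<bar> \<le> real_of_int a" by (rule of_int_le_iff[THEN iffD2])
      then show "y \<in> clamp_to n -` {y. \<bar>real y - real c\<bar> \<le> of_int a}" by simp
    qed
  qed simp
  finally show "1 - \<beta> \<le> measure_pmf.prob (M_dist (geo_total (geo_base k) n) (geo_sample (geo_base k) n) c)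
      {y. \<bar>real y - real c\<bar> \<le> of_int \<lceil>?s * ln (1 / \<beta>)\<rceil>}"
    by (simp add: M_dist_geo_sample[OF k n c] a_def)
qed


section \<open>Long integers on the word RAM\<close>

lemma bignum_0 [simp]: "bignum w m a 0 = 0"
  by (simp add: bignum_def)

lemma bignum_Suc: "bignum w m a (Suc l) = m a + 2 ^ w * bignum w m (Suc a) l"
  unfolding bignum_def sum.lessThan_Suc_shift
  by (simp add: sum_distrib_left power_add mult_ac)

lemma bignum_cong:
  assumes "\<And>i. i < l \<Longrightarrow> m (a + i) = m' (a' + i)"
  shows "bignum w m a l = bignum w m' a' l"
  using assms by (simp add: bignum_def)

lemma bignum_less:
  assumes "\<And>a. m a < 2 ^ w"
  shows "bignum w m a l < 2 ^ (w * l)"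
proof (induction l arbitrary: a)
  case (Suc l)
  have "bignum w m a (Suc l) < 2 ^ w + 2 ^ w * bignum w m (Suc a) l"
    using assms[of a] by (simp add: bignum_Suc)
  also have "\<dots> = 2 ^ w * Suc (bignum w m (Suc a) l)" by simp
  also have "\<dots> \<le> 2 ^ w * 2 ^ (w * l)"
    using Suc.IH[of "Suc a"] by (intro mult_left_mono) auto
  finally show ?case by (simp add: power_add)
qed simp

lemma sum_digit: "(\<Sum>i<l. digit w x i * 2 ^ (w * i)) = x mod 2 ^ (w * l)"
proof (induction l)
  case (Suc l)
  have "x mod 2 ^ (w * Suc l) = x mod (2 ^ (w * l) * 2 ^ w)"
    by (simp add: power_add mult.commute)
  also have "\<dots> = 2 ^ (w * l) * (x div 2 ^ (w * l) mod 2 ^ w) + x mod 2 ^ (w * l)"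
    by (rule mod_mult2_eq)
  finally show ?case using Suc by (simp add: digit_def)
qed simp

lemma bignum_digit:
  assumes "\<And>i. i < l \<Longrightarrow> m (a + i) = digit w x i"
  shows "bignum w m a l = x mod 2 ^ (w * l)"
  using assms by (simp add: bignum_def sum_digit)

lemma digit_less: "digit w x i < 2 ^ w"
  by (simp add: digit_def)


section \<open>Straight-line programs as state transformers, and subtraction with borrow\<close>

fun straight :: "com \<Rightarrow> bool" where
  "straight (Seq P Q) \<longleftrightarrow> straight P \<and> straight Q"
| "straight (Const r k) \<longleftrightarrow> True"
| "straight (Op f r a b) \<longleftrightarrow> True"
| "straight (Load r a) \<longleftrightarrow> True"
| "straight (Store a r) \<longleftrightarrow> True"
| "straight _ \<longleftrightarrow> False"

fun straight_time :: "com \<Rightarrow> nat" where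
  "straight_time (Seq P Q) = straight_time P + straight_time Q"
| "straight_time _ = 1"

fun straight_state :: "nat \<Rightarrow> com \<Rightarrow> state \<Rightarrow> state" where
  "straight_state w (Seq P Q) s = straight_state w Q (straight_state w P s)"
| "straight_state w (Const r k) (R, m) = (R(r := k mod 2 ^ w), m)"
| "straight_state w (Op f r a b) (R, m) = (R(r := apply_op w f (R a) (R b)), m)"
| "straight_state w (Load r a) (R, m) = (R(r := m (R a)), m)"
| "straight_state w (Store a r) (R, m) = (R, m(R a := R r))"
| "straight_state w _ s = s"

lemma exec_straight:
  "straight P \<Longrightarrow> exec mulcost w P s (straight_time P) (straight_state w P s)"
proof (induction P arbitrary: s)
  case (Seq P Q)
  then have "exec mulcost w P s (straight_time P) (straight_state w P s)"
    "exec mulcost w Q (straight_state w P s) (straight_time Q)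
      (straight_state w Q (straight_state w P s))"
    by simp_all
  then show ?case by (simp only: straight_time.simps straight_state.simps exec.Seq)
next
  case (Const r k)
  show ?case by (cases s) (simp add: exec.Const[simplified])
next
  case (Op f r a b)
  show ?case by (cases s) (simp add: exec.Op[simplified])
next
  case (Load r a)
  show ?case by (cases s) (simp add: exec.Load[simplified])
next
  case (Store a r)
  show ?case by (cases s) (simp add: exec.Store[simplified])
qed auto

text \<open>
  One digit of a subtraction: registers 0, 1, 2 point to the difference, minuend and subtrahend,
  register 3 holds the borrow, register 6 the number of digits left, and register 13 the number one.
\<close>

definition sub_body :: com where
  "sub_body =
    Seq (Load 7 1) (Seq (Load 8 2) (Seq (Op Sub 9 7 8) (Seq (Op Less 10 7 8)
    (Seq (Op Sub 11 9 3) (Seq (Op Less 12 9 3) (Seq (Op Add 3 10 12) (Seq (Store 0 11)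
    (Seq (Op Add 0 0 13) (Seq (Op Add 1 1 13) (Seq (Op Add 2 2 13) (Op Sub 6 6 13)))))))))))"

lemma exec_sub_body:
  fixes R :: "reg \<Rightarrow> nat" and w :: nat
  assumes w: "2 \<le> w" and m: "\<And>a. m a < 2 ^ w"
    and bounds: "Suc (R 0) < 2 ^ w" "Suc (R 1) < 2 ^ w" "Suc (R 2) < 2 ^ w" "R 3 \<le> 1"
      "R 6 = Suc l" "Suc l < 2 ^ w" "R 13 = 1"
  obtains R' e where "exec mulcost w sub_body (R, m) 12 (R', m(R 0 := e))" "e < 2 ^ w"
    "R' 0 = Suc (R 0)" "R' 1 = Suc (R 1)" "R' 2 = Suc (R 2)" "R' 3 \<le> 1" "R' 6 = l" "R' 13 = 1"
    "\<And>r. 14 \<le> r \<Longrightarrow> R' r = R r" "e + m (R 2) + R 3 = m (R 1) + R' 3 * 2 ^ w"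
proof -
  define x y b W where "x = m (R 1)" and "y = m (R 2)" and "b = R 3" and "W = (2::nat) ^ w"
  define f where "f = (x + W - y) mod W"
  define e where "e = (f + W - b) mod W"
  define b' where "b' = (if x < y then 1 else 0) + (if f < b then 1 else (0::nat))"
  have W: "2 < W"
    using power_increasing[OF w, of "2::nat"] by (simp add: W_def)
  have xy: "x < W" "y < W" "b \<le> 1" using m bounds by (auto simp: x_def y_def W_def b_def)
  have sub: "(u + W - v) mod W = (if u < v then u + W - v else u - v)" if "u < W" "v < W" for u v
  proof (cases "u < v")
    case False
    then have "u + W - v = (u - v) + W" by simp
    moreover have "u - v < W" using that by simp
    ultimately show ?thesis using False by (simp only: mod_add_self2 mod_less if_False)
  qed (use that in simp)
  have f: "f = (if x < y then x + W - y else x - y)"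
    unfolding f_def by (rule sub) (use xy in auto)
  then have "f < W" using xy by auto
  then have e: "e = (if f < b then f + W - b else f - b)"
    unfolding e_def by (rule sub) (use xy W in auto)
  \<comment> \<open>The two borrows exclude each other: \<open>f < b\<close> forces
    \<open>f = 0\<close> and \<open>b = 1\<close>, hence \<open>x = y\<close>. So their sum is again
    a single borrow.\<close>
  have b': "b' \<le> 1" "e + y + b = x + b' * W"
    using xy f e W \<open>f < W\<close> unfolding b'_def by (auto split: if_split_asm)
  have bW: "b' mod W = b'" using b' W by simp
  have e_less: "e < 2 ^ w" using W by (simp add: e_def W_def)
  define S where "S = straight_state w sub_body (R, m)"
  have "exec mulcost w sub_body (R, m) 12 S"
  proof -
    have "straight sub_body" "straight_time sub_body = 12" by (simp_all add: sub_body_def)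
    then show ?thesis using exec_straight[of sub_body mulcost w "(R, m)"] by (simp only: S_def)
  qed
  moreover have "S = (R(7 := x, 8 := y, 9 := f, 10 := if x < y then 1 else 0, 11 := e,
      12 := if f < b then 1 else 0, 3 := b', 0 := Suc (R 0), 1 := Suc (R 1),
      2 := Suc (R 2), 6 := l), m(R 0 := e))" (is "S = ?S")
  proof -
    have "(R 0 + 1) mod W = Suc (R 0)" "(R 1 + 1) mod W = Suc (R 1)" "(R 2 + 1) mod W = Suc (R 2)"
      "(Suc l + W - 1) mod W = l"
      using bounds by (simp_all add: W_def)
    moreover have "((if x < y then 1 else 0) + (if f < b then 1 else 0)) mod W = b'"
      using bW by (simp only: b'_def)
    ultimately show ?thesis
      using bounds(5,7)
      by (simp add: S_def sub_body_def split del: if_split del: One_nat_def flip: x_def y_def b_def W_def f_def e_def)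
  qed
  ultimately have "exec mulcost w sub_body (R, m) 12 ?S" by (simp only:)
  then show thesis
    by (rule that) (use b' e_less bounds in \<open>simp_all add: x_def y_def b_def W_def\<close>)
qed

text \<open>
  The target of a subtraction may be one of its operands; the last two premises only exclude that
  a word is overwritten before it is read.
\<close>

lemma exec_sub_loop:
  assumes w: "2 \<le> w"
  shows "\<lbrakk>\<And>a. m a < 2 ^ w; R 0 + l < 2 ^ w; R 1 + l < 2 ^ w; R 2 + l < 2 ^ w;
      R 3 \<le> 1; R 6 = l; R 13 = 1; R 0 \<le> R 1 \<or> R 1 + l \<le> R 0; R 0 \<le> R 2 \<or> R 2 + l \<le> R 0\<rbrakk> \<Longrightarrow>
    \<exists>R' m'. exec mulcost w (While 6 sub_body) (R, m) (1 + 13 * l) (R', m') \<and>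
      (\<forall>r\<ge>14. R' r = R r) \<and> R' 3 \<le> 1 \<and> (\<forall>a. m' a < 2 ^ w) \<and>
      (\<forall>a. a < R 0 \<or> R 0 + l \<le> a \<longrightarrow> m' a = m a) \<and>
      bignum w m' (R 0) l + bignum w m (R 2) l + R 3 = bignum w m (R 1) l + R' 3 * 2 ^ (w * l)"
proof (induction l arbitrary: R m)
  case 0
  have "exec mulcost w (While 6 sub_body) (R, m) 1 (R, m)"
    using 0 by (intro exec.WhileFalse) auto
  then show ?case using 0 by (intro exI[of _ R] exI[of _ m]) simp
next
  case (Suc l)
  have pre: "Suc (R 0) < 2 ^ w" "Suc (R 1) < 2 ^ w" "Suc (R 2) < 2 ^ w" "R 3 \<le> 1"
    "R 6 = Suc l" "Suc l < 2 ^ w" "R 13 = 1"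
    using Suc.prems(2-7) by linarith+
  obtain R1 e where 1: "exec mulcost w sub_body (R, m) 12 (R1, m(R 0 := e))" "e < 2 ^ w"
    "R1 0 = Suc (R 0)" "R1 1 = Suc (R 1)" "R1 2 = Suc (R 2)" "R1 3 \<le> 1" "R1 6 = l" "R1 13 = 1"
    "\<And>r. 14 \<le> r \<Longrightarrow> R1 r = R r" "e + m (R 2) + R 3 = m (R 1) + R1 3 * 2 ^ w"
    by (rule exec_sub_body[of w m R l mulcost, OF w Suc.prems(1) pre], rule that)
  define m1 where "m1 = m(R 0 := e)"
  have "\<exists>R' m'. exec mulcost w (While 6 sub_body) (R1, m1) (1 + 13 * l) (R', m') \<and>
      (\<forall>r\<ge>14. R' r = R1 r) \<and> R' 3 \<le> 1 \<and> (\<forall>a. m' a < 2 ^ w) \<and>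
      (\<forall>a. a < R1 0 \<or> R1 0 + l \<le> a \<longrightarrow> m' a = m1 a) \<and>
      bignum w m' (R1 0) l + bignum w m1 (R1 2) l + R1 3 =
        bignum w m1 (R1 1) l + R' 3 * 2 ^ (w * l)"
  proof (rule Suc.IH)
    show "m1 a < 2 ^ w" for a using Suc.prems(1) 1(2) by (simp add: m1_def)
    show "R1 0 \<le> R1 1 \<or> R1 1 + l \<le> R1 0" using Suc.prems(8) 1(3,4) by linarith
    show "R1 0 \<le> R1 2 \<or> R1 2 + l \<le> R1 0" using Suc.prems(9) 1(3,5) by linarith
  qed (use Suc.prems(2-4) 1(3-8) in linarith)+
  then obtain R' m' where 2: "exec mulcost w (While 6 sub_body) (R1, m1) (1 + 13 * l) (R', m')"
    "\<And>r. r \<ge> 14 \<Longrightarrow> R' r = R1 r" "R' 3 \<le> 1" "\<And>a. m' a < 2 ^ w"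
    "\<And>a. a < R1 0 \<or> R1 0 + l \<le> a \<Longrightarrow> m' a = m1 a"
    "bignum w m' (R1 0) l + bignum w m1 (R1 2) l + R1 3 =
        bignum w m1 (R1 1) l + R' 3 * 2 ^ (w * l)"
    by blast
  have "exec mulcost w (While 6 sub_body) (R, m) (1 + 12 + (1 + 13 * l)) (R', m')"
    by (rule exec.WhileTrue[OF _ 1(1)]) (use Suc.prems(6) 2(1) in \<open>simp_all add: m1_def\<close>)
  \<comment> \<open>By the two aliasing premises, the word just written at \<open>R 0\<close> is not
    among the operand words still to be read.\<close>
  moreover have "bignum w m1 (Suc (R 1)) l = bignum w m (Suc (R 1)) l"
    "bignum w m1 (Suc (R 2)) l = bignum w m (Suc (R 2)) l"
    using Suc.prems(8,9) by (auto intro!: bignum_cong simp: m1_def)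
  then have "bignum w m' (R 0) (Suc l) + bignum w m (R 2) (Suc l) + R 3 =
      bignum w m (R 1) (Suc l) + R' 3 * 2 ^ (w * Suc l)"
  proof -
    assume eq: "bignum w m1 (Suc (R 1)) l = bignum w m (Suc (R 1)) l"
      "bignum w m1 (Suc (R 2)) l = bignum w m (Suc (R 2)) l"
    have "m' (R 0) = e" using 2(5)[of "R 0"] 1(3) by (simp add: m1_def)
    then have "bignum w m' (R 0) (Suc l) + bignum w m (R 2) (Suc l) + R 3 =
        (e + m (R 2) + R 3) + 2 ^ w * (bignum w m' (Suc (R 0)) l + bignum w m (Suc (R 2)) l)"
      by (simp add: bignum_Suc algebra_simps)
    also have "\<dots> = m (R 1) + 2 ^ w *
        (bignum w m' (Suc (R 0)) l + bignum w m (Suc (R 2)) l + R1 3)"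
      using 1(10) by (simp add: algebra_simps)
    also have "\<dots> = m (R 1) + 2 ^ w * (bignum w m (Suc (R 1)) l + R' 3 * 2 ^ (w * l))"
      using 2(6) 1 eq by simp
    also have "\<dots> = bignum w m (R 1) (Suc l) + R' 3 * 2 ^ (w * Suc l)"
      by (simp add: bignum_Suc algebra_simps power_add)
    finally show ?thesis .
  qed
  moreover have "m' a = m a" if "a < R 0 \<or> R 0 + Suc l \<le> a" for a
    using that 2(5)[of a] 1(3) by (auto simp: m1_def)
  moreover have "R' r = R r" if "r \<ge> 14" for r using 2(2) 1(9) that by simp
  ultimately show ?case
    using 2(3,4) by (intro exI[of _ R'] exI[of _ m']) simp
qed

text \<open>
  Registers below 16 are scratch space, register 16 holds the buffer length \<open>L\<close>, register 17 the
  address of the first buffer; programs on long integers use the registers from 18 on. Register 18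
  always contains one, register 19 the last borrow, register 20 the number \<open>n\<close>, register 22 the
  third input \<open>c\<close> or \<open>z\<close>; 24, 25, 26 are the bounds and the midpoint of a binary search and 28 its
  outcome. Consecutive buffers are \<open>2 L\<close> words apart because \<open>BigMul\<close> writes a product of double
  length, of which only the lower half is used. Buffer 0 contains the last input, buffer 1 the
  number one, buffer 2 the number \<open>k = 1 / \<epsilon>\<close>, buffer 3 the number two, buffers 6 and 7 the numbers
  \<open>q\<close> and \<open>q + 1\<close>, and buffer 9 the number \<open>d\<close>.
\<close>

definition addr :: "reg \<Rightarrow> nat \<Rightarrow> com" where
  "addr r j = Seq (Const r j) (Seq (Op Mul r r 16) (Seq (Op Add r r r) (Op Add r r 17)))"

definition bmul :: "nat \<Rightarrow> nat \<Rightarrow> nat \<Rightarrow> com" where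
  "bmul i j k = Seq (addr 0 i) (Seq (addr 1 j) (Seq (addr 2 k) (BigMul 0 1 2 16)))"

text \<open>\<open>Op Or\<close> of a register with itself serves as a register move, here and in
  all later programs.\<close>

definition bsub :: "nat \<Rightarrow> nat \<Rightarrow> nat \<Rightarrow> com" where
  "bsub i j k = Seq (addr 0 i) (Seq (addr 1 j) (Seq (addr 2 k)
    (Seq (Seq (Const 3 0) (Seq (Const 13 1) (Op Or 6 16 16)))
    (Seq (While 6 sub_body) (Op Or 19 3 3)))))"

text \<open>Word computations confined to registers from 18 on: they leave the memory, the buffer
  length and the base address alone, so every buffer keeps its value.\<close>

fun public :: "com \<Rightarrow> bool" where
  "public (Seq P Q) \<longleftrightarrow> public P \<and> public Q"
| "public (Const r k) \<longleftrightarrow> 18 \<le> r"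
| "public (Op f r a b) \<longleftrightarrow> 18 \<le> r \<and> 18 \<le> a \<and> 18 \<le> b"
| "public _ \<longleftrightarrow> False"

section \<open>A cost calculus for programs on long integers\<close>

locale bignum_machine =
  fixes mulcost :: "nat \<Rightarrow> nat" and w L base :: nat
  assumes word_size: "2 \<le> w" and L_pos: "0 < L" and room: "base + 24 * L < 2 ^ w"
begin

definition M :: nat where "M = 2 ^ (w * L)"

definition K :: nat where "K = 60 + 13 * L + mulcost (L * w)"

definition slot :: "nat \<Rightarrow> nat" where "slot j = base + 2 * (j * L)"

text \<open>
  The state \<open>s\<close> represents the values \<open>V\<close> of the registers from 18 on and \<open>B\<close> of the buffers. In
  \<open>awp k P Q V B\<close>, time is counted in units of \<open>K\<close>, which bounds the cost of one long operation.
\<close>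

definition rep :: "(reg \<Rightarrow> nat) \<Rightarrow> (nat \<Rightarrow> nat) \<Rightarrow> state \<Rightarrow> bool" where
  "rep V B s \<longleftrightarrow> (\<forall>r\<ge>18. fst s r = V r) \<and> fst s 16 = L \<and> fst s 17 = base \<and>
     (\<forall>a. snd s a < 2 ^ w) \<and> (\<forall>j<12. bignum w (snd s) (slot j) L = B j)"

definition awp :: "nat \<Rightarrow> com \<Rightarrow> ((reg \<Rightarrow> nat) \<Rightarrow> (nat \<Rightarrow> nat) \<Rightarrow> bool) \<Rightarrow>
    (reg \<Rightarrow> nat) \<Rightarrow> (nat \<Rightarrow> nat) \<Rightarrow> bool" where
  "awp k P Q V B \<longleftrightarrow> (\<forall>s. rep V B s \<longrightarrow>
     (\<exists>t s' V' B'. exec mulcost w P s t s' \<and> t \<le> k * K \<and> rep V' B' s' \<and> Q V' B'))"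

lemma K_pos: "1 \<le> K" by (simp add: K_def)

lemma M_gt_1: "1 < M"
  using word_size L_pos one_less_power[of "2::nat" "w * L"] by (simp add: M_def)

lemma L_bounds: "24 < (2::nat) ^ w" "24 * L < 2 ^ w"
  using room L_pos by auto

text \<open>The \<open>24 * L\<close> in \<open>room\<close> pays for twelve buffers that are
  \<open>2 * L\<close> words apart.\<close>

lemma slot_bound: "j < 12 \<Longrightarrow> slot j + 2 * L < 2 ^ w"
proof -
  assume "j < 12"
  then have "j + 1 \<le> 12" by simp
  then have "(j + 1) * L \<le> 12 * L" by (rule mult_right_mono) simp
  moreover have "slot j + 2 * L = base + 2 * ((j + 1) * L)" by (simp add: slot_def)
  ultimately show ?thesis using room by linarith
qed

lemma slot_less: "i < j \<Longrightarrow> slot i + 2 * L \<le> slot j"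
proof -
  assume "i < j"
  then have "(i + 1) * L \<le> j * L" by (intro mult_right_mono) auto
  then show ?thesis by (simp add: slot_def)
qed

lemma slot_disjoint: "i \<noteq> j \<Longrightarrow> slot i + 2 * L \<le> slot j \<or> slot j + 2 * L \<le> slot i"
  using slot_less[of i j] slot_less[of j i] by linarith

lemma exec_addr:
  assumes "R 16 = L" "R 17 = base" "r < 16" "j < 12"
  shows "exec mulcost w (addr r j) (R, m) 4 (R(r := slot j), m)"
proof -
  have "2 * (j * L) + base < 2 ^ w" using slot_bound[of j] assms by (simp add: slot_def)
  then have b: "j * L + j * L + base < 2 ^ w" "j * L + j * L < 2 ^ w" "j * L < 2 ^ w" by auto
  have "j < 2 ^ w" using L_bounds assms by linarith
  then have "straight_state w (addr r j) (R, m) = (R(r := slot j), m)"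
    using b assms by (simp add: addr_def slot_def mult_2 add_ac)
  moreover have "straight (addr r j)" "straight_time (addr r j) = 4" by (simp_all add: addr_def)
  ultimately show ?thesis using exec_straight[of "addr r j" mulcost w "(R, m)"] by simp
qed

lemma awp_le:
  assumes "awp k P Q V B" "k \<le> k'"
  shows "awp k' P Q V B"
proof -
  have "k * K \<le> k' * K" using assms(2) by (rule mult_right_mono) simp
  then show ?thesis using assms(1) unfolding awp_def by (meson le_trans)
qed

text \<open>Postconditions act as continuations: \<open>awp k' P' Q\<close> is itself a predicate on
  registers and buffers, so a sequence is verified from front to back while the costs add
  up.\<close>

lemma awp_Seq:
  assumes "awp k P (\<lambda>V B. awp k' P' Q V B) V B"
  shows "awp (k + k') (Seq P P') Q V B"
  unfolding awp_def
proof (intro allI impI)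
  fix s assume "rep V B s"
  then obtain t s' V' B' where 1: "exec mulcost w P s t s'" "t \<le> k * K" "rep V' B' s'"
    "awp k' P' Q V' B'"
    using assms unfolding awp_def[of k] by blast
  then obtain u s'' V'' B'' where "exec mulcost w P' s' u s''" "u \<le> k' * K" "rep V'' B'' s''"
    "Q V'' B''"
    unfolding awp_def by blast
  with 1 show "\<exists>t s' V' B'. exec mulcost w (Seq P P') s t s' \<and> t \<le> (k + k') * K \<and>
      rep V' B' s' \<and> Q V' B'"
    by (intro exI[of _ "t + u"]) (auto intro: exec.Seq simp: add_mult_distrib simp del: split_paired_Ex)
qed

lemma rep_reg: "rep V B s \<Longrightarrow> 18 \<le> r \<Longrightarrow> fst s r = V r"
  by (simp add: rep_def)

lemma awp_Skip: "Q V B \<Longrightarrow> awp 1 Skip Q V B"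
  unfolding awp_def using K_pos exec.Skip by fastforce

lemma awp_Cond:
  assumes "18 \<le> r" "V r \<noteq> 0 \<Longrightarrow> awp k P Q V B" "V r = 0 \<Longrightarrow> awp k P' Q V B"
  shows "awp (k + 1) (Cond r P P') Q V B"
  unfolding awp_def
proof (intro allI impI)
  fix s assume s: "rep V B s"
  have "\<exists>t s' V' B'. exec mulcost w (Cond r P P') s (1 + t) s' \<and> t \<le> k * K \<and>
      rep V' B' s' \<and> Q V' B'"
  proof (cases "V r = 0")
    case True
    then have "fst s r = 0" using rep_reg[OF s assms(1)] by simp
    with assms(3)[OF True] s show ?thesis unfolding awp_def by (meson exec.CondFalse)
  next
    case False
    then have "fst s r \<noteq> 0" using rep_reg[OF s assms(1)] by simp
    with assms(2)[OF False] s show ?thesis unfolding awp_def by (meson exec.CondTrue)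
  qed
  then obtain t s' V' B' where t: "exec mulcost w (Cond r P P') s (1 + t) s'" "t \<le> k * K"
    "rep V' B' s'" "Q V' B'" by blast
  moreover have "1 + t \<le> (k + 1) * K" using t(2) K_pos by simp
  ultimately show "\<exists>t s' V' B'. exec mulcost w (Cond r P P') s t s' \<and> t \<le> (k + 1) * K \<and>
      rep V' B' s' \<and> Q V' B'" by blast
qed

text \<open>The index of \<open>I\<close> bounds the remaining rounds and must force an exit at 0.
  Each round is charged one unit beyond its body for the test; that unit is available because
  \<open>K\<close> is at least 1.\<close>

lemma awp_While:
  assumes r: "18 \<le> r"
    and body: "\<And>i V B. I (Suc i) V B \<Longrightarrow> V r \<noteq> 0 \<Longrightarrow> awp k P (I i) V B"
    and stop: "\<And>V B. I 0 V B \<Longrightarrow> V r = 0"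
    and Q: "\<And>i V B. I i V B \<Longrightarrow> V r = 0 \<Longrightarrow> Q V B"
  shows "I i V B \<Longrightarrow> awp (i * (k + 1) + 1) (While r P) Q V B"
proof (induction i arbitrary: V B)
  case 0
  show ?case unfolding awp_def
  proof (intro allI impI)
    fix s assume "rep V B s"
    then show "\<exists>t s' V' B'. exec mulcost w (While r P) s t s' \<and> t \<le> (0 * (k + 1) + 1) * K \<and>
        rep V' B' s' \<and> Q V' B'"
      using 0 stop[OF 0] Q[OF 0] r rep_reg K_pos exec.WhileFalse
      by (metis mult_0 add_0 mult_1)
  qed
next
  case (Suc i)
  show ?case unfolding awp_def
  proof (intro allI impI)
    fix s assume s: "rep V B s"
    let ?k = "Suc i * (k + 1) + 1"
    have "\<exists>t s' V' B'. exec mulcost w (While r P) s t s' \<and> t \<le> ?k * K \<and>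
        rep V' B' s' \<and> Q V' B'"
    proof (cases "V r = 0")
      case True
      then have "exec mulcost w (While r P) s 1 s" using rep_reg[OF s r] by (simp add: exec.WhileFalse[simplified])
      moreover have "1 \<le> ?k * K" using K_pos by simp
      ultimately show ?thesis using s Q[OF Suc.prems True] by blast
    next
      case False
      then have n: "fst s r \<noteq> 0" using rep_reg[OF s r] by simp
      obtain t s' V' B' where 1: "exec mulcost w P s t s'" "t \<le> k * K" "rep V' B' s'" "I i V' B'"
        using body[OF Suc.prems False] s unfolding awp_def by blast
      obtain u s'' V'' B'' where 2: "exec mulcost w (While r P) s' u s''"
        "u \<le> (i * (k + 1) + 1) * K" "rep V'' B'' s''" "Q V'' B''"
        using Suc.IH[OF 1(4)] 1(3) unfolding awp_def by blast
      have "exec mulcost w (While r P) s (1 + t + u) s''"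
        by (rule exec.WhileTrue[OF n 1(1) 2(1)])
      moreover have "1 + t + u \<le> K + k * K + (i * (k + 1) + 1) * K"
        using 1(2) 2(2) K_pos by linarith
      then have "1 + t + u \<le> ?k * K" by (simp add: algebra_simps)
      ultimately show ?thesis using 2 by blast
    qed
    then show "\<exists>t s' V' B'. exec mulcost w (While r P) s t s' \<and> t \<le> ?k * K \<and>
        rep V' B' s' \<and> Q V' B'" .
  qed
qed

fun word_state :: "com \<Rightarrow> (reg \<Rightarrow> nat) \<Rightarrow> reg \<Rightarrow> nat" where
  "word_state (Seq P Q) V = word_state Q (word_state P V)"
| "word_state (Const r k) V = V(r := k mod 2 ^ w)"
| "word_state (Op f r a b) V = V(r := apply_op w f (V a) (V b))"
| "word_state _ V = V"

lemma rep_public: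
  "public P \<Longrightarrow> rep V B s \<Longrightarrow> straight P \<and> rep (word_state P V) B (straight_state w P s)"
proof (induction P arbitrary: V s)
  case (Const r k)
  then show ?case by (cases s) (simp add: rep_def)
next
  case (Op f r a b)
  then show ?case by (cases s) (simp add: rep_def)
qed auto

lemma awp_words:
  assumes "public P" "Q (word_state P V) B" "straight_time P \<le> k"
  shows "awp k P Q V B"
  unfolding awp_def
proof (intro allI impI)
  fix s assume "rep V B s"
  with rep_public[OF assms(1)] have "straight P" "rep (word_state P V) B (straight_state w P s)"
    by auto
  moreover have "straight_time P * 1 \<le> k * K" using assms(3) K_pos by (rule mult_le_mono)
  ultimately show "\<exists>t s' V' B'. exec mulcost w P s t s' \<and> t \<le> k * K \<and> rep V' B' s' \<and> Q V' B'"
    using exec_straight[of P mulcost w s] assms(2) by (metis mult.right_neutral)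
qed

text \<open>The factors are read before the product is written, so the three buffers may coincide.
  The double-length product stays inside the \<open>2 * L\<close> words reserved for buffer
  \<open>i\<close>, and its lower half is the product modulo \<open>M\<close>.\<close>

lemma awp_bmul:
  assumes ijk: "i < 12" "j < 12" "k < 12" and Q: "Q V (B(i := B j * B k mod M))"
  shows "awp 1 (bmul i j k) Q V B"
  unfolding awp_def
proof (intro allI impI)
  fix s assume s: "rep V B s"
  obtain R m where [simp]: "s = (R, m)" by force
  have R: "R 16 = L" "R 17 = base" using s by (auto simp: rep_def)
  define R' where "R' = R(0 := slot i, 1 := slot j, 2 := slot k)"
  define p where "p = bignum w m (slot j) L * bignum w m (slot k) L"
  define m' where "m' = (\<lambda>a. if slot i \<le> a \<and> a < slot i + 2 * L then digit w p (a - slot i) else m a)"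
  have R': "R' 0 = slot i" "R' 1 = slot j" "R' 2 = slot k" "R' 16 = L"
    using R by (simp_all add: R'_def)
  have b: "exec mulcost w (BigMul 0 1 2 16) (R', m) (1 + mulcost (L * w)) (R', m')"
    using exec.BigMul[of R' 1 16 w 2 0 p m mulcost] slot_bound[OF ijk(1)] slot_bound[OF ijk(2)]
      slot_bound[OF ijk(3)] R'
    unfolding p_def m'_def by (simp cong: if_cong)
  have "exec mulcost w (bmul i j k) (R, m) (4 + (4 + (4 + (1 + mulcost (L * w))))) (R', m')"
    unfolding bmul_def
    by (rule exec.Seq[OF exec_addr exec.Seq[OF exec_addr exec.Seq[OF exec_addr]]])
      (use R ijk b in \<open>simp_all add: R'_def\<close>)
  moreover have "rep V (B(i := B j * B k mod M)) (R', m')"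
    unfolding rep_def fst_conv snd_conv
  proof (intro conjI allI impI)
    fix j' :: nat assume j': "j' < 12"
    show "bignum w m' (slot j') L = (B(i := B j * B k mod M)) j'"
    proof (cases "j' = i")
      case True
      have "bignum w m' (slot i) L = p mod 2 ^ (w * L)"
        by (rule bignum_digit) (simp add: m'_def)
      then show ?thesis using True s ijk by (simp add: p_def M_def rep_def)
    next
      case False
      have "bignum w m' (slot j') L = bignum w m (slot j') L"
        using slot_disjoint[OF False] by (intro bignum_cong) (auto simp: m'_def)
      then show ?thesis using False s j' by (simp add: rep_def)
    qed
  qed (use s R in \<open>auto simp: rep_def R'_def m'_def digit_less\<close>)
  moreover have "4 + (4 + (4 + (1 + mulcost (L * w)))) \<le> 1 * K" by (simp add: K_def)
  ultimately show "\<exists>t s' V' B'. exec mulcost w (bmul i j k) s t s' \<and> t \<le> 1 * K \<and>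
      rep V' B' s' \<and> Q V' B'"
    using Q unfolding \<open>s = (R, m)\<close> by blast
qed

text \<open>The final borrow in register 19 makes this the comparison as well. The bounds by
  \<open>M\<close> hold for every represented buffer and are passed on to the continuation, where
  \<open>awp_badd\<close> uses them.\<close>

lemma awp_bsub:
  assumes ijk: "i < 12" "j < 12" "k < 12"
    and Q: "B j < M \<Longrightarrow> B k < M \<Longrightarrow>
      Q (V(19 := if B j < B k then 1 else 0)) (B(i := (B j + M - B k) mod M))"
  shows "awp 1 (bsub i j k) Q V B"
  unfolding awp_def
proof (intro allI impI)
  fix s assume s: "rep V B s"
  obtain R m where [simp]: "s = (R, m)" by force
  have R: "R 16 = L" "R 17 = base" and m: "\<And>a. m a < 2 ^ w" using s by (auto simp: rep_def)
  define R1 where "R1 = R(0 := slot i, 1 := slot j, 2 := slot k, 3 := 0, 13 := 1, 6 := L)"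
  let ?pre = "Seq (Const 3 0) (Seq (Const 13 1) (Op Or 6 16 16))"
  let ?R = "R(0 := slot i, 1 := slot j, 2 := slot k)"
  have "straight_state w ?pre (?R, m) = (R1, m)"
    using R word_size by (auto simp: R1_def or_nat_def)
  then have pre: "exec mulcost w ?pre (?R, m) 3 (R1, m)"
    using exec_straight[of ?pre mulcost w "(?R, m)"] by (simp add: numeral_3_eq_3)
  have "\<exists>R' m'. exec mulcost w (While 6 sub_body) (R1, m) (1 + 13 * L) (R', m') \<and>
      (\<forall>r\<ge>14. R' r = R1 r) \<and> R' 3 \<le> 1 \<and> (\<forall>a. m' a < 2 ^ w) \<and>
      (\<forall>a. a < R1 0 \<or> R1 0 + L \<le> a \<longrightarrow> m' a = m a) \<and>
      bignum w m' (R1 0) L + bignum w m (R1 2) L + R1 3 =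
        bignum w m (R1 1) L + R' 3 * 2 ^ (w * L)"
  proof (rule exec_sub_loop[OF word_size])
    show "R1 0 \<le> R1 1 \<or> R1 1 + L \<le> R1 0" "R1 0 \<le> R1 2 \<or> R1 2 + L \<le> R1 0"
      using slot_disjoint[of i j] slot_disjoint[of i k]
      by (cases "i = j"; cases "i = k"; auto simp: R1_def)+
  qed (use m ijk[THEN slot_bound] in \<open>auto simp: R1_def\<close>)
  then obtain R' m' where 0: "exec mulcost w (While 6 sub_body) (R1, m) (1 + 13 * L) (R', m')"
    "\<forall>r\<ge>14. R' r = R1 r" "R' 3 \<le> 1" "\<forall>a. m' a < 2 ^ w"
    "\<forall>a. a < R1 0 \<or> R1 0 + L \<le> a \<longrightarrow> m' a = m a"
    "bignum w m' (R1 0) L + bignum w m (R1 2) L + R1 3 = bignum w m (R1 1) L + R' 3 * 2 ^ (w * L)"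
    by blast
  have R1: "R1 0 = slot i" "R1 1 = slot j" "R1 2 = slot k" "R1 3 = 0"
    by (simp_all add: R1_def)
  note 1 = 0(1) 0(2)[rule_format] 0(3) 0(4)[rule_format] 0(5)[rule_format, unfolded R1]
    0(6)[unfolded R1 add_0_right, folded M_def]
  have x: "bignum w m' (slot i) L < M" unfolding M_def by (rule bignum_less) (rule 1(4))
  have B: "bignum w m (slot j') L = B j'" if "j' < 12" for j'
    using s that by (simp add: rep_def)
  have Bless: "B j' < M" if "j' < 12" for j'
    using bignum_less[of m w "slot j'" L] B[OF that] m by (simp add: M_def)
  have eq: "bignum w m' (slot i) L + B k = B j + R' 3 * M" using 1(6) B ijk by simp
  have b: "R' 3 = (if B j < B k then 1 else 0)"
  proof (cases "R' 3 = 0")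
    case True
    then have "B k \<le> B j" using eq by simp
    then show ?thesis using True by simp
  next
    case False
    then have "R' 3 = 1" using 1(3) by simp
    moreover from this have "B j < B k" using eq x by simp
    ultimately show ?thesis by simp
  qed
  have val: "bignum w m' (slot i) L = (B j + M - B k) mod M"
  proof (cases "B j < B k")
    case True
    then have "R' 3 = 1" using b by simp
    then have "bignum w m' (slot i) L = B j + M - B k" using eq by simp
    with x show ?thesis by simp
  next
    case False
    then have "R' 3 = 0" using b by simp
    then have "bignum w m' (slot i) L = B j - B k" using eq by simp
    moreover have "B j + M - B k = (B j - B k) + M" using False by simp
    ultimately show ?thesis using x by (metis mod_add_self2 mod_less)
  qed
  define R2 where "R2 = R'(19 := apply_op w Or (R' 3) (R' 3))"
  have "exec mulcost w (bsub i j k) (R, m) (4 + (4 + (4 + (3 + ((1 + 13 * L) + 1))))) (R2, m')"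
    unfolding bsub_def
    unfolding R2_def
    by (rule exec.Seq[OF exec_addr exec.Seq[OF exec_addr exec.Seq[OF exec_addr
        exec.Seq[OF pre exec.Seq[OF 1(1) exec.Op]]]]]) (use R ijk in simp_all)
  moreover have "rep (V(19 := if B j < B k then 1 else 0)) (B(i := (B j + M - B k) mod M)) (R2, m')"
    unfolding rep_def fst_conv snd_conv
  proof (intro conjI allI impI)
    fix j' :: nat assume j': "j' < 12"
    show "bignum w m' (slot j') L = (B(i := (B j + M - B k) mod M)) j'"
    proof (cases "j' = i")
      case True then show ?thesis using val by simp
    next
      case False
      have "bignum w m' (slot j') L = bignum w m (slot j') L"
        using slot_disjoint[OF False] by (intro bignum_cong 1(5)) auto
      then show ?thesis using False B j' by simp
    qed
  next
    fix r :: nat assume "18 \<le> r"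
    then show "R2 r = (V(19 := if B j < B k then 1 else 0)) r"
      using s 1(2)[of r] b by (simp add: rep_def R2_def R1_def)
  qed (use R 1 in \<open>simp_all add: R2_def R1_def\<close>)
  moreover have "4 + (4 + (4 + (3 + ((1 + 13 * L) + 1)))) \<le> 1 * K" by (simp add: K_def)
  ultimately show "\<exists>t s' V' B'. exec mulcost w (bsub i j k) s t s' \<and> t \<le> 1 * K \<and>
      rep V' B' s' \<and> Q V' B'"
    using Q Bless ijk unfolding \<open>s = (R, m)\<close> by blast
qed

end


section \<open>The programs\<close>

text \<open>Binary powering from the lowest bit: buffer \<open>d\<close> accumulates, buffer 5 is
  squared, register \<open>e\<close> is consumed. Multiplication with buffer 1 initialises both
  buffers; register 18, which holds one, is bit mask and shift distance.\<close>

definition bpow :: "nat \<Rightarrow> nat \<Rightarrow> reg \<Rightarrow> com" where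
  "bpow d b e = Seq (bmul d 1 1) (Seq (bmul 5 b 1) (While e
    (Seq (Op And 31 e 18) (Seq (Cond 31 (bmul d d 5) Skip) (Seq (bmul 5 5 5) (Op Shr e e 18))))))"

definition bsearch :: "com \<Rightarrow> com" where
  "bsearch test = Seq (Op Less 27 24 25) (While 27
    (Seq (Seq (Op Add 26 24 25) (Op Shr 26 26 18))
    (Seq test (Seq (Cond 28 (Op Or 25 26 26) (Op Add 24 26 18)) (Op Less 27 24 25)))))"

context bignum_machine
begin

lemma awp_bpow:
  assumes one: "V 18 = 1" "B 1 = 1"
    and slots: "d < 12" "b < 12" "d \<notin> {1, 5, b}" "b \<noteq> 5"
    and e: "18 \<le> e" "e \<notin> {18, 31}" "V e < 2 ^ w"
    and Q: "\<And>V' B'. (\<And>r. r \<noteq> e \<Longrightarrow> r \<noteq> 31 \<Longrightarrow> V' r = V r) \<Longrightarrow>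
      (\<And>j. j \<noteq> d \<Longrightarrow> j \<noteq> 5 \<Longrightarrow> B' j = B j) \<Longrightarrow> B' d = B b ^ V e mod M \<Longrightarrow> Q V' B'"
  shows "awp (6 * w + 3) (bpow d b e) Q V B"
proof -
  \<comment> \<open>The product of the accumulator and the remaining power is invariant modulo
    \<open>M\<close>. The bound \<open>B' d < M\<close> turns the congruence at exponent 0 into an
    equality.\<close>
  define I where "I i V' B' \<longleftrightarrow> V' e < 2 ^ i \<and> B' d < M \<and> B' d * B' 5 ^ V' e mod M = B b ^ V e mod M \<and>
    (\<forall>r. r \<noteq> e \<longrightarrow> r \<noteq> 31 \<longrightarrow> V' r = V r) \<and> (\<forall>j. j \<noteq> d \<longrightarrow> j \<noteq> 5 \<longrightarrow> B' j = B j)"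
    for i V' B'
  let ?body = "Seq (Op And 31 e 18) (Seq (Cond 31 (bmul d d 5) Skip)
    (Seq (bmul 5 5 5) (Op Shr e e 18)))"
  have loop: "awp (w * (5 + 1) + 1) (While e ?body) Q V1 B1" if "I w V1 B1" for V1 B1
  proof (rule awp_While[where I = I, OF e(1) _ _ _ that])
    fix i V' B' assume I: "I (Suc i) V' B'"
    have step: "I i (V'(31 := x, e := V' e div 2)) (B'(d := y, 5 := B' 5 * B' 5 mod M))"
      if y: "y = (if odd (V' e) then B' d * B' 5 mod M else B' d)" for x y
    proof -
      have *: "V' e = 2 * (V' e div 2) + V' e mod 2" by simp
      have sq: "B' 5 ^ V' e = (B' 5 * B' 5) ^ (V' e div 2) * B' 5 ^ (V' e mod 2)"
        by (subst *) (simp only: power_add power_mult power2_eq_square)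
      have m: "u * (v mod M) ^ k mod M = u * v ^ k mod M" for u v k
        by (metis mod_mult_right_eq power_mod)
      have "y * (B' 5 * B' 5 mod M) ^ (V' e div 2) mod M = B' d * B' 5 ^ V' e mod M"
      proof (cases "odd (V' e)")
        case True
        then have "V' e mod 2 = 1" by presburger
        then have "y * (B' 5 * B' 5) ^ (V' e div 2) mod M = B' d * B' 5 ^ V' e mod M"
          using True y sq by (simp add: mod_simps mult_ac)
        then show ?thesis by (simp only: m)
      next
        case False
        then have "V' e mod 2 = 0" by presburger
        then show ?thesis using False y sq by (simp add: m)
      qed
      moreover have "y < M" using I M_gt_1 y by (simp add: I_def)
      moreover have "V' e div 2 < 2 ^ i" using I by (simp add: I_def div_less_iff_less_mult mult.commute)
      ultimately show ?thesis using I e slots by (simp add: I_def)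
    qed
    have V18: "V' 18 = 1" using I e one by (simp add: I_def)
    have tail: "awp 2 (Seq (bmul 5 5 5) (Op Shr e e 18)) (I i) (V'(31 := V' e mod 2)) (B'(d := y))"
      if y: "y = (if odd (V' e) then B' d * B' 5 mod M else B' d)" for y
    proof -
      have "awp (1 + 1) (Seq (bmul 5 5 5) (Op Shr e e 18)) (I i) (V'(31 := V' e mod 2)) (B'(d := y))"
        by (rule awp_Seq, rule awp_bmul, simp, simp, simp, rule awp_words)
          (use e slots V18 step[OF y, of "V' e mod 2"] in simp_all)
      then show ?thesis by (rule awp_le) simp
    qed
    have "awp 2 (Cond 31 (bmul d d 5) Skip)
      (awp 2 (Seq (bmul 5 5 5) (Op Shr e e 18)) (I i)) (V'(31 := V' e mod 2)) B'"
    proof (rule awp_le[OF awp_Cond[where k = 1]])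
      assume "(V'(31 := V' e mod 2)) 31 \<noteq> 0"
      then have "odd (V' e)" by (simp add: odd_iff_mod_2_eq_one)
      then show "awp 1 (bmul d d 5) (awp 2 (Seq (bmul 5 5 5) (Op Shr e e 18)) (I i))
          (V'(31 := V' e mod 2)) B'"
        using slots by (intro awp_bmul tail) simp_all
    next
      assume "(V'(31 := V' e mod 2)) 31 = 0"
      then have "even (V' e)" by (simp add: even_iff_mod_2_eq_zero)
      then show "awp 1 Skip (awp 2 (Seq (bmul 5 5 5) (Op Shr e e 18)) (I i))
          (V'(31 := V' e mod 2)) B'"
        using tail[of "B' d"] by (intro awp_Skip) simp
    qed simp_all
    from awp_Seq[OF this] have "awp (1 + (2 + 2)) ?body (I i) V' B'"
      by (rule_tac awp_Seq, rule_tac awp_words) (use e V18 in \<open>simp_all add: and_one_eq\<close>)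
    then show "awp 5 ?body (I i) V' B'" by (rule awp_le) simp
  qed (auto simp: I_def intro!: Q)
  have "1 * (B b * 1 mod M) ^ V e mod M = B b ^ V e mod M"
    by (simp add: power_mod)
  then have I: "I w V (B(d := 1 * 1 mod M, 5 := B b * 1 mod M))"
    using slots e M_gt_1 by (simp add: I_def)
  have "awp (1 + (1 + (w * (5 + 1) + 1))) (bpow d b e) Q V B"
    unfolding bpow_def
    by (intro awp_Seq awp_bmul loop) (use slots one I in simp_all)
  then show ?thesis by (rule awp_le) simp
qed

text \<open>\<open>I\<close> is the invariant of the caller and must survive changes to the search
  registers. The test is only run strictly below the initial upper bound, which is taken as correct
  from the start: sampling thus never tests \<open>z = n\<close>, and the search for
  \<open>clog k\<close> never forms a power that exceeds \<open>M\<close>.\<close>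

lemma awp_bsearch:
  assumes init: "I V B" "V 24 \<le> z" "z \<le> V 25" "2 * V 25 < 2 ^ w"
    and one: "\<And>V B. I V B \<Longrightarrow> V 18 = 1"
    and stable: "\<And>V B r x. I V B \<Longrightarrow> r \<in> {24, 25, 26, 27} \<Longrightarrow> I (V(r := x)) B"
    and test: "\<And>V' B' Q. I V' B' \<Longrightarrow> V' 26 < V 25 \<Longrightarrow>
      (\<And>V'' B''. I V'' B'' \<Longrightarrow> V'' 24 = V' 24 \<Longrightarrow> V'' 25 = V' 25 \<Longrightarrow> V'' 26 = V' 26 \<Longrightarrow>
        (V'' 28 \<noteq> 0 \<longleftrightarrow> z \<le> V' 26) \<Longrightarrow> Q V'' B'') \<Longrightarrow> awp k test Q V' B'"
    and Q: "\<And>V' B'. I V' B' \<Longrightarrow> V' 24 = z \<Longrightarrow> Q V' B'"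
  shows "awp (w * (k + 6) + 2) (bsearch test) Q V B"
proof -
  define J where "J i V' B' \<longleftrightarrow> I V' B' \<and> V' 24 \<le> z \<and> z \<le> V' 25 \<and> V' 25 \<le> V 25 \<and>
    V' 25 - V' 24 < 2 ^ i \<and> V' 27 = (if V' 24 < V' 25 then 1 else 0)" for i V' B'
  let ?body = "Seq (Seq (Op Add 26 24 25) (Op Shr 26 26 18))
    (Seq test (Seq (Cond 28 (Op Or 25 26 26) (Op Add 24 26 18)) (Op Less 27 24 25)))"
  have loop: "awp (w * ((k + 5) + 1) + 1) (While 27 ?body) Q V1 B1" if "J w V1 B1" for V1 B1
  proof (rule awp_While[where I = J, OF _ _ _ _ that])
    fix i V' B' assume J: "J (Suc i) V' B'" "V' 27 \<noteq> 0"
    define mid where "mid = (V' 24 + V' 25) div 2"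
    \<comment> \<open>The upper half may still have length \<open>2 ^ i\<close>; moving the lower
      bound to \<open>mid + 1\<close> rather than \<open>mid\<close> makes the gap strictly
      smaller.\<close>
    have mid: "V' 24 \<le> mid" "mid < V' 25" "V' 25 - mid \<le> 2 ^ i" "mid - V' 24 < 2 ^ i"
      "V' 24 + V' 25 < 2 ^ w" "V' 25 \<le> V 25"
      using J init(4) unfolding J_def mid_def by (auto split: if_splits)
    have V18: "V' 18 = 1" using J one[of V' B'] by (simp add: J_def)
    have "awp (k + (2 + 1)) (Seq test (Seq (Cond 28 (Op Or 25 26 26) (Op Add 24 26 18)) (Op Less 27 24 25)))
      (J i) (V'(26 := mid)) B'"
    proof (rule awp_Seq, rule test)
      show "I (V'(26 := mid)) B'" using J stable by (simp add: J_def)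
      show "(V'(26 := mid)) 26 < V 25" using mid by simp
      fix V'' B''
      assume 1: "I V'' B''" "V'' 24 = (V'(26 := mid)) 24" "V'' 25 = (V'(26 := mid)) 25"
        "V'' 26 = (V'(26 := mid)) 26" "V'' 28 \<noteq> 0 \<longleftrightarrow> z \<le> (V'(26 := mid)) 26"
      have V18: "V'' 18 = 1" using 1 one[of V'' B''] by simp
      show "awp (2 + 1) (Seq (Cond 28 (Op Or 25 26 26) (Op Add 24 26 18)) (Op Less 27 24 25)) (J i) V'' B''"
      proof (rule awp_Seq, rule awp_le[OF awp_Cond[where k = 1]])
        assume "V'' 28 \<noteq> 0"
        then show "awp 1 (Op Or 25 26 26) (awp 1 (Op Less 27 24 25) (J i)) V'' B''"
          using 1 J mid stable by (intro awp_words) (simp_all add: J_def)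
      next
        assume "V'' 28 = 0"
        then show "awp 1 (Op Add 24 26 18) (awp 1 (Op Less 27 24 25) (J i)) V'' B''"
          using 1 J mid stable V18 by (intro awp_words) (auto simp add: J_def)
      qed simp_all
    qed
    then have "awp (2 + (k + (2 + 1))) ?body (J i) V' B'"
      by (rule_tac awp_Seq, rule_tac awp_words) (use V18 mid in \<open>simp_all add: mid_def\<close>)
    then show "awp (k + 5) ?body (J i) V' B'" by (rule awp_le) simp
  qed (auto simp: J_def intro!: Q split: if_splits)
  have "J w (V(27 := if V 24 < V 25 then 1 else 0)) B"
    using init stable by (simp add: J_def)
  then have "awp (1 + (w * ((k + 5) + 1) + 1)) (bsearch test) Q V B"
    unfolding bsearch_def by (intro awp_Seq awp_words loop) simp_all
  then show ?thesis by (rule awp_le) simp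
qed

end

text \<open>Buffer 10 is scratch: subtracted from itself, it provides the zero from which the second
  summand is negated.\<close>

definition badd :: "nat \<Rightarrow> nat \<Rightarrow> nat \<Rightarrow> com" where
  "badd i j k = Seq (bsub 10 10 10) (Seq (bsub 10 10 k) (bsub i j 10))"

text \<open>Leaves \<open>geo_term q n a\<close> in buffer 8, where register 32 holds
  \<open>a\<close>.\<close>

definition term_prog :: com where
  "term_prog = Seq (Op Sub 33 20 32) (Seq (bpow 8 6 32) (Seq (bpow 4 7 33) (bmul 8 8 4)))"

text \<open>The exponent is copied to register 29 because \<open>bpow\<close> consumes it. The
  borrow of \<open>2 ^ e - k\<close> says \<open>2 ^ e < k\<close>; comparing it with one negates
  it.\<close>

definition clog_test :: com where
  "clog_test = Seq (Op Or 29 26 26) (Seq (bpow 4 3 29) (Seq (bsub 10 4 2) (Op Less 28 19 18)))"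

definition total_prog :: com where
  "total_prog =
    Seq (Seq (Const 24 0) (Op Or 25 21 21)) (Seq (bsearch clog_test)
    (Seq (Op Add 23 24 18) (Seq (bpow 6 3 23) (Seq (badd 7 6 1)
    (Seq (Const 32 0) (Seq term_prog (Seq (bmul 9 8 1)
    (Seq (Const 32 1) (Seq term_prog (badd 9 9 8))))))))))"

definition sample_test :: com where
  "sample_test = Seq (Op Less 34 26 22) (Seq (Cond 34
      (Seq (Op Sub 32 22 26) (Seq term_prog (bsub 10 8 0)))
      (Seq (Seq (Op Add 32 26 18) (Op Sub 32 32 22)) (Seq term_prog (bsub 10 9 8))))
    (Op Less 28 19 18))"

text \<open>Buffer 9 is changed once from \<open>d\<close> to \<open>d - u\<close>. For
  \<open>c \<le> z\<close> the test \<open>u \<le> d - geo_term q n a\<close> then becomes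
  \<open>geo_term q n a \<le> d - u\<close>, a single subtraction per round.\<close>

definition sample_prog :: com where
  "sample_prog = Seq (bsub 9 9 0) (Seq (Seq (Const 24 0) (Op Or 25 20 20)) (bsearch sample_test))"

text \<open>For \<open>c = 0\<close> only upper tails occur, and at \<open>z = n\<close> buffer 9
  already holds the answer \<open>d\<close>.\<close>

definition cdf_prog :: com where
  "cdf_prog = Seq (Op Less 34 22 20)
    (Cond 34 (Seq (Op Add 32 22 18) (Seq term_prog (bsub 9 9 8))) Skip)"

context bignum_machine
begin

lemma awp_badd:
  assumes ijk: "i < 12" "j < 12" "k < 12" "j \<noteq> 10" "k \<noteq> 10" "i \<noteq> 10"
    and Q: "\<And>V' B'. (\<And>r. r \<noteq> 19 \<Longrightarrow> V' r = V r) \<Longrightarrow> (\<And>l. l \<noteq> i \<Longrightarrow> l \<noteq> 10 \<Longrightarrow> B' l = B l) \<Longrightarrow>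
      B' i = (B j + B k) mod M \<Longrightarrow> Q V' B'"
  shows "awp 3 (badd i j k) Q V B"
proof -
  have *: "(a + M - (((x + M - x) mod M + M - b) mod M)) mod M = (a + b) mod M" if "b < M" for a b x
  proof (cases "b = 0")
    case False
    have "(x + M - x) mod M = 0" by simp
    then have "((x + M - x) mod M + M - b) mod M = M - b" using False that by simp
    moreover have "a + M - (M - b) = a + b" using that by simp
    ultimately show ?thesis by simp
  qed simp
  have "awp (1 + (1 + 1)) (badd i j k) Q V B"
    unfolding badd_def
    apply (rule awp_Seq, rule awp_bsub, simp, simp, simp)
    apply (rule awp_Seq, rule awp_bsub, simp, simp, simp add: ijk)
    apply (rule awp_bsub, simp add: ijk, simp add: ijk, simp)
    apply (rule Q)
    using ijk * by (simp_all del: diff_add_inverse2 diff_add_inverse)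
  then show ?thesis by (rule awp_le) simp
qed

lemma awp_term_prog:
  assumes one: "V 18 = 1" "B 1 = 1" and a: "V 32 \<le> V 20" "V 20 < 2 ^ w"
    and Q: "\<And>V' B'. (\<And>r. r \<notin> {31, 32, 33} \<Longrightarrow> V' r = V r) \<Longrightarrow> (\<And>j. j \<notin> {4, 5, 8} \<Longrightarrow> B' j = B j) \<Longrightarrow>
      B' 8 = B 6 ^ V 32 * B 7 ^ (V 20 - V 32) mod M \<Longrightarrow> Q V' B'"
  shows "awp (12 * w + 8) term_prog Q V B"
proof -
  have sub: "(V 20 + 2 ^ w - V 32) mod 2 ^ w = V 20 - V 32"
  proof -
    have "V 20 + 2 ^ w - V 32 = (V 20 - V 32) + 2 ^ w" using a by simp
    then show ?thesis using a by (metis less_imp_diff_less mod_add_self2 mod_less)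
  qed
  have "awp (1 + ((6 * w + 3) + ((6 * w + 3) + 1))) term_prog Q V B"
    unfolding term_prog_def
    apply (rule awp_Seq, rule awp_words, simp)
     apply (rule awp_Seq, rule awp_bpow)
            apply (use one a in simp_all)[9]
     apply (rule awp_Seq, rule awp_bpow)
            apply (use one a in simp_all)[9]
     apply (rule awp_bmul, simp, simp, simp)
     apply (rule Q)
       apply (simp_all add: sub mod_mult_eq)
    done
  then show ?thesis by (rule awp_le) simp
qed

lemma awp_clog_test:
  assumes V: "V 18 = 1" "V 26 < 2 ^ w" "V 26 < w * L" and B: "B 1 = 1" "B 2 = k" "B 3 = 2"
    and Q: "\<And>V' B'. (\<And>r. r \<notin> {19, 28, 29, 31} \<Longrightarrow> V' r = V r) \<Longrightarrow> (\<And>j. j \<notin> {4, 5, 10} \<Longrightarrow> B' j = B j) \<Longrightarrow>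
      (V' 28 \<noteq> 0 \<longleftrightarrow> clog k \<le> V 26) \<Longrightarrow> Q V' B'"
  shows "awp (6 * w + 6) clog_test Q V B"
proof -
  \<comment> \<open>Reduction modulo \<open>M = 2 ^ (w * L)\<close> is harmless for exponents below
    \<open>w * L\<close>, so the comparison with \<open>k\<close> concerns the true power.\<close>
  have pw: "2 ^ V 26 mod M = 2 ^ V 26" using V(3) by (simp add: M_def)
  have "awp (1 + ((6 * w + 3) + (1 + 1))) clog_test Q V B"
    unfolding clog_test_def
    apply (rule awp_Seq, rule awp_words, simp)
     apply (rule awp_Seq, rule awp_bpow)
            apply (use V B in simp_all)[9]
     apply (rule awp_Seq, rule awp_bsub, simp, simp, simp)
     apply (rule awp_words, simp)
      apply (rule Q)
        apply (simp_all add: clog_le_iff pw V B linorder_not_less)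
    done
  then show ?thesis by (rule awp_le) simp
qed

text \<open>Each term is at most \<open>geo_total\<close>, which is below \<open>M\<close>; so
  arithmetic modulo \<open>M\<close> gives the exact integers.\<close>

lemma awp_term_sum:
  assumes V: "V 18 = 1" "V 20 = n" and B: "B 1 = 1" "B 6 = q" "B 7 = q + 1"
    and n: "1 \<le> n" "n < 2 ^ w" and M: "geo_total q n < M"
    and Q: "\<And>V' B'. V' 18 = 1 \<Longrightarrow> V' 20 = n \<Longrightarrow> V' 22 = V 22 \<Longrightarrow> B' 0 = B 0 \<Longrightarrow> B' 1 = 1 \<Longrightarrow>
      B' 6 = q \<Longrightarrow> B' 7 = q + 1 \<Longrightarrow> B' 9 = geo_total q n \<Longrightarrow> Q V' B'"
  shows "awp (24 * w + 22) (Seq (Const 32 0) (Seq term_prog (Seq (bmul 9 8 1)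
    (Seq (Const 32 1) (Seq term_prog (badd 9 9 8)))))) Q V B"
proof -
  have term_mod: "q ^ a * (q + 1) ^ (n - a) mod M = geo_term q n a" if "a \<le> n" for a
    using geo_term_le_total[OF that, of q] M by (simp add: geo_term_def)
  have t: "geo_term q n 0 mod M = geo_term q n 0"
    "(geo_term q n 0 + geo_term q n 1) mod M = geo_total q n"
    using M by (simp_all add: geo_total_def)
  have one: "1 mod 2 ^ w = (1::nat)"
    using word_size one_less_power[of "2::nat" w] by simp
  have "awp (1 + ((12 * w + 8) + (1 + (1 + ((12 * w + 8) + 3))))) (Seq (Const 32 0)
    (Seq term_prog (Seq (bmul 9 8 1) (Seq (Const 32 1) (Seq term_prog (badd 9 9 8)))))) Q V B"
  proof (rule awp_Seq, rule awp_words)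
    show "awp ((12 * w + 8) + (1 + (1 + ((12 * w + 8) + 3)))) (Seq term_prog (Seq (bmul 9 8 1)
      (Seq (Const 32 1) (Seq term_prog (badd 9 9 8))))) Q (word_state (Const 32 0) V) B"
    proof (rule awp_Seq, rule awp_term_prog, goal_cases)
      case (5 V1 B1)
      then have 1: "V1 18 = 1" "V1 20 = n" "V1 22 = V 22" "B1 0 = B 0" "B1 1 = 1" "B1 6 = q"
        "B1 7 = q + 1" "B1 8 = geo_term q n 0"
        using V B term_mod[of 0] by simp_all
      show ?case
      proof (rule awp_Seq, rule awp_bmul, simp, simp, simp, rule awp_Seq, rule awp_words)
        show "awp ((12 * w + 8) + 3) (Seq term_prog (badd 9 9 8)) Q (word_state (Const 32 1) V1)
          (B1(9 := B1 8 * B1 1 mod M))"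
        proof (rule awp_Seq, rule awp_term_prog, goal_cases)
          case (5 V2 B2)
          then have 2: "V2 18 = 1" "V2 20 = n" "V2 22 = V 22" "B2 0 = B 0" "B2 1 = 1" "B2 6 = q"
            "B2 7 = q + 1" "B2 8 = geo_term q n 1" "B2 9 = geo_term q n 0"
            using 1 term_mod[of 1] t(1) one n(1) by simp_all
          show ?case
            by (rule awp_badd; (rule Q)?) (use 2 t(2) in simp_all)
        qed (use 1 n one in simp_all)
      qed simp_all
    qed (use V B n in simp_all)
  qed simp_all
  then show ?thesis by (rule awp_le) simp
qed

lemma awp_total_prog:
  assumes V: "V 18 = 1" "V 20 = n" "V 21 = h" and B: "B 1 = 1" "B 2 = k" "B 3 = 2"
    and n: "1 \<le> n" "n < 2 ^ w" and h: "2 * h < 2 ^ w" "h \<le> w * L" "k \<le> 2 ^ h"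
    and M: "geo_total (geo_base k) n < M"
    and Q: "\<And>V' B'. V' 18 = 1 \<Longrightarrow> V' 20 = n \<Longrightarrow> V' 22 = V 22 \<Longrightarrow> B' 0 = B 0 \<Longrightarrow> B' 1 = 1 \<Longrightarrow>
      B' 6 = geo_base k \<Longrightarrow> B' 7 = geo_base k + 1 \<Longrightarrow> B' 9 = geo_total (geo_base k) n \<Longrightarrow> Q V' B'"
  shows "awp (6 * w ^ 2 + 42 * w + 40) total_prog Q V B"
proof -
  let ?q = "geo_base k"
  define I where "I V' B' \<longleftrightarrow> (\<forall>r. r \<notin> {19, 24, 25, 26, 27, 28, 29, 31} \<longrightarrow> V' r = V r) \<and>
    (\<forall>j. j \<notin> {4, 5, 10} \<longrightarrow> B' j = B j)" for V' B' :: "nat \<Rightarrow> nat"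
  \<comment> \<open>Since \<open>n\<close> is at least 1, \<open>q + 1\<close> is at most
    \<open>(q + 1) ^ n\<close>, a summand of \<open>geo_total\<close>.\<close>
  have q: "?q + 1 < M"
  proof -
    have "(?q + 1) ^ 1 \<le> (?q + 1) ^ n" using n by (intro power_increasing) auto
    then show ?thesis using geo_term_le_total[of 0 n ?q] M by (simp add: geo_term_def)
  qed
  have clog: "clog k \<le> h" using h by (simp add: clog_le_iff)
  have four: "4 \<le> (2::nat) ^ w" using power_increasing[OF word_size, of "2::nat"] by simp
  have base: "2 ^ (clog k + 1) mod M = ?q" using q by (simp add: geo_base_def)
  let ?sum = "Seq (Const 32 0) (Seq term_prog (Seq (bmul 9 8 1)
    (Seq (Const 32 1) (Seq term_prog (badd 9 9 8)))))"
  have "awp (2 + ((w * ((6 * w + 6) + 6) + 2) + (1 + ((6 * w + 3) + (3 + (24 * w + 22)))))) total_prog Q V B"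
    unfolding total_prog_def
  proof (rule awp_Seq, rule awp_words)
    show "awp ((w * ((6 * w + 6) + 6) + 2) + (1 + ((6 * w + 3) + (3 + (24 * w + 22)))))
      (Seq (bsearch clog_test) (Seq (Op Add 23 24 18) (Seq (bpow 6 3 23) (Seq (badd 7 6 1) ?sum)))) Q
      (word_state (Seq (Const 24 0) (Op Or 25 21 21)) V) B"
    proof (rule awp_Seq, rule awp_bsearch[where I = I and z = "clog k"], goal_cases)
      case (7 V' B' Q)
      then have b: "V' 18 = 1" "V' 26 < h" "B' 1 = 1" "B' 2 = k" "B' 3 = 2"
        using V B by (simp_all add: I_def)
      show ?case
        by (rule awp_clog_test; (rule 7(3))?) (use 7(1) b h in \<open>simp_all add: I_def\<close>)
    next
      case 6
      then show ?case by (auto simp: I_def)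
    next
      case (8 V1 B1)
      then have 1: "V1 18 = 1" "V1 20 = n" "V1 22 = V 22" "B1 0 = B 0" "B1 1 = 1" "B1 3 = 2"
        "V1 24 = clog k"
        using V B by (simp_all add: I_def)
      have c: "clog k + 1 < 2 ^ w" using clog h four by linarith
      show ?case
      proof (rule awp_Seq, rule awp_words)
        show "awp ((6 * w + 3) + (3 + (24 * w + 22))) (Seq (bpow 6 3 23) (Seq (badd 7 6 1) ?sum)) Q
          (word_state (Op Add 23 24 18) V1) B1"
        proof (rule awp_Seq, rule awp_bpow, goal_cases)
          case (10 V2 B2)
          then have 2: "V2 18 = 1" "V2 20 = n" "V2 22 = V 22" "B2 0 = B 0" "B2 1 = 1" "B2 6 = ?q"
            using 1 base c by simp_all
          show ?case
          proof (rule awp_Seq, rule awp_badd, goal_cases)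
            case (7 V3 B3)
            then have 3: "V3 18 = 1" "V3 20 = n" "V3 22 = V 22" "B3 0 = B 0" "B3 1 = 1" "B3 6 = ?q"
              "B3 7 = ?q + 1"
              using 2 q by simp_all
            show ?case by (rule awp_term_sum; (rule Q)?) (use 3 n M in simp_all)
          qed simp_all
        qed (use 1 c in simp_all)
      qed simp_all
    qed (use V h clog in \<open>simp_all add: I_def\<close>)
  qed simp_all
  then show ?thesis by (rule awp_le) (simp add: power2_eq_square algebra_simps)
qed

lemma awp_sample_test:
  assumes V: "V 18 = 1" "V 20 = n" "V 22 = c" "V 26 < n"
    and B: "B 0 = u" "B 1 = 1" "B 6 = q" "B 7 = q + 1" "B 9 = geo_total q n - u"
    and n: "c \<le> n" "2 * n < 2 ^ w" and M: "geo_total q n < M" and u: "u \<le> geo_total q n"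
    and Q: "\<And>V' B'. (\<And>r. r \<notin> {19, 28, 31, 32, 33, 34} \<Longrightarrow> V' r = V r) \<Longrightarrow>
      (\<And>j. j \<notin> {4, 5, 8, 10} \<Longrightarrow> B' j = B j) \<Longrightarrow>
      (V' 28 \<noteq> 0 \<longleftrightarrow> geo_sample q n c u \<le> V 26) \<Longrightarrow> Q V' B'"
  shows "awp (12 * w + 14) sample_test Q V B"
proof -
  have term_mod: "q ^ a * (q + 1) ^ (n - a) mod M = geo_term q n a" if "a \<le> n" for a
    using geo_term_le_total[OF that, of q] M by (simp add: geo_term_def)
  let ?lo = "Seq (Op Sub 32 22 26) (Seq term_prog (bsub 10 8 0))"
  let ?hi = "Seq (Seq (Op Add 32 26 18) (Op Sub 32 32 22)) (Seq term_prog (bsub 10 9 8))"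
  let ?z = "V 26"
  have lo: "awp (2 + ((12 * w + 8) + 1)) ?lo (awp 1 (Op Less 28 19 18) Q) (V(34 := x)) B"
    if z: "?z < c" for x
  proof (rule awp_Seq, rule awp_words)
    define a where "a = c - ?z"
    have a: "a \<le> n" "c + 2 ^ w - ?z = a + 2 ^ w" "a < 2 ^ w"
      using z n by (auto simp: a_def)
    have s: "geo_sample q n c u \<le> ?z \<longleftrightarrow> u \<le> geo_term q n a"
      using n u z by (simp add: geo_sample_le_iff geo_cdf_def a_def)
    have 1: "word_state (Op Sub 32 22 26) (V(34 := x)) = V(34 := x, 32 := a)"
      using V(3) a(2,3) by simp
    show "awp ((12 * w + 8) + 1) (Seq term_prog (bsub 10 8 0)) (awp 1 (Op Less 28 19 18) Q)
        (word_state (Op Sub 32 22 26) (V(34 := x))) B"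
      unfolding 1
    proof (rule awp_Seq, rule awp_term_prog, goal_cases)
      case (5 V1 B1)
      have b: "B1 8 = geo_term q n a" "B1 0 = u" "V1 18 = 1"
        using 5 V(1,2) B term_mod[OF a(1)] by simp_all
      show ?case
        by (rule awp_bsub, simp, simp, simp, rule awp_words, simp, rule Q)
          (use 5(1,2) b s in \<open>simp_all add: linorder_not_less\<close>)
    qed (use V(1,2) B n a in simp_all)
  qed simp_all
  have hi: "awp (2 + ((12 * w + 8) + 1)) ?hi (awp 1 (Op Less 28 19 18) Q) (V(34 := x)) B"
    if z: "\<not> ?z < c" for x
  proof (rule awp_Seq, rule awp_words)
    define a where "a = ?z + 1 - c"
    have a: "a \<le> n" "?z + 1 + 2 ^ w - c = a + 2 ^ w" "a < 2 ^ w" "(?z + 1) mod 2 ^ w = ?z + 1"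
      using z n V(4) by (auto simp: a_def)
    have "geo_sample q n c u \<le> ?z \<longleftrightarrow> u \<le> geo_total q n - geo_term q n a"
      using n u z V(4) by (simp add: geo_sample_le_iff geo_cdf_def a_def)
    then have s: "geo_sample q n c u \<le> ?z \<longleftrightarrow> geo_term q n a \<le> geo_total q n - u"
      using u geo_term_le_total[OF a(1), of q] by linarith
    have 1: "word_state (Seq (Op Add 32 26 18) (Op Sub 32 32 22)) (V(34 := x)) =
        V(34 := x, 32 := a)"
      using V(1,3) a(2-4) by simp
    show "awp ((12 * w + 8) + 1) (Seq term_prog (bsub 10 9 8)) (awp 1 (Op Less 28 19 18) Q)
        (word_state (Seq (Op Add 32 26 18) (Op Sub 32 32 22)) (V(34 := x))) B"
      unfolding 1
    proof (rule awp_Seq, rule awp_term_prog, goal_cases)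
      case (5 V1 B1)
      have b: "B1 8 = geo_term q n a" "B1 9 = geo_total q n - u" "V1 18 = 1"
        using 5 V(1,2) B term_mod[OF a(1)] by simp_all
      show ?case
        by (rule awp_bsub, simp, simp, simp, rule awp_words, simp, rule Q)
          (use 5(1,2) b s in \<open>simp_all add: linorder_not_less\<close>)
    qed (use V(1,2) B n a in simp_all)
  qed simp_all
  have "awp (1 + ((2 + ((12 * w + 8) + 1) + 1) + 1)) sample_test Q V B"
    unfolding sample_test_def
    by (rule awp_Seq, rule awp_words, simp, rule awp_Seq, rule awp_Cond)
      (use lo hi V in \<open>simp_all split: if_splits\<close>)
  then show ?thesis by (rule awp_le) simp
qed

lemma awp_sample_prog:
  assumes V: "V 18 = 1" "V 20 = n" "V 22 = c"
    and B: "B 0 = u" "B 1 = 1" "B 6 = q" "B 7 = q + 1" "B 9 = geo_total q n"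
    and n: "c \<le> n" "2 * n < 2 ^ w" and M: "geo_total q n < M" and u: "u \<le> geo_total q n"
    and Q: "\<And>V' B'. V' 24 = geo_sample q n c u \<Longrightarrow> Q V' B'"
  shows "awp (12 * w ^ 2 + 20 * w + 5) sample_prog Q V B"
proof -
  define I where "I V' B' \<longleftrightarrow> V' 18 = 1 \<and> V' 20 = n \<and> V' 22 = c \<and> B' 0 = u \<and> B' 1 = 1 \<and> B' 6 = q \<and>
    B' 7 = q + 1 \<and> B' 9 = geo_total q n - u" for V' B' :: "nat \<Rightarrow> nat"
  have "(geo_total q n + M - u) mod M = geo_total q n - u"
  proof -
    have "geo_total q n + M - u = (geo_total q n - u) + M" using u by simp
    moreover have "geo_total q n - u < M" using M by simp
    ultimately show ?thesis by (metis mod_add_self2 mod_less)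
  qed
  then have I: "I (V(19 := x, 24 := 0, 25 := n)) (B(9 := (geo_total q n + M - u) mod M))" for x
    using V B by (simp add: I_def)
  have "awp (1 + (2 + (w * ((12 * w + 14) + 6) + 2))) sample_prog Q V B"
    unfolding sample_prog_def
  proof (rule awp_Seq, rule awp_bsub, simp, simp, simp, rule awp_Seq, rule awp_words, simp,
      rule awp_bsearch[where I = I and z = "geo_sample q n c u"], goal_cases)
    case 1
    then show ?case using I B V by simp
  next
    case (7 V' B' Q)
    then have mid: "V' 26 < n" using V by simp
    show ?case
      by (rule awp_sample_test[where n = n and c = c and q = q and u = u]; (rule 7(5))?)
        (use 7(3) mid n M u in \<open>simp_all add: I_def\<close>)
  next
    case 6
    then show ?case by (auto simp: I_def)
  next
    case (8 V' B')
    then show ?case by (intro Q)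
  qed (use V n u geo_sample_le[of c n u q] in \<open>simp_all add: I_def\<close>)
  then show ?thesis by (rule awp_le) (simp add: power2_eq_square algebra_simps)
qed

lemma awp_cdf_prog:
  assumes V: "V 18 = 1" "V 20 = n" "V 22 = z"
    and B: "B 1 = 1" "B 6 = q" "B 7 = q + 1" "B 9 = geo_total q n"
    and n: "z \<le> n" "2 * n < 2 ^ w" and M: "geo_total q n < M"
    and Q: "\<And>V' B'. B' 9 = geo_cdf q n 0 z \<Longrightarrow> Q V' B'"
  shows "awp (12 * w + 12) cdf_prog Q V B"
proof -
  have term_mod: "q ^ a * (q + 1) ^ (n - a) mod M = geo_term q n a" if "a \<le> n" for a
    using geo_term_le_total[OF that, of q] M by (simp add: geo_term_def)
  have lt: "awp (1 + ((12 * w + 8) + 1)) (Seq (Op Add 32 22 18) (Seq term_prog (bsub 9 9 8))) Q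
      (V(34 := x)) B" if z: "z < n" for x
  proof (rule awp_Seq, rule awp_words)
    have "(z + 1) mod 2 ^ w = z + 1" using n z by simp
    then have 1: "word_state (Op Add 32 22 18) (V(34 := x)) = V(34 := x, 32 := z + 1)"
      using V by simp
    show "awp ((12 * w + 8) + 1) (Seq term_prog (bsub 9 9 8)) Q (word_state (Op Add 32 22 18) (V(34 := x))) B"
      unfolding 1
    proof (rule awp_Seq, rule awp_term_prog, goal_cases)
      case (5 V1 B1)
      have a: "z + 1 \<le> n" using z by simp
      from 5 have b: "B1 8 = geo_term q n (z + 1)" "B1 9 = geo_total q n"
        using V B n term_mod[OF a] by simp_all
      have "(geo_total q n + M - geo_term q n (z + 1)) mod M = geo_cdf q n 0 z"
      proof -
        have "geo_total q n + M - geo_term q n (z + 1) = geo_cdf q n 0 z + M"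
          using z geo_term_le_total[OF a, of q] by (simp add: geo_cdf_def)
        moreover have "geo_cdf q n 0 z < M" using M geo_cdf_le_total[of 0 n q z] by simp
        ultimately show ?thesis by simp
      qed
      then show ?case
        by (intro awp_bsub Q) (use b in simp_all)
    qed (use V B n z in simp_all)
  qed simp_all
  have "awp (1 + ((1 + ((12 * w + 8) + 1)) + 1)) cdf_prog Q V B"
    unfolding cdf_prog_def
  proof (rule awp_Seq, rule awp_words, simp, rule awp_Cond, goal_cases)
    case 3
    then have "z = n" using n V by (simp split: if_splits)
    then have "Q (word_state (Op Less 34 22 20) V) B" using B by (intro Q) (simp add: geo_cdf_def)
    then show ?case by (intro awp_le[OF awp_Skip]) simp_all
  qed (use lt V in \<open>simp_all split: if_splits\<close>)
  then show ?thesis by (rule awp_le) simp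
qed

end

text \<open>
  Register \<open>b\<close> holds the address of the last input. As the memory is zero beyond it, this input is
  already a buffer of any sufficient length, and it becomes buffer 0. A third input that is zero
  occupies no words, so the word at its address is multiplied by its length. The loop determines the
  word size, and \<open>k\<close> is copied by multiplying it by one.
\<close>

definition init_prog :: "reg \<Rightarrow> com" where
  "init_prog b =
    Seq (Seq (Op Or 17 b b) (Seq (Load 20 0) (Seq (Const 18 1) (Seq (Op Add 10 3 18)
      (Seq (Op Mul 16 20 10) (Seq (Load 22 4) (Seq (Op Mul 22 22 5) (Seq (Const 10 1) (Const 11 0)))))))))
    (Seq (While 10 (Seq (Op Add 10 10 10) (Op Add 11 11 18)))
    (Seq (Op Mul 21 11 3) (Seq (addr 8 1) (Seq (Store 8 18) (Seq (addr 9 2) (Seq (BigMul 9 2 8 3)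
    (Seq (addr 8 3) (Seq (Const 10 2) (Store 8 10)))))))))"

lemma less_power_mono: "x < 2 ^ (w * a) \<Longrightarrow> a \<le> b \<Longrightarrow> x < 2 ^ (w * b)" for x :: nat
  by (erule less_le_trans) (intro power_increasing mult_left_mono, auto)

context bignum_machine
begin

text \<open>Doubling 1 modulo \<open>2 ^ w\<close> reaches 0 after exactly \<open>w\<close> rounds.
  The program has to find \<open>w\<close> at run time because one program must serve all admissible
  word sizes.\<close>

lemma exec_word_size:
  assumes "R 18 = 1" "R 10 = 2 ^ i mod 2 ^ w" "R 11 = i" "i \<le> w"
  shows "exec mulcost w (While 10 (Seq (Op Add 10 10 10) (Op Add 11 11 18))) (R, m)
    (1 + 3 * (w - i)) (R(10 := 0, 11 := w), m)"
  using assms(2-4) assms(1)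
proof (induction "w - i" arbitrary: i R)
  case 0
  then have eq: "R(10 := 0, 11 := w) = R" by auto
  have "exec mulcost w (While 10 (Seq (Op Add 10 10 10) (Op Add 11 11 18))) (R, m) 1 (R, m)"
    using 0 by (intro exec.WhileFalse) auto
  then show ?case using 0(1) by (simp only: eq mult_0_right add_0_right flip: 0(1))
next
  case (Suc j)
  define R' where "R' = R(10 := 2 ^ Suc i mod 2 ^ w, 11 := Suc i)"
  have "i < w" using Suc.hyps(2) by simp
  have ne: "fst (R, m) 10 \<noteq> 0" using Suc.prems \<open>i < w\<close> by simp
  have "Suc i < 2 ^ w" using \<open>i < w\<close> less_exp[of w] by linarith
  then have body: "exec mulcost w (Seq (Op Add 10 10 10) (Op Add 11 11 18)) (R, m) (1 + 1) (R', m)"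
  proof -
    have "(2 ^ i mod 2 ^ w + 2 ^ i mod 2 ^ w) mod 2 ^ w = (2 ^ Suc i mod 2 ^ w :: nat)"
      by (simp add: mod_add_eq mult_2)
    then have "R' = (R(10 := apply_op w Add (R 10) (R 10)))(11 := apply_op w Add
        ((R(10 := apply_op w Add (R 10) (R 10))) 11) ((R(10 := apply_op w Add (R 10) (R 10))) 18))"
      using Suc.prems \<open>Suc i < 2 ^ w\<close> by (simp add: R'_def)
    then show ?thesis using exec.Seq[OF exec.Op exec.Op] by metis
  qed
  have "exec mulcost w (While 10 (Seq (Op Add 10 10 10) (Op Add 11 11 18))) (R', m)
    (1 + 3 * (w - Suc i)) (R'(10 := 0, 11 := w), m)"
    by (rule Suc.hyps(1)) (use Suc.hyps(2) Suc.prems \<open>i < w\<close> in \<open>auto simp: R'_def\<close>)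
  from exec.WhileTrue[OF ne body this]
  have "exec mulcost w (While 10 (Seq (Op Add 10 10 10) (Op Add 11 11 18))) (R, m)
    (1 + (1 + 1) + (1 + 3 * (w - Suc i))) (R'(10 := 0, 11 := w), m)" .
  moreover have "R'(10 := 0, 11 := w) = R(10 := 0, 11 := w)" by (auto simp: R'_def)
  moreover have "1 + (1 + 1) + (1 + 3 * (w - Suc i)) = 1 + 3 * (w - i)" using \<open>i < w\<close> by simp
  ultimately show ?case by metis
qed

text \<open>Register \<open>b\<close> is 4 or 6 according to whether the last input is the third or
  the fourth; in the former case it serves both as the word \<open>c\<close> and as buffer
  0.\<close>

lemma exec_init_prog:
  assumes m: "\<And>a. m a < 2 ^ w" and b: "R b = base" "b \<in> {4, 6}"
    and n: "m (R 0) = n" "1 \<le> n"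
    and lk: "R 3 = lk" "L = n * (lk + 1)" "w * lk < 2 ^ w" "1 \<le> lk"
    and k: "R 2 + lk \<le> base" "\<And>i. i < lk \<Longrightarrow> m (R 2 + i) = digit w k i" "k < 2 ^ (w * lk)"
    and c: "m (R 4) * R 5 = c" "c < 2 ^ w"
    and x: "\<And>i. m (base + i) = digit w x i" "x < M"
  obtains t V B s where "exec mulcost w (init_prog b) (R, m) t s"
    "t \<le> 32 + 3 * w + mulcost (lk * w)" "rep V B s" "V 18 = 1" "V 20 = n" "V 21 = w * lk"
    "V 22 = c" "B 0 = x" "B 1 = 1" "B 2 = k" "B 3 = 2"
proof -
  have four: "4 \<le> (2::nat) ^ w" using power_increasing[OF word_size, of "2::nat"] by simp
  have lkL: "lk + 1 \<le> L" using mult_right_mono[OF n(2), of "lk + 1"] lk(2) by simp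
  have lk1: "lk + 1 < 2 ^ w" "L < 2 ^ w" "lk < 2 ^ w"
    using lkL L_bounds(2) by linarith+
  define R1 where "R1 = R(17 := base, 20 := n, 18 := 1, 10 := lk + 1, 16 := L, 22 := c, 10 := 1, 11 := 0)"
  let ?pre = "Seq (Op Or 17 b b) (Seq (Load 20 0) (Seq (Const 18 1) (Seq (Op Add 10 3 18)
      (Seq (Op Mul 16 20 10) (Seq (Load 22 4) (Seq (Op Mul 22 22 5) (Seq (Const 10 1) (Const 11 0))))))))"
  have "straight_state w ?pre (R, m) = (R1, m)"
    using b n lk c lk1 word_size by (auto simp: R1_def)
  moreover have "straight ?pre" "straight_time ?pre = 9" by simp_all
  ultimately have pre: "exec mulcost w ?pre (R, m) 9 (R1, m)"
    using exec_straight[of ?pre mulcost w "(R, m)"] by metis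
  define R2 where "R2 = R1(10 := 0, 11 := w)"
  have loop: "exec mulcost w (While 10 (Seq (Op Add 10 10 10) (Op Add 11 11 18))) (R1, m)
      (1 + 3 * (w - 0)) (R2, m)"
    unfolding R2_def by (rule exec_word_size) (use word_size in \<open>simp_all add: R1_def\<close>)
  have R2: "R2 16 = L" "R2 17 = base" "R2 18 = 1" "R2 20 = n" "R2 22 = c" "R2 2 = R 2" "R2 3 = lk"
    "R2 11 = w"
    using lk by (simp_all add: R2_def R1_def)
  define R3 where "R3 = R2(21 := w * lk)"
  have mul: "exec mulcost w (Op Mul 21 11 3) (R2, m) 1 (R3, m)"
    using exec.Op[of mulcost w Mul 21 11 3 R2 m] R2 lk by (simp add: R3_def)
  define R4 where "R4 = R3(8 := slot 1)"
  have a1: "exec mulcost w (addr 8 1) (R3, m) 4 (R4, m)"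
    unfolding R4_def by (rule exec_addr) (simp_all add: R3_def R2)
  define m1 where "m1 = m(slot 1 := 1)"
  have s1: "exec mulcost w (Store 8 18) (R4, m) 1 (R4, m1)"
    using exec.Store[of mulcost w 8 18 R4 m] by (simp add: R4_def R3_def R2 m1_def)
  define R5 where "R5 = R4(9 := slot 2)"
  have a2: "exec mulcost w (addr 9 2) (R4, m1) 4 (R5, m1)"
    unfolding R5_def by (rule exec_addr) (simp_all add: R4_def R3_def R2)
  have slots: "slot 0 = base" "slot 1 = base + 2 * L" "slot (Suc 0) = base + 2 * L" "slot 2 = base + 4 * L" "slot 3 = base + 6 * L"
    by (simp_all add: slot_def)
  \<comment> \<open>As \<open>x < M\<close>, the last input ends within \<open>L\<close> words and
    the memory behind it is zero. Hence a single store suffices to create the constants one and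
    two.\<close>
  have far: "m (base + i) = 0" if "L \<le> i" for i
  proof -
    have "x < 2 ^ (w * i)"
      using x(2) that unfolding M_def by (rule less_power_mono)
    then show ?thesis by (simp add: x digit_def)
  qed
  have far': "m a = 0" if "base + L \<le> a" for a
    using far[of "a - base"] that by simp
  define m2 where "m2 = (\<lambda>a. if slot 2 \<le> a \<and> a < slot 2 + 2 * lk then digit w k (a - slot 2) else m1 a)"
  have bk: "bignum w m1 (R 2) lk = k"
  proof -
    have "bignum w m1 (R 2) lk = k mod 2 ^ (w * lk)"
      by (rule bignum_digit) (use k slots in \<open>auto simp: m1_def\<close>)
    then show ?thesis using k(3) by simp
  qed
  have b1: "bignum w m1 (slot 1) l = 1" if "1 \<le> l" "l \<le> L" for l
  proof -
    have "bignum w m1 (Suc (slot 1)) (l - 1) = 0"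
      using far' by (simp add: bignum_def m1_def slots)
    then show ?thesis using bignum_Suc[of w m1 "slot 1" "l - 1"] that by (simp add: m1_def)
  qed
  have R5: "R5 9 = slot 2" "R5 2 = R 2" "R5 8 = slot 1" "R5 3 = lk"
    by (simp_all add: R5_def R4_def R3_def R2)
  \<comment> \<open>The factors have length \<open>lk\<close> instead of \<open>L\<close>, since the
    words behind \<open>k\<close> belong to the next inputs.\<close>
  have bm: "exec mulcost w (BigMul 9 2 8 3) (R5, m1) (1 + mulcost (lk * w)) (R5, m2)"
  proof -
    have "R 2 + lk \<le> 2 ^ w" "slot 1 + lk \<le> 2 ^ w" "slot 2 + 2 * lk \<le> 2 ^ w"
      using slot_bound[of 1] slot_bound[of 2] k(1) room lkL by auto
    moreover have "k = bignum w m1 (R5 2) (R5 3) * bignum w m1 (R5 8) (R5 3)"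
      using bk b1[of lk] lkL lk by (simp add: R5)
    ultimately show ?thesis
      using exec.BigMul[of R5 2 3 w 8 9 k m1 mulcost] by (simp add: R5 m2_def cong: if_cong)
  qed
  define R6 where "R6 = R5(8 := slot 3)"
  have a3: "exec mulcost w (addr 8 3) (R5, m2) 4 (R6, m2)"
    unfolding R6_def by (rule exec_addr) (simp_all add: R5_def R4_def R3_def R2)
  define R7 where "R7 = R6(10 := 2)"
  have c2: "exec mulcost w (Const 10 2) (R6, m2) 1 (R7, m2)"
    using exec.Const[of mulcost w 10 2 R6 m2] four by (simp add: R7_def)
  define m3 where "m3 = m2(slot 3 := 2)"
  have s3: "exec mulcost w (Store 8 10) (R7, m2) 1 (R7, m3)"
    using exec.Store[of mulcost w 8 10 R7 m2] by (simp add: R7_def R6_def m3_def)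
  have run: "exec mulcost w (init_prog b) (R, m)
    (9 + ((1 + 3 * (w - 0)) + (1 + (4 + (1 + (4 + ((1 + mulcost (lk * w)) + (4 + (1 + 1))))))))) (R7, m3)"
    unfolding init_prog_def
    by (rule exec.Seq[OF pre exec.Seq[OF loop exec.Seq[OF mul exec.Seq[OF a1 exec.Seq[OF s1
      exec.Seq[OF a2 exec.Seq[OF bm exec.Seq[OF a3 exec.Seq[OF c2 s3]]]]]]]]])
  have rep: "rep R7 (\<lambda>j. bignum w m3 (slot j) L) (R7, m3)"
    using m four digit_less
    by (auto simp: rep_def R7_def R6_def R5_def R4_def R3_def R2 m3_def m2_def m1_def)
  have B0: "bignum w m3 (slot 0) L = x"
  proof -
    have "bignum w m3 (slot 0) L = x mod 2 ^ (w * L)"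
      by (rule bignum_digit) (use x lkL in \<open>auto simp: m3_def m2_def m1_def slots\<close>)
    then show ?thesis using x(2) by (simp add: M_def)
  qed
  have B1: "bignum w m3 (slot 1) L = 1"
  proof -
    have "bignum w m3 (slot 1) L = bignum w m1 (slot 1) L"
      by (rule bignum_cong) (auto simp: m3_def m2_def slots)
    then show ?thesis using b1[of L] L_pos by simp
  qed
  have B2: "bignum w m3 (slot 2) L = k"
  proof -
    have "digit w k i = 0" if "lk \<le> i" for i
    proof -
      have "k < 2 ^ (w * i)"
        using k(3) that by (rule less_power_mono)
      then show ?thesis by (simp add: digit_def)
    qed
    then have "bignum w m3 (slot 2) L = k mod 2 ^ (w * L)"
      using far' by (intro bignum_digit) (auto simp: m3_def m2_def m1_def slots)
    moreover have "k < 2 ^ (w * L)"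
      using k(3) by (rule less_power_mono) (use lkL in simp)
    ultimately show ?thesis by simp
  qed
  have B3: "bignum w m3 (slot 3) L = 2"
  proof -
    have "bignum w m3 (Suc (slot 3)) (L - 1) = 0"
      using far' lkL by (simp add: bignum_def m3_def m2_def m1_def slots)
    then show ?thesis using bignum_Suc[of w m3 "slot 3" "L - 1"] L_pos by (simp add: m3_def)
  qed
  show thesis
    by (rule that[OF run _ rep])
      (use B0 B1 B2 B3 in \<open>simp_all add: R7_def R6_def R5_def R4_def R3_def R2\<close>)
qed

end

section \<open>Input layout and correctness of the complete programs\<close>

lemma num_words_less: "1 \<le> w \<Longrightarrow> x < 2 ^ (w * num_words w x)"
  unfolding num_words_def
proof (rule LeastI)
  assume "1 \<le> w"
  have "x < 2 ^ x" by simp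
  also have "(2::nat) ^ x \<le> 2 ^ (w * x)" using \<open>1 \<le> w\<close> by (intro power_increasing) auto
  finally show "x < 2 ^ (w * x)" .
qed

lemma num_words_le: "x < 2 ^ (w * l) \<Longrightarrow> num_words w x \<le> l"
  unfolding num_words_def by (rule Least_le)

lemma words_of_single:
  assumes "1 \<le> x" "x < 2 ^ w"
  shows "words_of w x = [x]"
proof -
  have "num_words w x \<le> 1" using assms by (intro num_words_le) simp
  moreover have "num_words w x \<noteq> 0"
  proof
    assume 0: "num_words w x = 0"
    have "1 \<le> w" using assms by (cases w) auto
    then show False using num_words_less[of w x] 0 assms by simp
  qed
  ultimately have "num_words w x = 1" by simp
  then show ?thesis using assms by (simp add: words_of_def digit_def)
qed

lemma words_of_nth:
  assumes "1 \<le> w"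
  shows "(if i < length (words_of w x) then words_of w x ! i else 0) = digit w x i"
proof (cases "i < num_words w x")
  case False
  have "x < 2 ^ (w * num_words w x)" by (rule num_words_less[OF assms])
  also have "(2::nat) ^ (w * num_words w x) \<le> 2 ^ (w * i)"
    using False by (intro power_increasing mult_left_mono) auto
  finally show ?thesis using False by (simp add: words_of_def digit_def)
qed (simp add: words_of_def)

lemma input_state_last:
  assumes "1 \<le> w"
  shows "snd (input_state w (xs @ [x])) (length (concat (map (words_of w) xs)) + i) = digit w x i"
  using words_of_nth[OF assms, of i x]
  by (simp add: input_state_def Let_def nth_append split: if_split_asm)

lemma input_state_second:
  assumes "words_of w n = [n]" "i < num_words w k"
  shows "snd (input_state w (n # k # xs)) (1 + i) = digit w k i"
proof -
  have l: "length (words_of w k) = num_words w k" by (simp add: words_of_def)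
  have "words_of w k ! i = digit w k i" using assms by (simp add: words_of_def)
  then show ?thesis using assms l by (simp add: input_state_def Let_def nth_append)
qed

lemma input_state_first: "words_of w n = [n] \<Longrightarrow> snd (input_state w (n # xs)) 0 = n"
  by (simp add: input_state_def Let_def)

lemma input_state_word: "snd (input_state w xs) a < 2 ^ w"
proof -
  let ?m = "concat (map (words_of w) xs)"
  have "?m ! a < 2 ^ w" if "a < length ?m"
  proof -
    have "?m ! a \<in> set ?m" using that by (rule nth_mem)
    then show ?thesis by (auto simp: words_of_def digit_less)
  qed
  then show ?thesis by (simp add: input_state_def Let_def)
qed

text \<open>This is the \<open>L\<close> that \<open>init_prog\<close> computes. The words of
  \<open>k\<close> cover \<open>clog k\<close> bits and the extra word covers three more once
  \<open>w \<ge> 3\<close>, so \<open>w * L\<close> is at least the exponent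
  \<open>(clog k + 3) * n\<close> of \<open>geo_total_less\<close>.\<close>

definition num_limbs :: "nat \<Rightarrow> nat \<Rightarrow> nat \<Rightarrow> nat" where
  "num_limbs w n k = n * (num_words w k + 1)"

text \<open>In order: the extra word of \<open>num_limbs\<close> holds three bits; the inputs before
  the buffers and the twelve buffers fit into memory; the binary searches for \<open>clog k\<close>
  and for the sample add their bounds without overflow.\<close>

definition fits :: "nat \<Rightarrow> nat \<Rightarrow> nat \<Rightarrow> bool" where
  "fits w n k \<longleftrightarrow> 3 \<le> w \<and> num_words w k + 3 + 24 * num_limbs w n k < 2 ^ w \<and>
     2 * (w * num_words w k) < 2 ^ w \<and> 2 * n < 2 ^ w"

text \<open>The factor \<open>w ^ 2\<close> comes from about \<open>w\<close> search rounds with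
  powers of about \<open>w\<close> multiplications each. The cost of copying \<open>k\<close> is a
  separate summand because \<open>mulcost\<close> is not assumed to be monotone.\<close>

definition time_bound :: "(nat \<Rightarrow> nat) \<Rightarrow> nat \<Rightarrow> nat \<Rightarrow> nat \<Rightarrow> nat" where
  "time_bound mulcost w n k = 100 * w ^ 2 *
     (60 + 13 * num_limbs w n k + mulcost (num_limbs w n k * w)) + mulcost (num_words w k * w)"

text \<open>The result is a single word and is stored at the start of buffer 0, over the input
  \<open>u\<close>.\<close>

definition sample_com :: com where
  "sample_com = Seq (init_prog 6) (Seq (Seq total_prog sample_prog)
     (Seq (Op Or 0 17 17) (Seq (Store 0 24) (Const 1 1))))"

definition cdf_com :: com where
  "cdf_com = Seq (init_prog 4) (Seq (Seq total_prog cdf_prog) (Seq (addr 0 9) (Op Or 1 16 16)))"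

lemma geo_total_fits:
  assumes "3 \<le> w" "1 \<le> n"
  shows "geo_total (geo_base k) n < 2 ^ (w * num_limbs w n k)"
proof -
  have "clog k \<le> w * num_words w k"
    using num_words_less[of w k] assms by (simp add: clog_le_iff less_imp_le)
  then have "clog k + 3 \<le> w * (num_words w k + 1)" using assms by simp
  then have "(clog k + 3) * n \<le> w * (num_words w k + 1) * n" by (rule mult_right_mono) simp
  then have "(clog k + 3) * n \<le> w * num_limbs w n k" by (simp only: num_limbs_def mult_ac)
  then have "(2::nat) ^ ((clog k + 3) * n) \<le> 2 ^ (w * num_limbs w n k)"
    by (rule power_increasing) simp
  then show ?thesis using geo_total_less[OF assms(2), of k] by (rule less_le_trans[rotated])
qed

lemma length_words_of: "length (words_of w x) = num_words w x"
  by (simp add: words_of_def)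

lemma num_words_pos: "1 \<le> x \<Longrightarrow> 1 \<le> w \<Longrightarrow> 1 \<le> num_words w x"
  using num_words_less[of w x] by (cases "num_words w x") auto

lemma input_word:
  assumes "1 \<le> w" "c < 2 ^ w"
  shows "digit w c 0 * num_words w c = c" "num_words w c \<le> 1"
proof -
  show "num_words w c \<le> 1" using assms by (intro num_words_le) simp
  show "digit w c 0 * num_words w c = c"
  proof (cases "c = 0")
    case False
    then have "words_of w c = [c]" using assms by (intro words_of_single) auto
    then have "num_words w c = 1" by (metis length_words_of length_Cons list.size(3) One_nat_def)
    then show ?thesis using assms by (simp add: digit_def)
  qed (simp add: digit_def)
qed

lemma exec_sample_com:
  assumes fits: "fits w n k" and n: "1 \<le> n" and k: "1 \<le> k" and c: "c \<le> n"
    and u: "u \<le> geo_total (geo_base k) n"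
  shows "\<exists>t s. exec mulcost w sample_com (input_state w [n, k, c, u]) t s \<and>
    t \<le> time_bound mulcost w n k \<and> result_of w s = geo_sample (geo_base k) n c u"
proof -
  define lk where "lk = num_words w k"
  define L where "L = num_limbs w n k"
  define base where "base = 1 + lk + num_words w c"
  have w: "3 \<le> w" "lk + 3 + 24 * L < 2 ^ w" "2 * (w * lk) < 2 ^ w" "2 * n < 2 ^ w"
    using fits by (simp_all add: fits_def lk_def L_def)
  have lk: "1 \<le> lk" using num_words_pos[OF k, of w] w by (simp add: lk_def)
  have L: "L = n * (lk + 1)" by (simp add: L_def lk_def num_limbs_def)
  have "lk \<le> L" using mult_right_mono[OF n, of "lk + 1"] by (simp add: L)
  then have hL: "w * lk \<le> w * L" by simp
  have cw: "num_words w c \<le> 1" "digit w c 0 * num_words w c = c" "c < 2 ^ w"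
    using input_word[of w c] c w by simp_all
  interpret bignum_machine mulcost w L base
    by unfold_locales (use w n cw lk in \<open>auto simp: base_def L\<close>)
  obtain R m where s: "input_state w [n, k, c, u] = (R, m)" by force
  have R: "R = fst (input_state w [n, k, c, u])" and m: "m = snd (input_state w [n, k, c, u])"
    using s by simp_all
  have wn: "words_of w n = [n]" using n w by (intro words_of_single) auto
  have R0: "R 0 = 0" "R 2 = 1" "R 3 = lk" "R 4 = 1 + lk" "R 5 = num_words w c" "R 6 = base"
    unfolding R input_state_def Let_def by (simp_all add: wn length_words_of lk_def base_def)
  have last: "m (base + i) = digit w u i" for i
    using input_state_last[of w "[n, k, c]" u i] w wn
    by (simp add: m base_def length_words_of lk_def)
  have kd: "m (1 + i) = digit w k i" if "i < lk" for i
    unfolding m by (rule input_state_second[OF wn]) (use that in \<open>simp add: lk_def\<close>)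
  have md: "m 0 = n" unfolding m by (rule input_state_first[OF wn])
  have mc: "m (1 + lk) * num_words w c = c"
  proof (cases "num_words w c = 0")
    case False
    have "m (1 + lk) = words_of w c ! 0"
      using False by (simp add: m input_state_def Let_def wn nth_append length_words_of lk_def)
    then show ?thesis using cw False by (simp add: words_of_def)
  qed (use cw in simp)
  have total: "geo_total (geo_base k) n < M"
    using geo_total_fits[OF w(1) n, of k] by (simp add: M_def flip: L_def)
  have "k < 2 ^ (w * lk)" using num_words_less[of w k] w by (simp add: lk_def)
  have mless: "m a < 2 ^ w" for a unfolding m by (rule input_state_word)
  obtain t1 V B s1 where 1: "exec mulcost w (init_prog 6) (R, m) t1 s1"
    "t1 \<le> 32 + 3 * w + mulcost (lk * w)" "rep V B s1" "V 18 = 1" "V 20 = n" "V 21 = w * lk"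
    "V 22 = c" "B 0 = u" "B 1 = 1" "B 2 = k" "B 3 = 2"
    by (rule exec_init_prog[of m R 6 n lk k c u])
      (use R0 md mc kd last mless cw w n lk L total u \<open>k < 2 ^ (w * lk)\<close> in \<open>auto simp: base_def\<close>)
  have "awp ((6 * w ^ 2 + 42 * w + 40) + (12 * w ^ 2 + 20 * w + 5)) (Seq total_prog sample_prog)
    (\<lambda>V B. V 24 = geo_sample (geo_base k) n c u) V B"
  proof (rule awp_Seq, rule awp_total_prog[where k = k and h = "w * lk" and n = n], goal_cases)
    case (13 V' B')
    then show ?case
      by (intro awp_sample_prog[where n = n and c = c and q = "geo_base k" and u = u])
        (use 1 c w total u in simp_all)
  qed (use 1 n w hL total \<open>k < 2 ^ (w * lk)\<close> in auto)
  then obtain t2 s2 V2 B2 where 2: "exec mulcost w (Seq total_prog sample_prog) s1 t2 s2"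
    "t2 \<le> ((6 * w ^ 2 + 42 * w + 40) + (12 * w ^ 2 + 20 * w + 5)) * K" "rep V2 B2 s2"
    "V2 24 = geo_sample (geo_base k) n c u"
    using 1(3) unfolding awp_def by blast
  let ?out = "Seq (Op Or 0 17 17) (Seq (Store 0 24) (Const 1 1))"
  have 3: "exec mulcost w ?out s2 3 (straight_state w ?out s2)"
    using exec_straight[of ?out mulcost w s2] by (simp add: numeral_3_eq_3)
  have "result_of w (straight_state w ?out s2) = geo_sample (geo_base k) n c u"
    using 2(3,4) w by (cases s2) (auto simp: result_of_def bignum_def rep_def)
  moreover have "exec mulcost w sample_com (input_state w [n, k, c, u]) (t1 + (t2 + 3))
      (straight_state w ?out s2)"
    unfolding sample_com_def s by (intro exec.Seq[OF 1(1) exec.Seq[OF 2(1) 3]])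
  moreover have "t1 + (t2 + 3) \<le> time_bound mulcost w n k"
  proof -
    have "t1 + (t2 + 3) \<le> (35 + 3 * w) + (18 * w ^ 2 + 62 * w + 45) * K + mulcost (lk * w)"
      using 1(2) 2(2) by (simp add: algebra_simps)
    also have "\<dots> \<le> (35 + 3 * w) * K + (18 * w ^ 2 + 62 * w + 45) * K + mulcost (lk * w)"
      using K_pos by simp
    also have "\<dots> = (18 * w ^ 2 + 65 * w + 80) * K + mulcost (lk * w)" by (simp add: algebra_simps)
    also have "18 * w ^ 2 + 65 * w + 80 \<le> 100 * w ^ 2"
    proof -
      have "3 * w \<le> w ^ 2" using w(1) by (simp add: power2_eq_square)
      then show ?thesis using w(1) by linarith
    qed
    finally show ?thesis by (simp add: time_bound_def K_def flip: L_def lk_def)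
  qed
  ultimately show ?thesis by blast
qed

lemma exec_cdf_com:
  assumes fits: "fits w n k" and n: "1 \<le> n" and k: "1 \<le> k" and z: "z \<le> n"
  shows "\<exists>t s. exec mulcost w cdf_com (input_state w [n, k, z]) t s \<and>
    t \<le> time_bound mulcost w n k \<and> result_of w s = geo_cdf (geo_base k) n 0 z"
proof -
  define lk where "lk = num_words w k"
  define L where "L = num_limbs w n k"
  define base where "base = 1 + lk"
  have w: "3 \<le> w" "lk + 3 + 24 * L < 2 ^ w" "2 * (w * lk) < 2 ^ w" "2 * n < 2 ^ w"
    using fits by (simp_all add: fits_def lk_def L_def)
  have lk: "1 \<le> lk" using num_words_pos[OF k, of w] w by (simp add: lk_def)
  have L: "L = n * (lk + 1)" by (simp add: L_def lk_def num_limbs_def)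
  have "lk \<le> L" using mult_right_mono[OF n, of "lk + 1"] by (simp add: L)
  then have hL: "w * lk \<le> w * L" by simp
  have zw: "digit w z 0 * num_words w z = z" "z < 2 ^ w"
    using input_word[of w z] z w by simp_all
  interpret bignum_machine mulcost w L base
    by unfold_locales (use w n lk in \<open>auto simp: base_def L\<close>)
  obtain R m where s: "input_state w [n, k, z] = (R, m)" by force
  have R: "R = fst (input_state w [n, k, z])" and m: "m = snd (input_state w [n, k, z])"
    using s by simp_all
  have wn: "words_of w n = [n]" using n w by (intro words_of_single) auto
  have R0: "R 0 = 0" "R 2 = 1" "R 3 = lk" "R 4 = base" "R 5 = num_words w z"
    unfolding R input_state_def Let_def by (simp_all add: wn length_words_of lk_def base_def)
  have last: "m (base + i) = digit w z i" for i
    using input_state_last[of w "[n, k]" z i] w wn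
    by (simp add: m base_def length_words_of lk_def)
  have kd: "m (1 + i) = digit w k i" if "i < lk" for i
    unfolding m by (rule input_state_second[OF wn]) (use that in \<open>simp add: lk_def\<close>)
  have md: "m 0 = n" unfolding m by (rule input_state_first[OF wn])
  have mz: "m base * num_words w z = z" using last[of 0] zw by simp
  have total: "geo_total (geo_base k) n < M"
    using geo_total_fits[OF w(1) n, of k] by (simp add: M_def flip: L_def)
  have "z < M"
    using less_power_mono[of z w 1 L] L_pos zw(2) by (simp add: M_def)
  have "k < 2 ^ (w * lk)" using num_words_less[of w k] w by (simp add: lk_def)
  have mless: "m a < 2 ^ w" for a unfolding m by (rule input_state_word)
  obtain t1 V B s1 where 1: "exec mulcost w (init_prog 4) (R, m) t1 s1"
    "t1 \<le> 32 + 3 * w + mulcost (lk * w)" "rep V B s1" "V 18 = 1" "V 20 = n" "V 21 = w * lk"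
    "V 22 = z" "B 0 = z" "B 1 = 1" "B 2 = k" "B 3 = 2"
    by (rule exec_init_prog[of m R 4 n lk k z z])
      (use R0 md mz kd last mless zw w n lk L \<open>z < M\<close> \<open>k < 2 ^ (w * lk)\<close> in \<open>auto simp: base_def\<close>)
  have "awp ((6 * w ^ 2 + 42 * w + 40) + (12 * w + 12)) (Seq total_prog cdf_prog)
    (\<lambda>V B. B 9 = geo_cdf (geo_base k) n 0 z) V B"
  proof (rule awp_Seq, rule awp_total_prog[where k = k and h = "w * lk" and n = n], goal_cases)
    case (13 V' B')
    then show ?case
      by (intro awp_cdf_prog[where n = n and z = z and q = "geo_base k"])
        (use 1 z w total in simp_all)
  qed (use 1 n w hL total \<open>k < 2 ^ (w * lk)\<close> in auto)
  then obtain t2 s2 V2 B2 where 2: "exec mulcost w (Seq total_prog cdf_prog) s1 t2 s2"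
    "t2 \<le> ((6 * w ^ 2 + 42 * w + 40) + (12 * w + 12)) * K" "rep V2 B2 s2"
    "B2 9 = geo_cdf (geo_base k) n 0 z"
    using 1(3) unfolding awp_def by blast
  obtain R2 m2 where s2: "s2 = (R2, m2)" by force
  have R2: "R2 16 = L" "R2 17 = base" "bignum w m2 (slot 9) L = B2 9"
    using 2(3) by (simp_all add: rep_def s2)
  let ?s = "((R2(0 := slot 9))(1 := L), m2)"
  have 3: "exec mulcost w (Seq (addr 0 9) (Op Or 1 16 16)) s2 (4 + 1) ?s"
    using exec.Seq[OF exec_addr[of R2 0 9 m2] exec.Op[of mulcost w Or 1 16 16]] R2
    by (simp add: s2)
  have "result_of w ?s = geo_cdf (geo_base k) n 0 z"
    using R2 2(4) by (simp add: result_of_def)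
  moreover have "exec mulcost w cdf_com (input_state w [n, k, z]) (t1 + (t2 + (4 + 1))) ?s"
    unfolding cdf_com_def s by (intro exec.Seq[OF 1(1) exec.Seq[OF 2(1) 3]])
  moreover have "t1 + (t2 + (4 + 1)) \<le> time_bound mulcost w n k"
  proof -
    have "t1 + (t2 + (4 + 1)) \<le> (37 + 3 * w) + (6 * w ^ 2 + 54 * w + 52) * K + mulcost (lk * w)"
      using 1(2) 2(2) by (simp add: algebra_simps)
    also have "\<dots> \<le> (37 + 3 * w) * K + (6 * w ^ 2 + 54 * w + 52) * K + mulcost (lk * w)"
      using K_pos by simp
    also have "\<dots> = (6 * w ^ 2 + 57 * w + 89) * K + mulcost (lk * w)" by (simp add: algebra_simps)
    also have "6 * w ^ 2 + 57 * w + 89 \<le> 100 * w ^ 2"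
    proof -
      have "3 * w \<le> w ^ 2" using w(1) by (simp add: power2_eq_square)
      then show ?thesis using w(1) by linarith
    qed
    finally show ?thesis by (simp add: time_bound_def K_def flip: L_def lk_def)
  qed
  ultimately show ?thesis by blast
qed


section \<open>Running time\<close>

definition size_param :: "nat \<Rightarrow> nat \<Rightarrow> real" where
  "size_param n k = real n * max 1 (log 2 (real k))"

lemma size_param_bounds:
  assumes "1 \<le> n" "1 \<le> k"
  shows "real n \<le> size_param n k" "1 \<le> size_param n k" "log 2 k \<le> size_param n k"
    "real n * log 2 k \<le> size_param n k"
proof -
  have l: "0 \<le> log 2 k" using assms by simp
  have n: "1 \<le> real n" using assms by simp
  have "real n * 1 \<le> real n * max 1 (log 2 (real k))" by (rule mult_left_mono) auto
  then show 1: "real n \<le> size_param n k" by (simp add: size_param_def)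
  then show "1 \<le> size_param n k" using n by simp
  show 2: "real n * log 2 k \<le> size_param n k"
    unfolding size_param_def by (rule mult_left_mono) auto
  have "1 * log 2 k \<le> real n * log 2 k" using n l by (rule mult_right_mono)
  then show "log 2 k \<le> size_param n k" using 2 by simp
qed

text \<open>The number of words is minimal, so one word fewer would not hold \<open>k\<close>;
  rounding up to whole words costs at most \<open>w\<close> bits.\<close>

lemma num_words_log:
  assumes "1 \<le> k" "1 \<le> w"
  shows "real (w * num_words w k) \<le> log 2 k + w"
proof -
  obtain l where l: "num_words w k = Suc l" using num_words_pos[OF assms] by (cases "num_words w k") auto
  have "\<not> k < 2 ^ (w * l)" using num_words_le[of k w l] l by auto
  then have "2 ^ (w * l) \<le> k" by simp
  then have "real (w * l) \<le> log 2 k" by (rule le_log2_of_power)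
  then show ?thesis using l by (simp add: algebra_simps)
qed

text \<open>The hypothesis says \<open>X ^ 10 \<le> 2 ^ w\<close> for
  \<open>X = 2 + size_param n k\<close>, while \<open>num_limbs\<close> is at most
  \<open>X ^ 2\<close>; so the memory requirement is met with room to spare. The factor 10 also
  gives \<open>w \<ge> 10\<close>, from which \<open>4 * w < 2 ^ w\<close>.\<close>

lemma fits_large_word:
  assumes n: "1 \<le> n" and k: "1 \<le> k" and w: "10 * log 2 (2 + size_param n k) \<le> real w"
  shows "fits w n k"
proof -
  define X where "X = 2 + size_param n k"
  note N = size_param_bounds[OF n k]
  have X: "3 \<le> X" using N by (simp add: X_def)
  have X10: "X ^ 10 \<le> 2 ^ w"
  proof -
    have "X ^ 10 = 2 powr (log 2 X * 10)"
      using X by (simp add: powr_powr[symmetric] powr_numeral)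
    also have "\<dots> \<le> 2 powr real w" using w by (intro powr_mono) (auto simp: X_def mult.commute)
    finally show ?thesis by (simp add: powr_realpow)
  qed
  have X2: "3 * X \<le> X ^ 2" using X by (simp add: power2_eq_square)
  have X3: "9 * X \<le> X ^ 3"
  proof -
    have "3 * (3 * X) \<le> X * X ^ 2" using X X2 by (intro mult_mono) auto
    then show ?thesis by (simp add: power3_eq_cube power2_eq_square mult.assoc)
  qed
  have X5: "27 * X ^ 2 \<le> X ^ 5"
  proof -
    have "3 ^ 3 \<le> X ^ 3" using X by (intro power_mono) auto
    then have "3 ^ 3 * X ^ 2 \<le> X ^ 3 * X ^ 2" by (intro mult_right_mono) auto
    then show ?thesis by (simp flip: power_add)
  qed
  have up: "X ^ 3 \<le> 2 ^ w" "X ^ 5 \<le> 2 ^ w"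
    by (rule order_trans[OF power_increasing X10]; use X in simp)+
  have w10: "10 \<le> w"
  proof -
    have "1 \<le> log 2 X" using X by simp
    then show ?thesis using w unfolding X_def[symmetric] by linarith
  qed
  have lk: "real (num_words w k) \<le> X - 1"
  proof -
    have "real w * real (num_words w k) \<le> log 2 k + w"
      using num_words_log[OF k, of w] w10 by simp
    also have "\<dots> \<le> real w * (X - 2) + real w"
    proof -
      have "log 2 k \<le> 1 * (X - 2)" using N by (simp add: X_def)
      also have "\<dots> \<le> real w * (X - 2)" using w10 X by (intro mult_right_mono) auto
      finally show ?thesis by simp
    qed
    also have "\<dots> = real w * (X - 1)" by (simp add: algebra_simps)
    finally show ?thesis using w10 by simp
  qed
  have L: "real (num_limbs w n k) \<le> X ^ 2"
  proof -
    have "real n * (real (num_words w k) + 1) \<le> X * X"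
      using N lk X by (intro mult_mono) (auto simp: X_def)
    then show ?thesis by (simp add: num_limbs_def power2_eq_square distrib_left)
  qed
  have "real (num_words w k + 3 + 24 * num_limbs w n k) < 2 ^ w"
    using lk L X X2 X5 up by simp
  then have 1: "num_words w k + 3 + 24 * num_limbs w n k < 2 ^ w"
    by (metis of_nat_less_iff of_nat_numeral of_nat_power)
  have w4: "4 * w < 2 ^ w"
  proof -
    have "4 * v < 2 ^ v" if "10 \<le> v" for v :: nat
      using that by (induction v rule: dec_induct) auto
    then show ?thesis using w10 .
  qed
  have "real (2 * (w * num_words w k)) \<le> 2 * X + 2 * w"
    using num_words_log[OF k, of w] w10 N by (simp add: X_def)
  also have "\<dots> < 2 ^ w"
  proof -
    have "4 * real w < 2 ^ w" using w4 by (metis of_nat_less_iff of_nat_mult of_nat_numeral of_nat_power)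
    moreover have "4 * X \<le> 2 ^ w" using X3 up X by linarith
    ultimately show ?thesis by linarith
  qed
  finally have 2: "2 * (w * num_words w k) < 2 ^ w"
    by (metis of_nat_less_iff of_nat_numeral of_nat_power)
  have "real (2 * n) < 2 ^ w" using X3 up X N by (simp add: X_def)
  then have 3: "2 * n < 2 ^ w" by (metis of_nat_less_iff of_nat_numeral of_nat_power)
  show ?thesis using 1 2 3 w10 by (simp add: fits_def)
qed

text \<open>With \<open>N = size_param n k\<close> and \<open>Lam\<close> of order
  \<open>log N\<close>, the word size is \<open>O(Lam)\<close> and a buffer has at most
  \<open>3 * w * N\<close> bits. A long operation therefore costs
  \<open>O(N * Lam ^ (j + 1))\<close>, and the factor \<open>w ^ 2\<close> raises the exponent to
  \<open>j + 3\<close>.\<close>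

lemma time_bound_soft_O:
  assumes "soft_O_on UNIV (\<lambda>x. real (mulcost x)) real"
  obtains C j where "\<And>n k w. 1 \<le> n \<Longrightarrow> 1 \<le> k \<Longrightarrow> 1 \<le> w \<Longrightarrow>
    real w \<le> \<kappa> * log 2 (2 + size_param n k) \<Longrightarrow>
    real (time_bound mulcost w n k) \<le> C * size_param n k * (1 + log 2 (1 + size_param n k)) ^ j"
proof -
  obtain C0 j where C0: "\<And>x. real (mulcost x) \<le> C0 * real x * (1 + log 2 (1 + real x)) ^ j"
    using assms by (auto simp: soft_O_on_def)
  define C1 where "C1 = max 0 C0"
  have C1: "real (mulcost x) \<le> C1 * real x * (1 + log 2 (1 + real x)) ^ j" "0 \<le> C1" for x
  proof -
    have "C0 * (real x * (1 + log 2 (1 + real x)) ^ j) \<le> C1 * (real x * (1 + log 2 (1 + real x)) ^ j)"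
      unfolding C1_def by (intro mult_right_mono) auto
    then show "real (mulcost x) \<le> C1 * real x * (1 + log 2 (1 + real x)) ^ j"
      using C0[of x] by (simp add: mult.assoc)
  qed (simp add: C1_def)
  define A where "A = max 1 \<kappa>"
  define D where "D = C1 * (3 * A) * (3 + A) ^ j"
  define C where "C = 100 * A ^ 2 * (60 + 39 * A + D) + D"
  have "real (time_bound mulcost w n k) \<le> C * size_param n k * (1 + log 2 (1 + size_param n k)) ^ (j + 3)"
    if n: "1 \<le> n" and k: "1 \<le> k" and w1: "1 \<le> w"
      and w: "real w \<le> \<kappa> * log 2 (2 + size_param n k)" for n k w
  proof -
    define N where "N = size_param n k"
    define Lam where "Lam = 1 + log 2 (1 + N)"
    note Nb = size_param_bounds[OF n k, folded N_def]
    have Lam: "1 \<le> Lam" using Nb by (simp add: Lam_def)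
    have "log 2 (2 + N) \<le> log 2 (2 * (1 + N))" using Nb by simp
    also have "\<dots> = log 2 2 + log 2 (1 + N)" by (subst log_mult) (use Nb in auto)
    also have "\<dots> = Lam" by (simp add: Lam_def)
    finally have l2: "log 2 (2 + N) \<le> Lam" .
    have A: "1 \<le> A" by (simp add: A_def)
    have wA: "real w \<le> A * Lam"
    proof -
      have "\<kappa> * log 2 (2 + N) \<le> A * log 2 (2 + N)"
        using Nb by (intro mult_right_mono) (auto simp: A_def)
      also have "\<dots> \<le> A * Lam" using l2 A by (intro mult_left_mono) auto
      finally show ?thesis using w by (simp add: N_def)
    qed
    have wN: "3 * real w * N \<le> 3 * (A * Lam) * N"
      using wA Nb by (intro mult_right_mono mult_left_mono) auto
    have Lw: "real (num_limbs w n k * w) \<le> 3 * real w * N"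
    proof -
      have "real (num_limbs w n k * w) = real n * real (w * num_words w k) + real n * real w"
        by (simp add: num_limbs_def algebra_simps)
      also have "\<dots> \<le> real n * (log 2 k + w) + real n * real w"
        using num_words_log[OF k w1] by (intro add_right_mono mult_left_mono) auto
      also have "\<dots> = real n * log 2 k + 2 * (real n * real w)" by (simp add: algebra_simps)
      also have "\<dots> \<le> real w * N + 2 * (N * real w)"
      proof -
        have "1 * N \<le> real w * N" using w1 Nb by (intro mult_right_mono) auto
        then have "real n * log 2 k \<le> real w * N" using Nb by linarith
        moreover have "real n * real w \<le> N * real w" using Nb by (intro mult_right_mono) auto
        ultimately show ?thesis by linarith
      qed
      finally show ?thesis by (simp add: algebra_simps)
    qed
    have lkw: "num_words w k * w \<le> num_limbs w n k * w"
    proof -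
      have "1 * num_words w k \<le> n * (num_words w k + 1)" using n by (intro mult_mono) auto
      then show ?thesis by (simp add: num_limbs_def)
    qed
    \<comment> \<open>Stated for every \<open>x\<close> in the range, so that it covers both the
      buffer length and the length of \<open>k\<close>. The crude \<open>log w \<le> w\<close>
      suffices because \<open>w\<close> is itself at most \<open>A * Lam\<close>.\<close>
    have mc: "real (mulcost x) \<le> D * N * Lam ^ (j + 1)" if x: "real x \<le> 3 * real w * N" for x
    proof -
      have "1 + real x \<le> 4 * (real w * (1 + N))"
        using x w1 Nb by (simp add: algebra_simps)
      then have "log 2 (1 + real x) \<le> log 2 (4 * (real w * (1 + N)))" by simp
      also have "\<dots> = 2 + (log 2 (real w) + log 2 (1 + N))"
        using w1 Nb log_pow_cancel[of 2 2] by (simp add: log_mult)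
      also have "\<dots> \<le> 1 + (real w + Lam)"
      proof -
        have "log 2 (real w) \<le> real w"
          using w1 log2_of_power_le[of w w] by (simp add: less_imp_le)
        then show ?thesis by (simp add: Lam_def)
      qed
      also have "\<dots> \<le> 1 + (A * Lam + Lam)" using wA by simp
      finally have "1 + log 2 (1 + real x) \<le> (3 + A) * Lam"
        using Lam by (simp add: algebra_simps)
      then have "(1 + log 2 (1 + real x)) ^ j \<le> ((3 + A) * Lam) ^ j"
        by (intro power_mono) auto
      moreover have "real x \<le> 3 * (A * Lam) * N"
        using x wN by linarith
      ultimately have "C1 * real x * (1 + log 2 (1 + real x)) ^ j \<le>
          C1 * (3 * (A * Lam) * N) * ((3 + A) * Lam) ^ j"
        using C1(2) A Lam Nb by (intro mult_mono) auto
      also have "\<dots> = D * N * Lam ^ (j + 1)"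
        by (simp add: D_def power_mult_distrib mult_ac)
      finally show ?thesis using C1(1)[of x] by linarith
    qed
    have D0: "0 \<le> D" using C1 A by (simp add: D_def)
    have Lamj: "Lam \<le> Lam ^ (j + 1)" "Lam ^ (j + 1) \<le> Lam ^ (j + 3)" "1 \<le> Lam ^ (j + 1)"
      using Lam power_increasing[of 1 "j + 1" Lam] power_increasing[of "j + 1" "j + 3" Lam]
        one_le_power[of Lam "j + 1"]
      by simp_all
    have inner: "real (60 + 13 * num_limbs w n k + mulcost (num_limbs w n k * w)) \<le>
        (60 + 39 * A + D) * N * Lam ^ (j + 1)"
    proof -
      have "num_limbs w n k * 1 \<le> num_limbs w n k * w" using w1 by (intro mult_left_mono) auto
      then have "real (num_limbs w n k) \<le> real (num_limbs w n k * w)" by (simp only: of_nat_mono mult_1_right)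
      also have "\<dots> \<le> 3 * (A * Lam) * N" using Lw wN by linarith
      also have "\<dots> = 3 * A * N * Lam" by simp
      also have "\<dots> \<le> 3 * A * N * Lam ^ (j + 1)" using Lamj A Nb by (intro mult_left_mono) auto
      finally have 1: "real (num_limbs w n k) \<le> 3 * A * N * Lam ^ (j + 1)" .
      have "1 * 1 \<le> N * Lam ^ (j + 1)" using Nb Lamj by (intro mult_mono) auto
      then show ?thesis using 1 mc[OF Lw] by (simp add: algebra_simps)
    qed
    have "real (w ^ 2) \<le> (A * Lam) ^ 2" unfolding of_nat_power by (rule power_mono[OF wA]) simp
    then have "100 * real (w ^ 2) * real (60 + 13 * num_limbs w n k + mulcost (num_limbs w n k * w)) \<le>
        100 * (A * Lam) ^ 2 * ((60 + 39 * A + D) * N * Lam ^ (j + 1))"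
      using inner by (intro mult_mono) auto
    also have "\<dots> = 100 * A ^ 2 * (60 + 39 * A + D) * N * Lam ^ (j + 3)"
      by (simp add: power_mult_distrib power_add power2_eq_square power3_eq_cube mult_ac)
    finally have 1: "100 * real (w ^ 2) * real (60 + 13 * num_limbs w n k + mulcost (num_limbs w n k * w)) \<le>
        100 * A ^ 2 * (60 + 39 * A + D) * N * Lam ^ (j + 3)" .
    have "real (mulcost (num_words w k * w)) \<le> D * N * Lam ^ (j + 1)"
      by (rule mc) (use Lw lkw in \<open>linarith\<close>)
    also have "\<dots> \<le> D * N * Lam ^ (j + 3)"
      using Lamj D0 Nb by (intro mult_left_mono) auto
    finally have 2: "real (mulcost (num_words w k * w)) \<le> D * N * Lam ^ (j + 3)" .
    have "real (time_bound mulcost w n k) = 100 * real (w ^ 2) *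
        real (60 + 13 * num_limbs w n k + mulcost (num_limbs w n k * w)) +
        real (mulcost (num_words w k * w))"
      by (simp add: time_bound_def)
    also have "\<dots> \<le> C * N * Lam ^ (j + 3)"
      using 1 2 by (simp add: C_def algebra_simps)
    finally show ?thesis by (simp add: N_def Lam_def)
  qed
  then show thesis by (rule that)
qed

lemma computable_in_soft_O_time_bound:
  assumes mulcost: "soft_O_on UNIV (\<lambda>x. real (mulcost x)) real"
    and n: "\<And>i. i \<in> I \<Longrightarrow> 1 \<le> n i" and k: "\<And>i. i \<in> I \<Longrightarrow> 1 \<le> k i"
    and g: "\<And>i. i \<in> I \<Longrightarrow> g i = size_param (n i) (k i)"
    and P: "\<And>i w. i \<in> I \<Longrightarrow> fits w (n i) (k i) \<Longrightarrow>
      \<exists>t s. exec mulcost w P (input_state w (inp i)) t s \<and> t \<le> time_bound mulcost w (n i) (k i) \<and>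
        real (result_of w s) = f i"
  shows "computable_in_soft_O mulcost I g g inp f"
  unfolding computable_in_soft_O_def
proof (rule exI[of _ P], rule exI[of _ 10], rule allI)
  fix \<kappa>' :: real
  obtain C j where C: "\<And>n k w. 1 \<le> n \<Longrightarrow> 1 \<le> k \<Longrightarrow> 1 \<le> w \<Longrightarrow>
      real w \<le> \<kappa>' * log 2 (2 + size_param n k) \<Longrightarrow>
      real (time_bound mulcost w n k) \<le> C * size_param n k * (1 + log 2 (1 + size_param n k)) ^ j"
    using time_bound_soft_O[OF mulcost, of \<kappa>'] by metis
  define T where "T i = C * g i * (1 + log 2 (1 + g i)) ^ j" for i
  have "soft_O_on I T g" by (auto simp: soft_O_on_def T_def)
  moreover have "\<exists>t s. exec mulcost w P (input_state w (inp i)) t s \<and> real t \<le> T i \<and>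
      real (result_of w s) = f i"
    if i: "i \<in> I" and w: "10 * log 2 (2 + g i) \<le> real w" "real w \<le> \<kappa>' * log 2 (2 + g i)" for i w
  proof -
    have fit: "fits w (n i) (k i)"
      using fits_large_word[OF n[OF i] k[OF i]] w g[OF i] by simp
    then have "1 \<le> w" by (simp add: fits_def)
    from C[OF n[OF i] k[OF i] this] have "real (time_bound mulcost w (n i) (k i)) \<le> T i"
      using w g[OF i] by (simp add: T_def)
    moreover obtain t s where "exec mulcost w P (input_state w (inp i)) t s"
      "t \<le> time_bound mulcost w (n i) (k i)" "real (result_of w s) = f i"
      using P[OF i fit] by blast
    ultimately show ?thesis by (meson of_nat_mono order_trans)
  qed
  ultimately show "\<exists>T. soft_O_on I T g \<and> (\<forall>i\<in>I. \<forall>w. 10 * log 2 (2 + g i) \<le> real w \<and>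
      real w \<le> \<kappa>' * log 2 (2 + g i) \<longrightarrow>
      (\<exists>t s. exec mulcost w P (input_state w (inp i)) t s \<and> real t \<le> T i \<and> real (result_of w s) = f i))"
    by blast
qed

lemma log_geo_total:
  assumes k: "1 \<le> k" and n: "1 \<le> n"
  shows "log 2 (real (geo_total (geo_base k) n)) \<le> 5 * size_param n k"
proof -
  have "log 2 (real (geo_total (geo_base k) n)) \<le> real ((clog k + 3) * n)"
    using geo_total_less[OF n, of k] geo_total_pos by (intro log2_of_power_le) (simp_all add: less_imp_le)
  also have "\<dots> \<le> 5 * (max 1 (log 2 (real k))) * real n"
  proof -
    have "real_of_int \<lceil>log 2 (2 * real k)\<rceil> < log 2 (2 * real k) + 1" by linarith
    then have "real (clog k) < 1 + log 2 (real k)"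
      using ceiling_log2_eq_clog[OF k] k by (simp add: log_mult)
    \<comment> \<open>The 5 is \<open>1 + 1 + 3\<close>: the coefficient of \<open>log k\<close>,
      the rounding in \<open>clog k\<close>, and the additive 3, each bounded by multiples of the
      maximum.\<close>
    then have "real (clog k + 3) \<le> 5 * max 1 (log 2 (real k))" by simp
    then have "real (clog k + 3) * real n \<le> 5 * max 1 (log 2 (real k)) * real n"
      by (rule mult_right_mono) simp
    then show ?thesis by simp
  qed
  finally show ?thesis by (simp add: size_param_def mult_ac)
qed

lemma reciprocalsE:
  assumes "\<epsilon> \<in> reciprocals"
  obtains k where "1 \<le> k" "\<epsilon> = 1 / real k" "recip \<epsilon> = k" "\<And>n. nlog n \<epsilon> = size_param n k"
proof -
  obtain k :: nat where "0 < k" "\<epsilon> = 1 / real k" using assms by (auto simp: reciprocals_def)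
  then show thesis by (intro that[of k]) (simp_all add: recip_def nlog_def size_param_def)
qed

theorem theorem4p6:
  fixes mulcost :: "nat \<Rightarrow> nat"
  assumes mulcost: "soft_O_on UNIV (\<lambda>x. real (mulcost x)) real"
  shows
    "(\<forall>\<epsilon>\<in>reciprocals. 4 / 9 * \<epsilon> < eps_tilde \<epsilon> \<and> eps_tilde \<epsilon> \<le> \<epsilon>) \<and>
     (\<exists>(d :: nat \<Rightarrow> real \<Rightarrow> nat) (GeoSample :: nat \<Rightarrow> real \<Rightarrow> nat \<Rightarrow> nat \<Rightarrow> nat).
        (\<exists>C::real. \<forall>n\<ge>1. \<forall>\<epsilon>\<in>reciprocals. log 2 (real (d n \<epsilon>)) \<le> C * nlog n \<epsilon>) \<and>
        (\<forall>n\<ge>1. \<forall>\<epsilon>\<in>reciprocals.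
           d n \<epsilon> \<ge> 1 \<and>
           (\<forall>c\<in>{0..n}. \<forall>u\<in>{1..d n \<epsilon>}. GeoSample n \<epsilon> c u \<in> {0..n}) \<and>
           (\<forall>c\<in>{0..n}. M_dist (d n \<epsilon>) (GeoSample n \<epsilon>) c =
                        map_pmf (clamp_to n) (geo (int c) (2 / eps_tilde \<epsilon>))) \<and>
           dp_counting n (d n \<epsilon>) (eps_tilde \<epsilon> / 2) 0 (GeoSample n \<epsilon>) \<and>
           (\<forall>\<beta>\<in>{0<..1}. accurate n (d n \<epsilon>) (of_int \<lceil>2 / eps_tilde \<epsilon> * ln (1 / \<beta>)\<rceil>) \<beta>
                           (GeoSample n \<epsilon>)) \<and>
           (\<forall>c\<in>{0..n}. mono_on {1..d n \<epsilon>} (GeoSample n \<epsilon> c))) \<and>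
        computable_in_soft_O mulcost
          {(n, \<epsilon>, c, u). n \<ge> 1 \<and> \<epsilon> \<in> reciprocals \<and> c \<in> {0..n} \<and> u \<in> {1..d n \<epsilon>}}
          (\<lambda>(n, \<epsilon>, c, u). nlog n \<epsilon>) (\<lambda>(n, \<epsilon>, c, u). nlog n \<epsilon>)
          (\<lambda>(n, \<epsilon>, c, u). [n, recip \<epsilon>, c, u])
          (\<lambda>(n, \<epsilon>, c, u). real (GeoSample n \<epsilon> c u)) \<and>
        computable_in_soft_O mulcost
          {(n, \<epsilon>, z). n \<ge> 1 \<and> \<epsilon> \<in> reciprocals \<and> z \<in> {0..n}}
          (\<lambda>(n, \<epsilon>, z). nlog n \<epsilon>) (\<lambda>(n, \<epsilon>, z). nlog n \<epsilon>)
          (\<lambda>(n, \<epsilon>, z). [n, recip \<epsilon>, z])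
          (\<lambda>(n, \<epsilon>, z). scaled_cdf (d n \<epsilon>) (GeoSample n \<epsilon>) z))"
proof (rule conjI, goal_cases)
  case 1
  show ?case
  proof
    fix \<epsilon> assume "\<epsilon> \<in> reciprocals"
    then obtain k where "1 \<le> k" "\<epsilon> = 1 / real k" by (rule reciprocalsE)
    then show "4 / 9 * \<epsilon> < eps_tilde \<epsilon> \<and> eps_tilde \<epsilon> \<le> \<epsilon>"
      using eps_tilde_bounds by simp
  qed
next
  case 2
  define d where "d n \<epsilon> = geo_total (geo_base (recip \<epsilon>)) n" for n \<epsilon>
  define G where "G n \<epsilon> = geo_sample (geo_base (recip \<epsilon>)) n" for n \<epsilon>
  have bits: "\<exists>C::real. \<forall>n\<ge>1. \<forall>\<epsilon>\<in>reciprocals. log 2 (real (d n \<epsilon>)) \<le> C * nlog n \<epsilon>"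
  proof (rule exI[of _ 5], intro allI impI ballI)
    fix n :: nat and \<epsilon> assume "1 \<le> n" "\<epsilon> \<in> reciprocals"
    then show "log 2 (real (d n \<epsilon>)) \<le> 5 * nlog n \<epsilon>"
      using log_geo_total by (auto simp: d_def elim!: reciprocalsE)
  qed
  have sampler: "d n \<epsilon> \<ge> 1 \<and>
      (\<forall>c\<in>{0..n}. \<forall>u\<in>{1..d n \<epsilon>}. G n \<epsilon> c u \<in> {0..n}) \<and>
      (\<forall>c\<in>{0..n}. M_dist (d n \<epsilon>) (G n \<epsilon>) c =
                   map_pmf (clamp_to n) (geo (int c) (2 / eps_tilde \<epsilon>))) \<and>
      dp_counting n (d n \<epsilon>) (eps_tilde \<epsilon> / 2) 0 (G n \<epsilon>) \<and>
      (\<forall>\<beta>\<in>{0<..1}. accurate n (d n \<epsilon>) (of_int \<lceil>2 / eps_tilde \<epsilon> * ln (1 / \<beta>)\<rceil>) \<beta> (G n \<epsilon>)) \<and>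
      (\<forall>c\<in>{0..n}. mono_on {1..d n \<epsilon>} (G n \<epsilon> c))" if n: "n \<ge> 1" and "\<epsilon> \<in> reciprocals" for n \<epsilon>
  proof -
    obtain k where k: "1 \<le> k" "\<epsilon> = 1 / real k" "recip \<epsilon> = k"
      using \<open>\<epsilon> \<in> reciprocals\<close> by (rule reciprocalsE)
    \<comment> \<open>By the Galois connection: \<open>u \<le> v\<close>, and \<open>v\<close> is at
      most the value of \<open>geo_cdf\<close> at the sample for \<open>v\<close>.\<close>
    have "mono_on {1..d n \<epsilon>} (G n \<epsilon> c)" if "c \<le> n" for c
    proof (rule mono_onI)
      fix u v assume "u \<in> {1..d n \<epsilon>}" "v \<in> {1..d n \<epsilon>}" "u \<le> v"
      then have "u \<le> geo_cdf (geo_base k) n c (geo_sample (geo_base k) n c v)"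
        using geo_sample_le_iff[OF that, of v "geo_base k"] k by (auto simp: d_def intro: order_trans)
      then show "G n \<epsilon> c u \<le> G n \<epsilon> c v"
        using \<open>u \<in> _\<close> k geo_sample_le_iff[OF that, of u "geo_base k"] by (simp add: d_def G_def)
    qed
    moreover have "d n \<epsilon> \<ge> 1" using geo_total_pos by (simp add: d_def Suc_le_eq)
    ultimately show ?thesis
      using k n M_dist_geo_sample[OF k(1) n] dp_counting_geo_sample[OF k(1) n]
        accurate_geo_sample[OF k(1) n] geo_sample_le[of _ n _ "geo_base k"]
      by (simp add: d_def G_def)
  qed
  have time_sample: "computable_in_soft_O mulcost
      {(n, \<epsilon>, c, u). n \<ge> 1 \<and> \<epsilon> \<in> reciprocals \<and> c \<in> {0..n} \<and> u \<in> {1..d n \<epsilon>}}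
      (\<lambda>(n, \<epsilon>, c, u). nlog n \<epsilon>) (\<lambda>(n, \<epsilon>, c, u). nlog n \<epsilon>)
      (\<lambda>(n, \<epsilon>, c, u). [n, recip \<epsilon>, c, u]) (\<lambda>(n, \<epsilon>, c, u). real (G n \<epsilon> c u))"
  proof (rule computable_in_soft_O_time_bound[OF mulcost, where P = sample_com and
        n = fst and k = "\<lambda>(n, \<epsilon>, c, u). recip \<epsilon>"], goal_cases)
    case (4 i w)
    then show ?case
      using exec_sample_com[of w "fst i" "recip (fst (snd i))"]
      by (auto simp: d_def G_def elim!: reciprocalsE)
  qed (auto elim!: reciprocalsE)
  have time_cdf: "computable_in_soft_O mulcost
      {(n, \<epsilon>, z). n \<ge> 1 \<and> \<epsilon> \<in> reciprocals \<and> z \<in> {0..n}}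
      (\<lambda>(n, \<epsilon>, z). nlog n \<epsilon>) (\<lambda>(n, \<epsilon>, z). nlog n \<epsilon>)
      (\<lambda>(n, \<epsilon>, z). [n, recip \<epsilon>, z]) (\<lambda>(n, \<epsilon>, z). scaled_cdf (d n \<epsilon>) (G n \<epsilon>) z)"
  proof (rule computable_in_soft_O_time_bound[OF mulcost, where P = cdf_com and
        n = fst and k = "\<lambda>(n, \<epsilon>, z). recip \<epsilon>"], goal_cases)
    case (4 i w)
    have "scaled_cdf (d n \<epsilon>) (G n \<epsilon>) z = geo_cdf (geo_base (recip \<epsilon>)) n 0 z" for n \<epsilon> z
      using prob_geo_sample[of 0 n "geo_base (recip \<epsilon>)" z] geo_total_pos[of "geo_base (recip \<epsilon>)" n]
      by (simp add: scaled_cdf_def d_def G_def atMost_def)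
    with 4 show ?case
      using exec_cdf_com[of w "fst i" "recip (fst (snd i))"]
      by (auto elim!: reciprocalsE)
  qed (auto elim!: reciprocalsE)
  show ?case
    by (rule exI[of _ d], rule exI[of _ G],
        rule conjI[OF bits conjI[OF _ conjI[OF time_sample time_cdf]]],
        intro allI impI ballI, rule sampler)
qed

end
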